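(* Let $\Omega\subset\mathbb R^d$ be a bounded Lipschitz domain, let $s>0$ and $0<p,q\le\infty$ satisfy $s>d/p$ (so that $B^s_q(L_p(\Omega))\subset L_\infty(\Omega)$), and let $k=\lfloor s\rfloor+1$. If $u,v\in B^s_q(L_p(\Omega))$, then $uv\in B^s_q(L_p(\Omega))$ and $$|uv|_{B^s_q(L_p(\Omega))}\le C\sum_{j=0}^k|u|_{B^{sj/k}_q(L_{pk/j}(\Omega))}\,|v|_{B^{s(k-j)/k}_q(L_{pk/(k-j)}(\Omega))},$$ with the convention that $B^0_q(L_{pk/0}(\Omega))=L_\infty(\Omega)$ and $|\cdot|_{B^0_q(L_{pk/0}(\Omega))}=\|\cdot\|_{L_\infty(\Omega)}$. The constant $C$ does not depend on $u,v$ and is invariant under dilations of $\Omega$.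
   Context: Besov spaces: for $h\in\mathbb R^d$, $m\in\mathbb N$, $\Delta_h^mu(x)=\sum_{j=0}^m(-1)^{m+j}\binom mj u(x+jh)$ if $x+\tau mh\in\Omega$ for all $\tau\in[0,1]$, and $\Delta_h^mu(x)=0$ otherwise. Modulus of smoothness: $\omega_m(u,t)_p=\sup_{|h|\le t}\|\Delta_h^mu\|_{L_p(\Omega)}$, $t>0$. For $s>0$, $0<p,q\le\infty$ and $m:=\lfloor s\rfloor+1$, $|u|_{B^s_q(L_p(\Omega))}:=\big(\int_0^\infty[t^{-s}\omega_m(u,t)_p]^q\frac{dt}t\big)^{1/q}$ if $q<\infty$ and $\sup_{t>0}t^{-s}\omega_m(u,t)_p$ if $q=\infty$; $B^s_q(L_p(\Omega))$ is the set of $u\in L_p(\Omega)$ with $|u|_{B^s_q(L_p(\Omega))}<\infty$, with (quasi-)norm $\|u\|_{L_p(\Omega)}+|u|_{B^s_q(L_p(\Omega))}$. *)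

theory Defs
  imports "HOL-Analysis.Analysis" "HOL-Probability.Essential_Supremum"
begin

text \<open>
  The exponents \<open>p, q\<close> lie in \<open>(0, \<infinity>]\<close> and are modelled by \<^typ>\<open>ennreal\<close>; all norms and
  seminorms take values in \<^typ>\<open>ennreal\<close>, so that they are defined for every function.
  Functions on \<open>\<Omega>\<close> are total functions whose values outside \<open>\<Omega>\<close> are never used.
\<close>

text \<open>Real powers on \<open>[0, \<infinity>]\<close>; only meant for exponents \<open>a > 0\<close> (hence \<open>\<infinity>\<^sup>a = \<infinity>\<close>, \<open>0\<^sup>a = 0\<close>).\<close>

definition ennreal_rpow :: "ennreal \<Rightarrow> real \<Rightarrow> ennreal" where
  "ennreal_rpow x a = (if x = \<infinity> then \<infinity> else ennreal (enn2real x powr a))"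

text \<open>
  Near each boundary point and after a rotation (\<open>e\<close> is the new vertical direction, \<open>e\<^sup>\<bottom>\<close> the
  horizontal hyperplane), \<open>\<Omega>\<close> is the strict epigraph of a Lipschitz function on \<open>e\<^sup>\<bottom>\<close>.
\<close>

definition bounded_lipschitz_domain :: "'a::euclidean_space set \<Rightarrow> bool" where
  "bounded_lipschitz_domain \<Omega> \<longleftrightarrow>
     open \<Omega> \<and> connected \<Omega> \<and> \<Omega> \<noteq> {} \<and> bounded \<Omega> \<and>
     (\<forall>z\<in>frontier \<Omega>. \<exists>e \<rho> L. \<exists>\<phi> :: 'a \<Rightarrow> real.
        norm e = 1 \<and> \<rho> > 0 \<and> L-lipschitz_on {y. y \<bullet> e = 0} \<phi> \<and>
        \<Omega> \<inter> ball z \<rho> = {x \<in> ball z \<rho>. \<phi> (x - (x \<bullet> e) *\<^sub>R e) < x \<bullet> e})"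

definition Lp_norm :: "ennreal \<Rightarrow> 'a::euclidean_space set \<Rightarrow> ('a \<Rightarrow> real) \<Rightarrow> ennreal" where
  "Lp_norm p \<Omega> u =
     (if p = \<infinity> then esssup (lebesgue_on \<Omega>) (\<lambda>x. ennreal \<bar>u x\<bar>)
      else ennreal_rpow (\<integral>\<^sup>+x. ennreal (\<bar>u x\<bar> powr enn2real p) \<partial>lebesgue_on \<Omega>) (1 / enn2real p))"

definition Lp_space :: "ennreal \<Rightarrow> 'a::euclidean_space set \<Rightarrow> ('a \<Rightarrow> real) set" where
  "Lp_space p \<Omega> = {u \<in> borel_measurable (lebesgue_on \<Omega>). Lp_norm p \<Omega> u < \<infinity>}"

definition diff_op ::
  "'a::euclidean_space set \<Rightarrow> nat \<Rightarrow> 'a \<Rightarrow> ('a \<Rightarrow> real) \<Rightarrow> 'a \<Rightarrow> real" where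
  "diff_op \<Omega> m h u x =
     (if \<forall>\<tau>\<in>{0..1}. x + (\<tau> * real m) *\<^sub>R h \<in> \<Omega>
      then \<Sum>j\<le>m. (-1) ^ (m + j) * real (m choose j) * u (x + real j *\<^sub>R h)
      else 0)"

definition modulus_smoothness ::
  "nat \<Rightarrow> ennreal \<Rightarrow> 'a::euclidean_space set \<Rightarrow> ('a \<Rightarrow> real) \<Rightarrow> real \<Rightarrow> ennreal" where
  "modulus_smoothness m p \<Omega> u t = (SUP h\<in>{h. norm h \<le> t}. Lp_norm p \<Omega> (diff_op \<Omega> m h u))"

text \<open>The seminorm of \<open>B\<^sup>s\<^sub>q(L\<^sub>p(\<Omega>))\<close> for \<open>s > 0\<close>.\<close>

definition besov_seminorm_pos ::
  "real \<Rightarrow> ennreal \<Rightarrow> ennreal \<Rightarrow> 'a::euclidean_space set \<Rightarrow> ('a \<Rightarrow> real) \<Rightarrow> ennreal" where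
  "besov_seminorm_pos s q p \<Omega> u =
     (let m = nat \<lfloor>s\<rfloor> + 1;
          g = (\<lambda>t. ennreal (t powr (- s)) * modulus_smoothness m p \<Omega> u t)
      in if q = \<infinity> then SUP t\<in>{0<..}. g t
         else ennreal_rpow
                (\<integral>\<^sup>+t\<in>{0<..}. ennreal_rpow (g t) (enn2real q) / ennreal t \<partial>lborel)
                (1 / enn2real q))"

text \<open>
  Extension to \<open>s = 0\<close>, which is only meant for \<open>p = \<infinity>\<close>: by convention the seminorm of
  \<open>B\<^sup>0\<^sub>q(L\<^sub>\<infinity>(\<Omega>))\<close> is the \<open>L\<^sub>\<infinity>\<close> norm.
\<close>

definition besov_seminorm ::
  "real \<Rightarrow> ennreal \<Rightarrow> ennreal \<Rightarrow> 'a::euclidean_space set \<Rightarrow> ('a \<Rightarrow> real) \<Rightarrow> ennreal" where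
  "besov_seminorm s q p \<Omega> u =
     (if s = 0 then Lp_norm \<infinity> \<Omega> u else besov_seminorm_pos s q p \<Omega> u)"

definition besov_space ::
  "real \<Rightarrow> ennreal \<Rightarrow> ennreal \<Rightarrow> 'a::euclidean_space set \<Rightarrow> ('a \<Rightarrow> real) set" where
  "besov_space s q p \<Omega> = {u \<in> Lp_space p \<Omega>. besov_seminorm s q p \<Omega> u < \<infinity>}"

end

theory Submission
  imports Defs "HOL-Computational_Algebra.Polynomial"
begin

text \<open>
  The product rule for \<open>k\<close>-th differences and Hoelder's inequality with exponents \<open>p k / j\<close> and
  \<open>p k / (k - j)\<close> bound \<open>\<omega>\<^sub>k(uv, t)\<close> by the products of \<open>\<omega>\<^sub>j(u, t)\<close> and \<open>\<omega>\<^bsub>k-j\<^esub>(v, t)\<close>. As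
  \<open>s j / k < j\<close>, each \<open>\<omega>\<^sub>j\<close> is dominated by the modulus that defines the seminorm of order
  \<open>s j / k\<close>; one factor is then estimated by its supremum in \<open>t\<close>, which monotonicity of the
  modulus controls by the seminorm. No property of the domain enters, so the constant is
  dilation invariant.

  Membership of \<open>uv\<close> needs finite intermediate terms, and here the interior cones of a Lipschitz
  domain are used. If \<open>u\<close> is bounded, interpolating between \<open>L\<^sub>p\<close> and \<open>L\<^sub>\<infinity>\<close> gives
  \<open>t\<^bsup>-sj/k\<^esup> \<omega>\<^sub>k(u, t)\<close> in \<open>L\<^bsub>qk/j\<^esub>(dt / t)\<close>, a weak Marchaud inequality lowers the order from \<open>k\<close>
  to \<open>j\<close>, and Hoelder's inequality in \<open>t\<close> applies. Boundedness of \<open>u\<close> for \<open>s p > d\<close> is proved by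
  comparing the measures of superlevel sets: if \<open>\<bar>u(x)\<bar>\<close> is large, then for most \<open>h\<close> in a cone
  either \<open>\<Delta>\<^sup>k\<^sub>hu(x)\<close> or some \<open>u(x + ih)\<close> is large. For \<open>k > 1\<close> this yields only \<open>u \<in> L\<^sub>R\<close> for all finite
  \<open>R\<close>; after interpolation and a reduction to \<open>k = 1\<close> by Marchaud's inequality, a De Giorgi
  iteration gives a bound.
\<close>

section \<open>Real powers and quasi-norms on \<open>[0, \<infinity>]\<close>\<close>

text \<open>Only finite sums are estimated, each at the price of a constant depending on the number
  of terms, and Marchaud's inequality takes the form of a recursion from t to N t whose last term is
  absorbed into the left-hand side. The two claims rest on different estimates. Interpolation with
  L_inf controls smoothness of order s j / k with the fine index q k / j, which exceeds q for 0 < j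
  < k and finite q, so it does not yield the seminorms of index q that stand on the right of the
  inequality. For membership this index is nevertheless the right one: the reciprocals j / (q k) and
  (k - j) / (q k) add up to 1 / q, so Hoelder's inequality in t gives the index q for the
  product.\<close>

lemma ennreal_rpow_ennreal: "0 \<le> r \<Longrightarrow> ennreal_rpow (ennreal r) a = ennreal (r powr a)"
  by (simp add: ennreal_rpow_def)

lemma ennreal_rpow_top [simp]: "ennreal_rpow top a = top"
  by (simp add: ennreal_rpow_def)

lemma ennreal_rpow_0 [simp]: "ennreal_rpow 0 a = 0"
  by (simp add: ennreal_rpow_def)

lemma ennreal_rpow_1 [simp]: "ennreal_rpow x 1 = x"
  by (cases x) (auto simp: ennreal_rpow_def)

lemma ennreal_rpow_eq_0_iff [simp]: "ennreal_rpow x a = 0 \<longleftrightarrow> x = 0"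
  by (cases x) (auto simp: ennreal_rpow_def)

lemma ennreal_rpow_eq_top_iff [simp]: "ennreal_rpow x a = top \<longleftrightarrow> x = top"
  by (cases x) (auto simp: ennreal_rpow_def)

lemma ennreal_rpow_less_top_iff [simp]: "ennreal_rpow x a < top \<longleftrightarrow> x < top"
  by (simp add: less_top[symmetric])

lemma ennreal_rpow_mono: "x \<le> y \<Longrightarrow> a \<ge> 0 \<Longrightarrow> ennreal_rpow x a \<le> ennreal_rpow y a"
  by (cases x; cases y) (auto simp: ennreal_rpow_def intro!: ennreal_leI powr_mono2 simp: top_unique)

lemma ennreal_rpow_mult: "ennreal_rpow (x * y) a = ennreal_rpow x a * ennreal_rpow y a"
  by (cases x; cases y)
     (auto simp: ennreal_rpow_ennreal ennreal_mult[symmetric] powr_mult ennreal_mult_top ennreal_top_mult)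

lemma ennreal_rpow_rpow: "ennreal_rpow (ennreal_rpow x a) b = ennreal_rpow x (a * b)"
  by (cases x) (auto simp: ennreal_rpow_ennreal powr_powr)

lemma ennreal_rpow_add: "ennreal_rpow x a * ennreal_rpow x b = ennreal_rpow x (a + b)"
  by (cases x) (auto simp: ennreal_rpow_ennreal ennreal_mult[symmetric] powr_add ennreal_mult_top)

lemma ennreal_rpow_le_iff: "a > 0 \<Longrightarrow> ennreal_rpow x a \<le> y \<longleftrightarrow> x \<le> ennreal_rpow y (1 / a)"
  using ennreal_rpow_mono[of x "ennreal_rpow y (1/a)" a]
    ennreal_rpow_mono[of "ennreal_rpow x a" y "1/a"] by (auto simp: ennreal_rpow_rpow)

lemma measurable_ennreal_rpow [measurable (raw)]:
  assumes [measurable]: "f \<in> borel_measurable M"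
  shows "(\<lambda>x. ennreal_rpow (f x) a) \<in> borel_measurable M"
  unfolding ennreal_rpow_def by measurable

text \<open>Each summand is at most the largest one, whose power occurs in the sum on the right. The
  crude factor is the price for a bound valid for all a > 0, where convexity would serve only a >=
  1.\<close>

lemma ennreal_rpow_sum_le:
  assumes "finite I" "a > 0"
  shows "ennreal_rpow (\<Sum>i\<in>I. f i) a \<le> ennreal (real (card I) powr a) * (\<Sum>i\<in>I. ennreal_rpow (f i) a)"
proof (cases "I = {}")
  case False
  then have "Max (f ` I) \<in> f ` I" using assms by simp
  then obtain i where i: "i \<in> I" "f i = Max (f ` I)" by (metis imageE)
  then have "\<And>j. j \<in> I \<Longrightarrow> f j \<le> f i" using assms by simp
  then have "(\<Sum>i\<in>I. f i) \<le> of_nat (card I) * f i" by (rule sum_bounded_above)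
  then have "ennreal_rpow (\<Sum>i\<in>I. f i) a \<le> ennreal_rpow (of_nat (card I) * f i) a"
    using assms by (intro ennreal_rpow_mono) auto
  also have "\<dots> = ennreal (real (card I) powr a) * ennreal_rpow (f i) a"
    by (simp add: ennreal_rpow_mult ennreal_rpow_ennreal flip: ennreal_of_nat_eq_real_of_nat
        ennreal_rpow_ennreal)
  also have "\<dots> \<le> ennreal (real (card I) powr a) * (\<Sum>i\<in>I. ennreal_rpow (f i) a)"
    using i assms by (intro mult_left_mono member_le_sum) auto
  finally show ?thesis .
qed simp

section \<open>Hoelder's inequality for functions with values in [0, infinity]\<close>

lemma Youngs_inequality_ennreal:
  assumes "a > 0" "b > 0" "a + b = 1"
  shows "ennreal_rpow x a * ennreal_rpow y b \<le> ennreal a * x + ennreal b * y"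
proof (cases "x = top \<or> y = top")
  case True
  then show ?thesis using assms by (auto simp: ennreal_mult_top ennreal_top_mult)
next
  case False
  then obtain r s where rs: "x = ennreal r" "y = ennreal s" "0 \<le> r" "0 \<le> s"
    by (metis ennreal_cases)
  have "r powr a * s powr b \<le> a * r + b * s"
  proof (cases "r = 0 \<or> s = 0")
    case False
    then show ?thesis using Youngs_inequality_0[of a b r s] assms rs by simp
  qed (use assms rs in auto)
  then show ?thesis using rs assms
    by (auto simp: ennreal_rpow_ennreal ennreal_mult[symmetric] ennreal_plus[symmetric] simp del: ennreal_plus
      intro!: ennreal_leI)
qed

text \<open>Young's inequality for the normalised functions f / F and g / G is integrated. A zero or
  infinite integral forbids the normalisation and is treated apart.\<close>

lemma nn_integral_Holder:
  assumes [measurable]: "f \<in> borel_measurable M" "g \<in> borel_measurable M"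
    and ab: "a > 0" "b > 0" "a + b = 1"
  shows "(\<integral>\<^sup>+x. ennreal_rpow (f x) a * ennreal_rpow (g x) b \<partial>M)
    \<le> ennreal_rpow (\<integral>\<^sup>+x. f x \<partial>M) a * ennreal_rpow (\<integral>\<^sup>+x. g x \<partial>M) b"
proof -
  define F where "F = (\<integral>\<^sup>+x. f x \<partial>M)"
  define G where "G = (\<integral>\<^sup>+x. g x \<partial>M)"
  consider "F = 0 \<or> G = 0" | "F \<noteq> 0" "G \<noteq> 0" "F = top \<or> G = top" | "F \<noteq> 0" "G \<noteq> 0" "F \<noteq> top" "G \<noteq> top"
    by blast
  then show ?thesis
  proof cases
    case 1
    then have "(AE x in M. f x = 0) \<or> (AE x in M. g x = 0)"
      unfolding F_def G_def by (simp add: nn_integral_0_iff_AE)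
    then have "AE x in M. ennreal_rpow (f x) a * ennreal_rpow (g x) b = 0" by auto
    then have "(\<integral>\<^sup>+x. ennreal_rpow (f x) a * ennreal_rpow (g x) b \<partial>M) = 0"
      by (subst nn_integral_0_iff_AE) auto
    then show ?thesis by simp
  next
    case 2
    then show ?thesis unfolding F_def[symmetric] G_def[symmetric]
      by (auto simp: ennreal_mult_top ennreal_top_mult)
  next
    case 3
    have F1: "F * inverse F = 1" "G * inverse G = 1"
      using 3 by (auto simp: divide_ennreal_def[symmetric] less_top intro!: ennreal_divide_self)
    have "(\<integral>\<^sup>+x. ennreal_rpow (f x) a * ennreal_rpow (g x) b \<partial>M)
      = (\<integral>\<^sup>+x. (ennreal_rpow F a * ennreal_rpow G b) *
          (ennreal_rpow (f x * inverse F) a * ennreal_rpow (g x * inverse G) b) \<partial>M)"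
    proof (rule nn_integral_cong)
      fix x
      have "(ennreal_rpow F a * ennreal_rpow G b) *
          (ennreal_rpow (f x * inverse F) a * ennreal_rpow (g x * inverse G) b)
        = ennreal_rpow (f x * (F * inverse F)) a * ennreal_rpow (g x * (G * inverse G)) b"
        unfolding ennreal_rpow_mult by (simp only: ac_simps)
      then show "ennreal_rpow (f x) a * ennreal_rpow (g x) b = (ennreal_rpow F a * ennreal_rpow G b) *
          (ennreal_rpow (f x * inverse F) a * ennreal_rpow (g x * inverse G) b)"
        using F1 by simp
    qed
    also have "\<dots> \<le> (\<integral>\<^sup>+x. (ennreal_rpow F a * ennreal_rpow G b) *
          (ennreal a * (f x * inverse F) + ennreal b * (g x * inverse G)) \<partial>M)"
      by (intro nn_integral_mono mult_left_mono Youngs_inequality_ennreal ab) auto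
    also have "\<dots> = (ennreal_rpow F a * ennreal_rpow G b) * (ennreal a * (F * inverse F) + ennreal b * (G * inverse G))"
      by (simp add: nn_integral_cmult nn_integral_multc nn_integral_add F_def G_def)
    also have "\<dots> = ennreal_rpow F a * ennreal_rpow G b"
      using F1 ab by (simp add: ennreal_plus[symmetric] del: ennreal_plus)
    finally show ?thesis by (simp add: F_def G_def)
  qed
qed

text \<open>One quasi-norm on an arbitrary measure space, so that the sum and Hoelder inequalities
  are proved once and serve both L_p on the domain and L_q with respect to dt / t.\<close>

definition lnorm :: "ennreal \<Rightarrow> 'b measure \<Rightarrow> ('b \<Rightarrow> ennreal) \<Rightarrow> ennreal" where
  "lnorm P M f = (if P = \<infinity> then esssup M f
    else ennreal_rpow (\<integral>\<^sup>+x. ennreal_rpow (f x) (enn2real P) \<partial>M) (1 / enn2real P))"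

lemma lnorm_mono_AE:
  assumes "P > 0" "f \<in> borel_measurable M" "AE x in M. f x \<le> g x"
  shows "lnorm P M f \<le> lnorm P M g"
proof (cases "P = \<infinity>")
  case True
  then show ?thesis using assms by (simp add: lnorm_def esssup_AE_mono)
next
  case False
  have "AE x in M. ennreal_rpow (f x) (enn2real P) \<le> ennreal_rpow (g x) (enn2real P)"
    using assms(3) by eventually_elim (simp add: ennreal_rpow_mono)
  then show ?thesis using False
    by (simp add: lnorm_def ennreal_rpow_mono nn_integral_mono_AE)
qed

lemma enn2real_pos: "P > 0 \<Longrightarrow> P \<noteq> top \<Longrightarrow> enn2real P > 0"
  by (simp add: enn2real_positive_iff less_top)

lemma lnorm_cmult_le:
  assumes "P > 0" and [measurable]: "f \<in> borel_measurable M"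
  shows "lnorm P M (\<lambda>x. c * f x) \<le> c * lnorm P M f"
proof (cases "P = \<infinity>")
  case True
  have "esssup M (\<lambda>x. c * f x) \<le> c * esssup M f"
  proof (rule esssup_I)
    show "AE x in M. c * f x \<le> c * esssup M f"
      using esssup_AE[of f M] by eventually_elim (rule mult_left_mono, auto)
  qed measurable
  then show ?thesis using True by (simp add: lnorm_def)
next
  case False
  with assms enn2real_pos[of P] show ?thesis
    by (simp add: lnorm_def ennreal_rpow_mult nn_integral_cmult ennreal_rpow_rpow)
qed

text \<open>For \<open>P = \<infinity>\<close> the junk values \<open>enn2real \<infinity> = 0\<close> and \<open>1 / 0 = 0\<close> give the constant \<open>n\<close>.\<close>

definition quasi_const :: "ennreal \<Rightarrow> nat \<Rightarrow> real" where
  "quasi_const P n = real n powr (1 + 1 / enn2real P)"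

lemma quasi_const_nonneg: "quasi_const P n \<ge> 0"
  by (simp add: quasi_const_def)

lemma lnorm_sum_le:
  assumes P: "P > 0" and I: "finite I" and [measurable]: "\<And>i. i \<in> I \<Longrightarrow> f i \<in> borel_measurable M"
  shows "lnorm P M (\<lambda>x. \<Sum>i\<in>I. f i x) \<le> ennreal (quasi_const P (card I)) * (\<Sum>i\<in>I. lnorm P M (f i))"
proof (cases "I = {}")
  case True
  then show ?thesis using lnorm_cmult_le[OF P, of "\<lambda>_. 0" M 0] by simp
next
  case ne: False
  then have n: "card I \<ge> 1" using I by (simp add: Suc_leI card_gt_0_iff)
  show ?thesis
  proof (cases "P = \<infinity>")
    case True
    have "esssup M (\<lambda>x. \<Sum>i\<in>I. f i x) \<le> (\<Sum>i\<in>I. esssup M (f i))"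
    proof (rule esssup_I)
      have "AE x in M. \<forall>i\<in>I. f i x \<le> esssup M (f i)"
        using I by (intro AE_finite_allI esssup_AE)
      then show "AE x in M. (\<Sum>i\<in>I. f i x) \<le> (\<Sum>i\<in>I. esssup M (f i))"
        by eventually_elim (auto intro: sum_mono)
    qed measurable
    also have "\<dots> \<le> ennreal (quasi_const P (card I)) * (\<Sum>i\<in>I. esssup M (f i))"
    proof -
      have "1 \<le> ennreal (quasi_const P (card I))"
        using n True by (simp add: quasi_const_def flip: ennreal_1)
      from mult_right_mono[OF this] show ?thesis by fastforce
    qed
    finally show ?thesis using True by (simp add: lnorm_def)
  next
    case False
    define p where "p = enn2real P"
    have p: "p > 0" using enn2real_pos P False p_def by simp
    define A where "A = (\<lambda>i. \<integral>\<^sup>+x. ennreal_rpow (f i x) p \<partial>M)"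
    \<comment> \<open>The bound for powers of sums is used twice, with exponent p under the integral
      and with 1 / p outside. This produces n * n^(1/p), the value of
      \<open>quasi_const\<close>.\<close>
    let ?n = "real (card I)"
    have "(\<integral>\<^sup>+x. ennreal_rpow (\<Sum>i\<in>I. f i x) p \<partial>M)
        \<le> (\<integral>\<^sup>+x. ennreal (?n powr p) * (\<Sum>i\<in>I. ennreal_rpow (f i x) p) \<partial>M)"
      by (intro nn_integral_mono ennreal_rpow_sum_le I p)
    also have "\<dots> = ennreal (?n powr p) * (\<Sum>i\<in>I. A i)"
      by (simp add: nn_integral_cmult nn_integral_sum A_def)
    finally have "ennreal_rpow (\<integral>\<^sup>+x. ennreal_rpow (\<Sum>i\<in>I. f i x) p \<partial>M) (1/p)
       \<le> ennreal_rpow (ennreal (?n powr p) * (\<Sum>i\<in>I. A i)) (1/p)"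
      using p by (intro ennreal_rpow_mono) auto
    also have "\<dots> = ennreal ?n * ennreal_rpow (\<Sum>i\<in>I. A i) (1/p)"
      using p by (simp add: ennreal_rpow_mult ennreal_rpow_ennreal powr_powr)
    also have "\<dots> \<le> ennreal ?n * (ennreal (?n powr (1/p)) * (\<Sum>i\<in>I. ennreal_rpow (A i) (1/p)))"
      using p I by (intro mult_left_mono ennreal_rpow_sum_le) auto
    also have "\<dots> = ennreal (quasi_const P (card I)) * (\<Sum>i\<in>I. ennreal_rpow (A i) (1/p))"
      using n by (simp add: quasi_const_def p_def powr_add ennreal_mult mult.assoc)
    finally show ?thesis using False by (simp add: lnorm_def p_def A_def)
  qed
qed

lemma lnorm_Holder:
  assumes [measurable]: "f \<in> borel_measurable M" "g \<in> borel_measurable M"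
    and ab: "a > 0" "b > 0" "a + b = 1" and p: "p > 0" 
    and P: "P = ennreal p" "P1 = ennreal (p / a)" "P2 = ennreal (p / b)"
  shows "lnorm P M (\<lambda>x. f x * g x) \<le> lnorm P1 M f * lnorm P2 M g"
proof -
  have "(\<integral>\<^sup>+x. ennreal_rpow (f x * g x) p \<partial>M)
    = (\<integral>\<^sup>+x. ennreal_rpow (ennreal_rpow (f x) (p/a)) a * ennreal_rpow (ennreal_rpow (g x) (p/b)) b \<partial>M)"
    using ab by (simp add: ennreal_rpow_rpow ennreal_rpow_mult)
  also have "\<dots> \<le> ennreal_rpow (\<integral>\<^sup>+x. ennreal_rpow (f x) (p/a) \<partial>M) a * ennreal_rpow (\<integral>\<^sup>+x. ennreal_rpow (g x) (p/b) \<partial>M) b"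
    by (intro nn_integral_Holder ab) auto
  finally have "ennreal_rpow (\<integral>\<^sup>+x. ennreal_rpow (f x * g x) p \<partial>M) (1/p)
     \<le> ennreal_rpow (ennreal_rpow (\<integral>\<^sup>+x. ennreal_rpow (f x) (p/a) \<partial>M) a * ennreal_rpow (\<integral>\<^sup>+x. ennreal_rpow (g x) (p/b) \<partial>M) b) (1/p)"
    using p by (intro ennreal_rpow_mono) auto
  then show ?thesis using P p ab by (simp add: lnorm_def ennreal_rpow_mult ennreal_rpow_rpow)
qed

section \<open>Finite differences\<close>

text \<open>The difference without the domain test in \<open>diff_op\<close>, so that the algebra of
  differences holds at every point; the test is handled separately through
  \<open>seg_dom\<close>.\<close>

definition fdiff :: "nat \<Rightarrow> 'a::real_vector \<Rightarrow> ('a \<Rightarrow> real) \<Rightarrow> 'a \<Rightarrow> real" where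
  "fdiff m h u x = (\<Sum>j\<le>m. (-1) ^ (m + j) * real (m choose j) * u (x + real j *\<^sub>R h))"

lemma fdiff_0 [simp]: "fdiff 0 h u x = u x"
  by (simp add: fdiff_def)

lemma fdiff_Suc: "fdiff (Suc m) h u x = fdiff m h u (x + h) - fdiff m h u x"
proof -
  define a where "a = (\<lambda>j. u (x + real j *\<^sub>R h))"
  have 1: "fdiff m h u (x + h) = (\<Sum>j\<le>m. (-1) ^ (m + j) * real (m choose j) * a (Suc j))"
    by (simp add: fdiff_def a_def algebra_simps)
  have 2: "fdiff m h u x = (\<Sum>j\<le>m. (-1) ^ (m + j) * real (m choose j) * a j)"
    by (simp add: fdiff_def a_def)
  have 3: "fdiff m h u x = (-1)^m * a 0 - (\<Sum>j\<le>m. (-1) ^ (m + j) * real (m choose Suc j) * a (Suc j))"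
  proof -
    have "(\<Sum>j\<le>m. (-1) ^ (m + j) * real (m choose j) * a j) =
      (\<Sum>j\<le>Suc m. (-1) ^ (m + j) * real (m choose j) * a j)"
      by (simp add: binomial_eq_0)
    also have "\<dots> = (-1)^m * a 0 + (\<Sum>j\<le>m. (-1) ^ (m + Suc j) * real (m choose Suc j) * a (Suc j))"
      by (subst sum.atMost_Suc_shift) simp
    finally show ?thesis unfolding 2 by (simp add: sum_negf[symmetric])
  qed
  have "fdiff (Suc m) h u x = (\<Sum>j\<le>Suc m. (-1) ^ (Suc m + j) * real (Suc m choose j) * a j)"
    by (simp add: fdiff_def a_def)
  also have "\<dots> = - ((-1)^m) * a 0 + (\<Sum>j\<le>m. (-1) ^ (m + j) * real (Suc m choose Suc j) * a (Suc j))"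
    by (subst sum.atMost_Suc_shift) simp
  also have "\<dots> = fdiff m h u (x + h) - fdiff m h u x"
    unfolding 1 3 by (simp add: sum.distrib algebra_simps)
  finally show ?thesis .
qed

lemma fdiff_fdiff: "fdiff n h (fdiff m h u) x = fdiff (m + n) h u x"
  by (induction n arbitrary: x) (simp_all add: fdiff_Suc)

lemma fdiff_commute: "fdiff n g (fdiff m h u) x = fdiff m h (fdiff n g u) x"
  unfolding fdiff_def sum_distrib_left by (subst sum.swap) (simp add: algebra_simps)

text \<open>The shift of \<open>u\<close> by (k - j) h comes from writing F(x+h) G(x+h) - F(x) G(x)
  as F(x+h) (G(x+h) - G(x)) + (F(x+h) - F(x)) G(x) in the induction step; Pascal's rule collects the
  coefficients. All nodes stay between x and x + k h.\<close>

lemma fdiff_Leibniz: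
  "fdiff k h (\<lambda>x. u x * v x) x
    = (\<Sum>j\<le>k. real (k choose j) * (fdiff j h u (x + real (k - j) *\<^sub>R h) * fdiff (k - j) h v x))"
proof (induction k arbitrary: x)
  case (Suc k)
  define F where "F = (\<lambda>j i n. fdiff j h u (x + real n *\<^sub>R h) * fdiff i h v x)"
  have *: "fdiff j h u (x + h + real (k - j) *\<^sub>R h) * fdiff (k - j) h v (x + h)
         - fdiff j h u (x + real (k - j) *\<^sub>R h) * fdiff (k - j) h v x
     = F j (Suc k - j) (Suc k - j) + F (Suc j) (k - j) (k - j)" if "j \<le> k" for j
  proof -
    have "x + h + real (k - j) *\<^sub>R h = x + real (Suc k - j) *\<^sub>R h"
       "x + real (k - j) *\<^sub>R h + h = x + real (Suc k - j) *\<^sub>R h"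
      using that by (simp_all add: algebra_simps Suc_diff_le)
    then show ?thesis
      using that by (simp add: F_def fdiff_Suc Suc_diff_le algebra_simps)
  qed
  have "fdiff (Suc k) h (\<lambda>x. u x * v x) x
    = (\<Sum>j\<le>k. real (k choose j) * (F j (Suc k - j) (Suc k - j) + F (Suc j) (k - j) (k - j)))"
    unfolding fdiff_Suc Suc.IH sum_subtractf[symmetric] right_diff_distrib[symmetric]
    by (intro sum.cong refl arg_cong2[where f="(*)"] *) auto
  also have "\<dots> = (\<Sum>j\<le>k. real (k choose j) * F j (Suc k - j) (Suc k - j))
     + (\<Sum>j\<le>k. real (k choose j) * F (Suc j) (k - j) (k - j))"
    by (simp add: sum.distrib distrib_left)
  also have "(\<Sum>j\<le>k. real (k choose j) * F j (Suc k - j) (Suc k - j))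
     = (\<Sum>j\<le>Suc k. real (k choose j) * F j (Suc k - j) (Suc k - j))"
    by (simp add: binomial_eq_0)
  also have "\<dots> = F 0 (Suc k) (Suc k) + (\<Sum>j\<le>k. real (k choose Suc j) * F (Suc j) (k - j) (k - j))"
    by (subst sum.atMost_Suc_shift) simp
  finally have "fdiff (Suc k) h (\<lambda>x. u x * v x) x =
     F 0 (Suc k) (Suc k) + (\<Sum>j\<le>k. real (Suc k choose Suc j) * F (Suc j) (k - j) (k - j))"
    by (simp add: sum.distrib algebra_simps)
  also have "\<dots> = (\<Sum>j\<le>Suc k. real (Suc k choose j) * F j (Suc k - j) (Suc k - j))"
    by (subst sum.atMost_Suc_shift) simp
  finally show ?case by (simp add: F_def)
qed simp

text \<open>Polynomials act on functions, the variable being the shift by \<open>h\<close>.\<close>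

definition shift_poly :: "real poly \<Rightarrow> 'a::real_vector \<Rightarrow> ('a \<Rightarrow> real) \<Rightarrow> 'a \<Rightarrow> real" where
  "shift_poly P h u x = (\<Sum>i\<le>degree P. coeff P i * u (x + real i *\<^sub>R h))"

lemma shift_poly_bound:
  "degree P \<le> n \<Longrightarrow> shift_poly P h u x = (\<Sum>i\<le>n. coeff P i * u (x + real i *\<^sub>R h))"
  unfolding shift_poly_def by (intro sum.mono_neutral_left) (auto simp: coeff_eq_0)

lemma shift_poly_0 [simp]: "shift_poly 0 h u x = 0"
  by (simp add: shift_poly_def)

lemma shift_poly_add: "shift_poly (P + Q) h u x = shift_poly P h u x + shift_poly Q h u x"
proof -
  let ?n = "max (degree P) (degree Q)"
  show ?thesis
    using shift_poly_bound[of P ?n h u x] shift_poly_bound[of Q ?n h u x] shift_poly_bound[of "P + Q" ?n h u x]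
    by (simp add: degree_add_le sum.distrib distrib_right)
qed

lemma shift_poly_smult: "shift_poly (smult c P) h u x = c * shift_poly P h u x"
  by (subst shift_poly_bound[of _ "degree P"]) (simp_all add: shift_poly_def sum_distrib_left algebra_simps)

lemma shift_poly_pCons: "shift_poly (pCons a P) h u x = a * u x + shift_poly P h u (x + h)"
proof -
  have "shift_poly (pCons a P) h u x = (\<Sum>i\<le>Suc (degree P). coeff (pCons a P) i * u (x + real i *\<^sub>R h))"
    by (intro shift_poly_bound) (rule degree_pCons_le)
  also have "\<dots> = a * u x + shift_poly P h u (x + h)"
    by (subst sum.atMost_Suc_shift) (simp add: shift_poly_def algebra_simps)
  finally show ?thesis .
qed

lemma shift_poly_mult: "shift_poly (P * Q) h u x = shift_poly P h (shift_poly Q h u) x"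
  by (induction P arbitrary: x)
     (simp_all add: shift_poly_pCons shift_poly_add shift_poly_smult)

lemma shift_poly_1: "shift_poly 1 h u x = u x"
  by (simp add: shift_poly_def)

lemma shift_poly_monom: "shift_poly (monom 1 n) h u x = u (x + real n *\<^sub>R h)"
proof -
  have "shift_poly (monom 1 n) h u x = (\<Sum>i\<le>n. (if i = n then u (x + real i *\<^sub>R h) else 0))"
    by (subst shift_poly_bound[OF degree_monom_le]) (intro sum.cong; simp)
  then show ?thesis by simp
qed

text \<open>Products of polynomials act as compositions, and X^N - 1 acts as the first difference
  with step N h. Relations between differences with steps h and N h thus become polynomial
  identities.\<close>

lemma shift_poly_power_eq_fdiff:
  "shift_poly ((monom 1 N - 1) ^ j) h u x = fdiff j (real N *\<^sub>R h) u x"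
proof (induction j arbitrary: x)
  case 0
  show ?case by (simp add: shift_poly_1)
next
  case (Suc j)
  have e: "(monom 1 N - 1 :: real poly) = monom 1 N + smult (-1) 1" by (simp add: one_pCons)
  have "shift_poly ((monom 1 N - 1) ^ Suc j) h u x
    = shift_poly (monom 1 N + smult (-1) 1) h (shift_poly ((monom 1 N - 1) ^ j) h u) x"
    unfolding power_Suc shift_poly_mult by (simp only: e[symmetric])
  then show ?case
    by (simp only: shift_poly_add shift_poly_smult shift_poly_monom shift_poly_1 Suc fdiff_Suc)
qed

text \<open>
  \<open>X\<^sup>N - 1 = (X - 1) G\<close> with \<open>G(1) = N\<close>, so \<open>X - 1\<close> divides \<open>G\<^sup>j - N\<^sup>j\<close>.
\<close>

lemma fdiff_scale_step:
  assumes "j \<ge> 1" "N \<ge> 2"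
  shows "\<exists>L q. L + Suc j \<le> N * j \<and> (\<forall>h (u :: 'a::real_vector \<Rightarrow> real) x. 
    fdiff j (real N *\<^sub>R h) u x = real N ^ j * fdiff j h u x
      + (\<Sum>l\<le>L. q l * fdiff (Suc j) h u (x + real l *\<^sub>R h)))"
proof -
  define X1 where "X1 = (monom 1 1 - 1 :: real poly)"
  have X1: "X1 = [:-1, 1:]" by (simp add: X1_def monom_altdef one_pCons)
  define G where "G = (\<Sum>i<N. monom 1 i :: real poly)"
  have G: "monom 1 N - 1 = X1 * G"
    using power_diff_1_eq[of "monom 1 1 :: real poly" N] by (simp add: X1_def G_def monom_power)
  have "poly (G ^ j - [:real N ^ j:]) 1 = 0"
    by (simp add: G_def poly_sum poly_monom)
  then obtain Q where Q: "G ^ j - [:real N ^ j:] = X1 * Q"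
    unfolding poly_eq_0_iff_dvd X1 by (rule dvdE)
  have id: "(monom 1 N - 1) ^ j = smult (real N ^ j) (X1 ^ j) + Q * X1 ^ Suc j"
  proof -
    have "(monom 1 N - 1) ^ j = X1 ^ j * (X1 * Q + [:real N ^ j:])"
      unfolding G power_mult_distrib using Q by (simp add: algebra_simps)
    then show ?thesis by (simp add: algebra_simps)
  qed
  \<comment> \<open>This bound keeps the nodes of all (j + 1)-st differences inside the segment from
    x to x + N j h that the difference with step N h uses. The zero polynomial has degree 0 by
    convention, so its case rests on N >= 2 and j >= 1.\<close>
  have deg: "degree Q + Suc j \<le> N * j"
  proof (cases "Q = 0")
    case True
    have "Suc j \<le> 2 * j" using assms by simp
    also have "\<dots> \<le> N * j" using assms by simp
    finally show ?thesis using True by simp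
  next
    case False
    have d1: "degree (X1 ^ n) = n" for n
      by (simp add: X1 degree_linear_power)
    have "Q * X1 ^ Suc j = (monom 1 N - 1) ^ j - smult (real N ^ j) (X1 ^ j)"
      using id by simp
    then have "degree (Q * X1 ^ Suc j) \<le> max (degree ((monom 1 N - 1 :: real poly) ^ j)) (degree (smult (real N ^ j) (X1 ^ j)))"
      by (simp only: degree_diff_le_max)
    also have "\<dots> \<le> N * j"
    proof -
      have "degree ((monom 1 N - 1 :: real poly) ^ j) \<le> degree (monom 1 N - 1 :: real poly) * j"
        by (rule degree_power_le)
      also have "\<dots> \<le> N * j"
        by (intro mult_right_mono degree_diff_le) (auto simp: degree_monom_le)
      finally show ?thesis using assms by (simp add: d1)
    qed
    finally have "degree (Q * X1 ^ Suc j) \<le> N * j" .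
    moreover have "degree (Q * X1 ^ Suc j) = degree Q + Suc j"
      using False d1[of "Suc j"] by (subst degree_mult_eq) (auto simp: X1)
    ultimately show ?thesis by simp
  qed
  have "fdiff j (real N *\<^sub>R h) u x = real N ^ j * fdiff j h u x
      + (\<Sum>l\<le>degree Q. coeff Q l * fdiff (Suc j) h u (x + real l *\<^sub>R h))" for h and u :: "'a \<Rightarrow> real" and x
  proof -
    have "fdiff j (real N *\<^sub>R h) u x = shift_poly (smult (real N ^ j) (X1 ^ j) + Q * X1 ^ Suc j) h u x"
      by (simp only: shift_poly_power_eq_fdiff[symmetric] id)
    also have "\<dots> = real N ^ j * fdiff j h u x + shift_poly Q h (fdiff (Suc j) h u) x"
    proof -
      have s: "shift_poly (X1 ^ n) h u = fdiff n h u" for n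
        using shift_poly_power_eq_fdiff[of 1 n h u] by (auto simp: X1_def)
      show ?thesis by (simp only: shift_poly_add shift_poly_smult shift_poly_mult s)
    qed
    finally show ?thesis by (simp add: shift_poly_def)
  qed
  then show ?thesis using deg by blast
qed

section \<open>Pointwise bounds for differences\<close>

lemma sum_choose: "(\<Sum>i\<le>n. real (n choose i)) = 2 ^ n"
  using choose_row_sum[of n] by (metis of_nat_numeral of_nat_power of_nat_sum)

lemma sum_choose_pos: "(\<Sum>i=1..n. real (n choose i)) = 2 ^ n - 1"
proof -
  have "{..n} = insert 0 {1..n}" by auto
  then show ?thesis using sum_choose[of n] by simp
qed

lemma abs_fdiff_le_shifts:
  "\<bar>fdiff j h u x\<bar> \<le> (\<Sum>l\<le>j. real (j choose l) * \<bar>u (x + real l *\<^sub>R h)\<bar>)"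
  unfolding fdiff_def by (rule order.trans[OF sum_abs]) (simp add: abs_mult)

text \<open>The node at x carries the coefficient 1 or -1, so the value there can be solved for. A
  point is exchanged for points displaced by multiples of \<open>g\<close>.\<close>

lemma abs_le_fdiff_plus_shifts:
  "\<bar>u x\<bar> \<le> \<bar>fdiff m g u x\<bar> + (\<Sum>i=1..m. real (m choose i) * \<bar>u (x + real i *\<^sub>R g)\<bar>)"
proof -
  define a where "a = (\<lambda>i. (-1) ^ (m + i) * real (m choose i) * u (x + real i *\<^sub>R g))"
  have "{..m} = insert 0 {1..m}" by auto
  then have "fdiff m g u x = a 0 + sum a {1..m}"
    by (simp add: fdiff_def a_def)
  moreover have "\<bar>a 0\<bar> = \<bar>u x\<bar>" by (simp add: a_def abs_mult)
  ultimately have "\<bar>u x\<bar> \<le> \<bar>fdiff m g u x\<bar> + \<bar>sum a {1..m}\<bar>" by linarith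
  also have "\<bar>sum a {1..m}\<bar> \<le> (\<Sum>i=1..m. \<bar>a i\<bar>)" by (rule sum_abs)
  finally show ?thesis by (simp add: a_def abs_mult)
qed

text \<open>The previous bound for the function \<open>fdiff j h u\<close>, with the two differences
  interchanged. With \<open>g\<close> pointing into the domain, a j-th difference near the boundary
  is replaced by j-th differences further inside, at the cost of an m-th difference in direction
  \<open>g\<close>.\<close>

lemma abs_fdiff_le_interior:
  "\<bar>fdiff j h u x\<bar> \<le> (\<Sum>l\<le>j. real (j choose l) * \<bar>fdiff m g u (x + real l *\<^sub>R h)\<bar>)
     + (\<Sum>i=1..m. real (m choose i) * \<bar>fdiff j h u (x + real i *\<^sub>R g)\<bar>)"
  using abs_le_fdiff_plus_shifts[of "fdiff j h u" x m g] abs_fdiff_le_shifts[of j h "fdiff m g u" x]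
  by (simp add: fdiff_commute)

section \<open>Lebesgue norms and moduli of smoothness\<close>

lemma distr_lebesgue_translation:
  fixes a :: "'a::euclidean_space"
  shows "(\<lambda>x. x + a) \<in> lebesgue \<rightarrow>\<^sub>M lebesgue" "distr lebesgue lebesgue (\<lambda>x. x + a) = lebesgue"
proof -
  have e: "(\<lambda>x. a + (\<Sum>j\<in>Basis. (1 * (x \<bullet> j)) *\<^sub>R j)) = (\<lambda>x. x + a)"
    by (simp add: euclidean_representation add.commute)
  show "(\<lambda>x. x + a) \<in> lebesgue \<rightarrow>\<^sub>M lebesgue"
    using lebesgue_affine_measurable[of "\<lambda>_. 1" a] unfolding e by simp
  show "distr lebesgue lebesgue (\<lambda>x. x + a) = lebesgue"
    using lebesgue_affine_euclidean[of "\<lambda>_. 1" a] unfolding e by (simp add: density_1)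
qed

lemma Lp_norm_eq_lnorm:
  "Lp_norm P U u = lnorm P (lebesgue_on U) (\<lambda>x. ennreal \<bar>u x\<bar>)"
  by (simp add: Lp_norm_def lnorm_def ennreal_rpow_ennreal)

lemma Lp_norm_sum_le:
  assumes P: "P > 0" and I: "finite I"
    and [measurable]: "f \<in> borel_measurable (lebesgue_on U)"
      "\<And>i. i \<in> I \<Longrightarrow> g i \<in> borel_measurable (lebesgue_on U)"
    and c: "\<And>i. i \<in> I \<Longrightarrow> c i \<ge> 0"
    and le: "\<And>x. x \<in> U \<Longrightarrow> \<bar>f x\<bar> \<le> (\<Sum>i\<in>I. c i * \<bar>g i x\<bar>)"
  shows "Lp_norm P U f \<le> ennreal (quasi_const P (card I)) * (\<Sum>i\<in>I. ennreal (c i) * Lp_norm P U (g i))"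
proof -
  let ?M = "lebesgue_on U"
  have "Lp_norm P U f \<le> lnorm P ?M (\<lambda>x. \<Sum>i\<in>I. ennreal (c i) * ennreal \<bar>g i x\<bar>)"
    unfolding Lp_norm_eq_lnorm
  proof (intro lnorm_mono_AE P)
    have "ennreal \<bar>f x\<bar> \<le> (\<Sum>i\<in>I. ennreal (c i) * ennreal \<bar>g i x\<bar>)" if "x \<in> U" for x
    proof -
      have "ennreal \<bar>f x\<bar> \<le> ennreal (\<Sum>i\<in>I. c i * \<bar>g i x\<bar>)" by (rule ennreal_leI[OF le[OF that]])
      also have "\<dots> = (\<Sum>i\<in>I. ennreal (c i) * ennreal \<bar>g i x\<bar>)"
        using c by (subst sum_ennreal[symmetric]) (auto simp: ennreal_mult intro!: sum.cong)
      finally show ?thesis .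
    qed
    then show "AE x in ?M. ennreal \<bar>f x\<bar> \<le> (\<Sum>i\<in>I. ennreal (c i) * ennreal \<bar>g i x\<bar>)"
      by (intro AE_I2) auto
  qed measurable
  also have "\<dots> \<le> ennreal (quasi_const P (card I)) * (\<Sum>i\<in>I. lnorm P ?M (\<lambda>x. ennreal (c i) * ennreal \<bar>g i x\<bar>))"
    by (intro lnorm_sum_le P I) measurable
  also have "\<dots> \<le> ennreal (quasi_const P (card I)) * (\<Sum>i\<in>I. ennreal (c i) * Lp_norm P U (g i))"
    unfolding Lp_norm_eq_lnorm by (intro mult_left_mono sum_mono lnorm_cmult_le P) auto
  finally show ?thesis .
qed

lemma Lp_norm_mono:
  assumes "P > 0" "f \<in> borel_measurable (lebesgue_on U)" "\<And>x. x \<in> U \<Longrightarrow> \<bar>f x\<bar> \<le> \<bar>g x\<bar>"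
  shows "Lp_norm P U f \<le> Lp_norm P U g"
  unfolding Lp_norm_eq_lnorm using assms
  by (intro lnorm_mono_AE AE_I2) auto

lemma exponent_top: "n > 0 \<Longrightarrow> top / of_nat n = (top :: ennreal)"
  by (simp add: ennreal_top_divide of_nat_less_top)

lemma exponent_ennreal:
  "r > 0 \<Longrightarrow> n > 0 \<Longrightarrow> k > 0 \<Longrightarrow> ennreal r * of_nat k / of_nat n = ennreal (r / (real n / real k))"
  by (simp add: ennreal_of_nat_eq_real_of_nat ennreal_mult[symmetric] divide_ennreal)

text \<open>Division of a positive number by zero in \<open>ennreal\<close> gives infinity, which is
  exactly the convention for the exponent p k / 0 of the end terms.\<close>

lemma exponent_0: "p > 0 \<Longrightarrow> k > 0 \<Longrightarrow> p * of_nat k / of_nat 0 = (top :: ennreal)"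
  by (simp add: ennreal_divide_zero)

lemma exponent_self: "k > 0 \<Longrightarrow> p * of_nat k / of_nat k = (p :: ennreal)"
  by (simp add: ennreal_mult_divide_eq)

lemma Lp_norm_Holder:
  assumes p: "p > 0" and k: "k > 0" "j \<le> k"
    and [measurable]: "f \<in> borel_measurable (lebesgue_on U)" "g \<in> borel_measurable (lebesgue_on U)"
  shows "Lp_norm p U (\<lambda>x. f x * g x)
    \<le> Lp_norm (p * of_nat k / of_nat j) U f * Lp_norm (p * of_nat k / of_nat (k - j)) U g"
proof -
  let ?M = "lebesgue_on U"
  note top = exponent_0[OF p k(1)] and self = exponent_self[OF k(1), of p]
  \<comment> \<open>Serves the end cases j = 0 and j = k as well as p = infinity: a factor in L_inf
    is replaced by its essential supremum.\<close>
  have inf: "lnorm P ?M (\<lambda>x. F x * G x) \<le> lnorm \<infinity> ?M F * lnorm P ?M G"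
    if P: "P > 0" and [measurable]: "F \<in> borel_measurable ?M" "G \<in> borel_measurable ?M" for P F G
  proof -
    have "lnorm P ?M (\<lambda>x. F x * G x) \<le> lnorm P ?M (\<lambda>x. esssup ?M F * G x)"
    proof (intro lnorm_mono_AE P)
      show "AE x in ?M. F x * G x \<le> esssup ?M F * G x"
        using esssup_AE[of F ?M] by eventually_elim (rule mult_right_mono, auto)
    qed measurable
    also have "\<dots> \<le> lnorm \<infinity> ?M F * lnorm P ?M G"
      using lnorm_cmult_le[OF P, of G ?M "esssup ?M F"] by (simp add: lnorm_def)
    finally show ?thesis .
  qed
  define F where "F = (\<lambda>x. ennreal \<bar>f x\<bar>)"
  define G where "G = (\<lambda>x. ennreal \<bar>g x\<bar>)"
  have [measurable]: "F \<in> borel_measurable ?M" "G \<in> borel_measurable ?M"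
    by (auto simp: F_def G_def)
  have FG: "(\<lambda>x. ennreal \<bar>f x * g x\<bar>) = (\<lambda>x. F x * G x)"
    by (simp add: F_def G_def abs_mult ennreal_mult)
  have "lnorm p ?M (\<lambda>x. F x * G x) \<le> lnorm (p * of_nat k / of_nat j) ?M F * lnorm (p * of_nat k / of_nat (k - j)) ?M G"
  proof -
    consider "j = 0" | "j = k" | "0 < j" "j < k" using k by linarith
    then show ?thesis
    proof cases
      case 1
      then show ?thesis using inf[OF p, of F G] top self by simp
    next
      case 2
      then show ?thesis using inf[OF p, of G F] top self by (simp add: mult.commute)
    next
      case 3
      show ?thesis
      proof (cases "p = \<infinity>")
        case True
        then show ?thesis using inf[of top F G] 3 k by (simp add: exponent_top)
      next
        case False
        then obtain r where r: "p = ennreal r" "r > 0"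
          using p by (cases p) auto
        show ?thesis unfolding r(1) using 3 r
          by (intro lnorm_Holder[where p=r and a = "real j / real k" and b = "real (k - j) / real k"] exponent_ennreal)
             (auto simp: field_simps of_nat_diff)
      qed
    qed
  qed
  then show ?thesis unfolding Lp_norm_eq_lnorm FG by (simp add: F_def G_def)
qed

text \<open>As \<open>G\<close> vanishes off \<open>U\<close>, its norm over \<open>U\<close> is its
  norm over the whole space, which translations preserve; restricting the translate to
  \<open>U\<close> can only lose mass. This absorbs the shifts in the product rule and in Marchaud's
  inequality.\<close>

lemma Lp_norm_translate_le:
  assumes P: "P > 0" and U: "U \<in> sets lebesgue" and [measurable]: "G \<in> borel_measurable lebesgue"
    and G: "\<And>x. x \<notin> U \<Longrightarrow> G x = 0"
  shows "Lp_norm P U (\<lambda>x. G (x + y)) \<le> Lp_norm P U G"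
proof -
  note distr_lebesgue_translation(1)[of y, measurable]
  have m[measurable]: "G \<in> borel_measurable (lebesgue_on U)" "(\<lambda>x. G (x + y)) \<in> borel_measurable (lebesgue_on U)"
    by (auto intro!: measurable_restrict_space1)
  show ?thesis
  proof (cases "P = \<infinity>")
    case True
    define C where "C = esssup (lebesgue_on U) (\<lambda>x. ennreal \<bar>G x\<bar>)"
    have "AE x in lebesgue_on U. ennreal \<bar>G x\<bar> \<le> C" unfolding C_def by (rule esssup_AE)
    then have "AE x in lebesgue. x \<in> U \<longrightarrow> ennreal \<bar>G x\<bar> \<le> C"
      using U by (subst (asm) AE_restrict_space_iff) auto
    then have "AE x in lebesgue. ennreal \<bar>G x\<bar> \<le> C"
      by eventually_elim (use G in force)
    then have "AE x in distr lebesgue lebesgue (\<lambda>x. x + y). ennreal \<bar>G x\<bar> \<le> C"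
      by (simp only: distr_lebesgue_translation(2))
    then have "AE x in lebesgue. ennreal \<bar>G (x + y)\<bar> \<le> C"
      by (rule AE_distrD[OF distr_lebesgue_translation(1)])
    then have "AE x in lebesgue_on U. ennreal \<bar>G (x + y)\<bar> \<le> C"
      using U by (subst AE_restrict_space_iff) (auto elim: eventually_mono)
    then have "esssup (lebesgue_on U) (\<lambda>x. ennreal \<bar>G (x + y)\<bar>) \<le> C"
      by (intro esssup_I) auto
    then show ?thesis using True by (simp add: Lp_norm_def C_def)
  next
    case False
    define p where "p = enn2real P"
    define F where "F = (\<lambda>x. ennreal (\<bar>G x\<bar> powr p))"
    have [measurable]: "F \<in> borel_measurable lebesgue" unfolding F_def by measurable
    have "(\<integral>\<^sup>+x. F (x + y) \<partial>lebesgue_on U) \<le> (\<integral>\<^sup>+x. F (x + y) \<partial>lebesgue)"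
      using U by (subst nn_integral_restrict_space) (auto intro!: nn_integral_mono simp: indicator_def)
    also have "\<dots> = (\<integral>\<^sup>+x. F x \<partial>distr lebesgue lebesgue (\<lambda>x. x + y))"
      by (subst nn_integral_distr) auto
    also have "\<dots> = (\<integral>\<^sup>+x. F x \<partial>lebesgue)"
      by (simp add: distr_lebesgue_translation(2))
    also have "\<dots> = (\<integral>\<^sup>+x. F x \<partial>lebesgue_on U)"
      using U G by (subst nn_integral_restrict_space) (auto intro!: nn_integral_cong simp: indicator_def F_def)
    finally show ?thesis using False
      by (simp add: Lp_norm_def F_def p_def ennreal_rpow_mono)
  qed
qed

text \<open>Parametrising by [0, m] instead of [0, 1] as in \<open>diff_op\<close> lets sub-segments
  and shifts by integer multiples of \<open>h\<close> be treated without rescaling.\<close>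

definition seg_dom :: "'a::real_vector set \<Rightarrow> nat \<Rightarrow> 'a \<Rightarrow> 'a set" where
  "seg_dom U m h = {x. \<forall>t\<in>{0..real m}. x + t *\<^sub>R h \<in> U}"

lemma diff_op_eq: "diff_op U m h u x = (if x \<in> seg_dom U m h then fdiff m h u x else 0)"
proof -
  have "(\<forall>\<tau>\<in>{0..1}. x + (\<tau> * real m) *\<^sub>R h \<in> U) \<longleftrightarrow> x \<in> seg_dom U m h"
  proof (cases "m = 0")
    case False
    have "x \<in> seg_dom U m h" if *: "\<forall>\<tau>\<in>{0..1}. x + (\<tau> * real m) *\<^sub>R h \<in> U"
    proof -
      have "x + t *\<^sub>R h \<in> U" if "t \<in> {0..real m}" for t
        using *[rule_format, of "t / real m"] that False by (auto simp: field_simps)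
      then show ?thesis by (auto simp: seg_dom_def)
    qed
    moreover have "x + (\<tau> * real m) *\<^sub>R h \<in> U" if "x \<in> seg_dom U m h" "\<tau> \<in> {0..1}" for \<tau>
      using that mult_right_mono[of \<tau> 1 "real m"] by (auto simp: seg_dom_def)
    ultimately show ?thesis by blast
  qed (auto simp: seg_dom_def)
  then show ?thesis by (simp add: diff_op_def fdiff_def)
qed

lemma seg_dom_mono: "j \<le> m \<Longrightarrow> x \<in> seg_dom U m h \<Longrightarrow> x \<in> seg_dom U j h"
  by (auto simp: seg_dom_def)

lemma seg_dom_shift:
  assumes "x \<in> seg_dom U m h" "l + j \<le> m"
  shows "x + real l *\<^sub>R h \<in> seg_dom U j h"
proof -
  have "x + real l *\<^sub>R h + t *\<^sub>R h \<in> U" if "t \<in> {0..real j}" for t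
  proof -
    have "real l + t \<in> {0..real m}" using that assms(2) by auto
    then have "x + (real l + t) *\<^sub>R h \<in> U" using assms(1) by (auto simp: seg_dom_def)
    then show ?thesis by (simp add: algebra_simps)
  qed
  then show ?thesis by (simp add: seg_dom_def)
qed

lemma seg_dom_0 [simp]: "seg_dom U 0 h = U"
  by (auto simp: seg_dom_def)

lemma seg_dom_subset: "seg_dom U m h \<subseteq> U"
  using seg_dom_mono[of 0 m _ U h] by auto

lemma seg_dom_point: "x \<in> seg_dom U m h \<Longrightarrow> l \<le> m \<Longrightarrow> x + real l *\<^sub>R h \<in> U"
  by (auto simp: seg_dom_def)

lemma diff_op_outside: "x \<notin> U \<Longrightarrow> diff_op U m h u x = 0"
  using seg_dom_subset by (auto simp: diff_op_eq)

text \<open>The segment is compact, hence has a uniform neighbourhood inside the open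
  \<open>U\<close>. Openness supplies the measurability of the domain test in
  \<open>diff_op\<close>.\<close>

lemma open_seg_dom:
  fixes U :: "'a::euclidean_space set"
  assumes "open U"
  shows "open (seg_dom U m h)"
  unfolding open_dist
proof
  fix x assume x: "x \<in> seg_dom U m h"
  let ?K = "(\<lambda>t. x + t *\<^sub>R h) ` {0..real m}"
  have "compact ?K" by (intro compact_continuous_image continuous_intros) auto
  moreover have "?K \<subseteq> U" using x by (auto simp: seg_dom_def)
  ultimately obtain e where e: "e > 0" "(\<Union>y\<in>?K. ball y e) \<subseteq> U"
    using assms compact_subset_open_imp_ball_epsilon_subset by metis
  have "y \<in> seg_dom U m h" if "dist y x < e" for y
  proof -
    have "y + t *\<^sub>R h \<in> U" if "t \<in> {0..real m}" for t
      using e(2) \<open>dist y x < e\<close> that by (force simp: dist_commute)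
    then show ?thesis by (simp add: seg_dom_def)
  qed
  then show "\<exists>e>0. \<forall>y. dist y x < e \<longrightarrow> y \<in> seg_dom U m h" using e(1) by blast
qed

lemma measurable_diff_op:
  assumes "open U" and u: "u \<in> borel_measurable (lebesgue_on U)"
  shows "diff_op U m h u \<in> borel_measurable lebesgue"
proof -
  \<comment> \<open>\<open>u\<close> is measurable on \<open>U\<close> only. Its extension by zero
    has measurable translates, and on \<open>seg_dom\<close> all nodes lie in \<open>U\<close>, so
    the difference is the same there.\<close>
  define w where "w = (\<lambda>x. if x \<in> U then u x else 0)"
  have U: "U \<in> sets lebesgue" using assms by (simp add: borel_open)
  have w: "w \<in> borel_measurable lebesgue"
    using u U by (simp add: w_def borel_measurable_if)
  have [measurable]: "(\<lambda>x. w (x + a)) \<in> borel_measurable lebesgue" for a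
    using measurable_compose[OF distr_lebesgue_translation(1) w] .
  have [measurable]: "seg_dom U m h \<in> sets lebesgue"
    using open_seg_dom[OF assms(1)] by (simp add: borel_open)
  have "diff_op U m h u = (\<lambda>x. if x \<in> seg_dom U m h then fdiff m h w x else 0)"
    using seg_dom_point by (fastforce simp: diff_op_eq fdiff_def w_def intro!: sum.cong)
  also have "\<dots> \<in> borel_measurable lebesgue"
    unfolding fdiff_def by measurable
  finally show ?thesis .
qed

lemma diff_op_0: "x \<in> U \<Longrightarrow> diff_op U 0 h u x = u x"
  by (simp add: diff_op_eq)

section \<open>Moduli of smoothness: monotonicity, raising the order, products\<close>

notation modulus_smoothness ("\<omega>")

abbreviation wmodulus :: "real \<Rightarrow> nat \<Rightarrow> ennreal \<Rightarrow> 'a::euclidean_space set \<Rightarrow> ('a \<Rightarrow> real) \<Rightarrow> real \<Rightarrow> ennreal" where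
  "wmodulus a m P U u \<equiv> (\<lambda>t. ennreal (t powr (- a)) * \<omega> m P U u t)"

lemma modulus_smoothness_mono:
  "t \<le> t' \<Longrightarrow> \<omega> m P U u t \<le> \<omega> m P U u t'"
  unfolding modulus_smoothness_def by (rule SUP_subset_mono) auto

lemma Lp_norm_diff_op_le_modulus:
  "norm h \<le> t \<Longrightarrow> Lp_norm P U (diff_op U m h u) \<le> \<omega> m P U u t"
  unfolding modulus_smoothness_def by (rule SUP_upper) auto

text \<open>The modulus is a supremum over uncountably many \<open>h\<close>, so its measurability
  in t is taken from monotonicity: the superlevel sets are intervals.\<close>

lemma borel_measurable_mono_ennreal:
  fixes f :: "real \<Rightarrow> ennreal"
  assumes "\<And>x y. x \<le> y \<Longrightarrow> f x \<le> f y"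
  shows "f \<in> borel_measurable borel"
proof (rule borel_measurableI_greater)
  fix y
  have "is_interval {x. y < f x}"
    unfolding is_interval_1 using assms by (auto intro: less_le_trans)
  then show "{x \<in> space borel. y < f x} \<in> sets borel"
    by (simp add: real_interval_borel_measurable)
qed

lemma measurable_modulus_smoothness [measurable]:
  "\<omega> m P U u \<in> borel_measurable borel"
  by (intro borel_measurable_mono_ennreal modulus_smoothness_mono)

lemma ennreal_exponent_pos:
  "p > 0 \<Longrightarrow> k > 0 \<Longrightarrow> p * of_nat k / of_nat j > (0 :: ennreal)"
  by (simp add: ennreal_zero_less_divide ennreal_zero_less_mult_iff of_nat_less_top)

lemma measurable_diff_op_shift:
  fixes U :: "'a::euclidean_space set"
  assumes "open U" "u \<in> borel_measurable (lebesgue_on U)"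
  shows "(\<lambda>x. diff_op U m h u (x + y)) \<in> borel_measurable (lebesgue_on U')"
  using measurable_compose[OF distr_lebesgue_translation(1) measurable_diff_op[OF assms]]
  by (rule measurable_restrict_space1)

lemma Lp_norm_diff_op_shift_le:
  assumes "open U" "u \<in> borel_measurable (lebesgue_on U)" "P > 0" "norm h \<le> t"
  shows "Lp_norm P U (\<lambda>x. diff_op U m h u (x + y)) \<le> \<omega> m P U u t"
  using assms measurable_diff_op[OF assms(1,2)]
  by (intro order.trans[OF Lp_norm_translate_le Lp_norm_diff_op_le_modulus])
     (auto simp: borel_open diff_op_outside)

lemma measurable_diff_op_lebesgue_on:
  assumes "open U" "u \<in> borel_measurable (lebesgue_on U)"
  shows "diff_op U m h u \<in> borel_measurable (lebesgue_on U')"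
  using measurable_diff_op_shift[OF assms, of m h 0] by simp

text \<open>A difference of order m + n is an n-th difference of the m-th one, hence a combination
  of n + 1 of its translates with binomial coefficients that add up to 2^n.\<close>

lemma modulus_smoothness_raise:
  fixes U :: "'a::euclidean_space set"
  assumes U: "open U" and u: "u \<in> borel_measurable (lebesgue_on U)" and P: "P > 0"
  shows "\<omega> (m + n) P U u t
    \<le> ennreal (quasi_const P (Suc n) * 2 ^ n) * \<omega> m P U u t"
  unfolding modulus_smoothness_def[of "m + n"]
proof (rule SUP_least, clarify)
  fix h :: 'a assume h: "norm h \<le> t"
  let ?w = "\<omega> m P U u t"
  have "Lp_norm P U (diff_op U (m + n) h u)
    \<le> ennreal (quasi_const P (card {..n})) * (\<Sum>i\<in>{..n}. ennreal (real (n choose i)) *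
       Lp_norm P U (\<lambda>x. diff_op U m h u (x + real i *\<^sub>R h)))"
  proof (intro Lp_norm_sum_le P measurable_diff_op_lebesgue_on measurable_diff_op_shift U u)
    fix x
    show "\<bar>diff_op U (m + n) h u x\<bar> \<le> (\<Sum>i\<in>{..n}. real (n choose i) * \<bar>diff_op U m h u (x + real i *\<^sub>R h)\<bar>)"
    proof (cases "x \<in> seg_dom U (m + n) h")
      case True
      have "\<bar>fdiff (m + n) h u x\<bar> \<le> (\<Sum>i\<le>n. real (n choose i) * \<bar>fdiff m h u (x + real i *\<^sub>R h)\<bar>)"
        unfolding fdiff_fdiff[symmetric] by (rule abs_fdiff_le_shifts)
      also have "\<dots> = (\<Sum>i\<in>{..n}. real (n choose i) * \<bar>diff_op U m h u (x + real i *\<^sub>R h)\<bar>)"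
        using True seg_dom_shift[of x U "m + n" h _ m] by (intro sum.cong) (auto simp: diff_op_eq)
      finally show ?thesis using True by (simp add: diff_op_eq)
    qed (simp add: diff_op_eq sum_nonneg)
  qed auto
  also have "\<dots> \<le> ennreal (quasi_const P (card {..n})) * (\<Sum>i\<in>{..n}. ennreal (real (n choose i)) * ?w)"
    by (intro mult_left_mono sum_mono Lp_norm_diff_op_shift_le U u P h) auto
  also have "(\<Sum>i\<in>{..n}. ennreal (real (n choose i)) * ?w) = ennreal (2 ^ n) * ?w"
    by (simp add: sum_distrib_right[symmetric] sum_ennreal sum_choose)
  finally show "Lp_norm P U (diff_op U (m + n) h u)
    \<le> ennreal (quasi_const P (Suc n) * 2 ^ n) * ?w"
    by (simp add: ennreal_mult quasi_const_nonneg mult.assoc)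
qed

lemma modulus_smoothness_0_le:
  assumes "open U" "u \<in> borel_measurable (lebesgue_on U)" "P > 0"
  shows "\<omega> 0 P U u t \<le> Lp_norm P U u"
  unfolding modulus_smoothness_def
  using assms by (intro SUP_least Lp_norm_mono measurable_diff_op_lebesgue_on) (auto simp: diff_op_0)

lemma modulus_smoothness_le_Lp_norm:
  assumes "open U" "u \<in> borel_measurable (lebesgue_on U)" "P > 0"
  shows "\<omega> n P U u t \<le> ennreal (quasi_const P (Suc n) * 2 ^ n) * Lp_norm P U u"
  by (rule order.trans[OF modulus_smoothness_raise[OF assms, of 0 n t, simplified]
    mult_left_mono[OF modulus_smoothness_0_le[OF assms]]]) simp

lemma modulus_smoothness_mult_le:
  fixes U :: "'a::euclidean_space set"
  assumes U: "open U" and u: "u \<in> borel_measurable (lebesgue_on U)"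
    and v: "v \<in> borel_measurable (lebesgue_on U)" and p: "p > 0" and k: "k > 0"
  shows "\<omega> k p U (\<lambda>x. u x * v x) t \<le> ennreal (quasi_const p (Suc k)) *
    (\<Sum>j\<le>k. ennreal (real (k choose j)) * (\<omega> j (p * of_nat k / of_nat j) U u t *
       \<omega> (k - j) (p * of_nat k / of_nat (k - j)) U v t))"
  unfolding modulus_smoothness_def[of k]
proof (rule SUP_least, clarify)
  fix h :: 'a assume h: "norm h \<le> t"
  note m = measurable_diff_op_lebesgue_on measurable_diff_op_shift
  have "Lp_norm p U (diff_op U k h (\<lambda>x. u x * v x))
    \<le> ennreal (quasi_const p (card {..k})) * (\<Sum>j\<in>{..k}. ennreal (real (k choose j)) *
       Lp_norm p U (\<lambda>x. diff_op U j h u (x + real (k - j) *\<^sub>R h) * diff_op U (k - j) h v x))"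
  proof (intro Lp_norm_sum_le p m borel_measurable_times U u v)
    fix x
    show "\<bar>diff_op U k h (\<lambda>x. u x * v x) x\<bar> \<le> (\<Sum>j\<in>{..k}. real (k choose j) *
       \<bar>diff_op U j h u (x + real (k - j) *\<^sub>R h) * diff_op U (k - j) h v x\<bar>)"
    proof (cases "x \<in> seg_dom U k h")
      case True
      \<comment> \<open>Each factor of the product rule uses only a part of the segment from x to x
        + k h, so it passes the domain test of its own \<open>diff_op\<close>. In that form it
        vanishes off \<open>U\<close>, and its translates can be estimated.\<close>
      have eq: "fdiff k h (\<lambda>x. u x * v x) x = (\<Sum>j\<le>k. real (k choose j) *
        (diff_op U j h u (x + real (k - j) *\<^sub>R h) * diff_op U (k - j) h v x))"
        unfolding fdiff_Leibniz
      proof (intro sum.cong refl)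
        fix j assume "j \<in> {..k}"
        then have "x + real (k - j) *\<^sub>R h \<in> seg_dom U j h" "x \<in> seg_dom U (k - j) h"
          using seg_dom_shift[OF True, of "k - j" j] seg_dom_mono[of "k - j" k] True by auto
        then show "real (k choose j) * (fdiff j h u (x + real (k - j) *\<^sub>R h) * fdiff (k - j) h v x) =
          real (k choose j) * (diff_op U j h u (x + real (k - j) *\<^sub>R h) * diff_op U (k - j) h v x)"
          by (simp add: diff_op_eq)
      qed
      have "\<bar>fdiff k h (\<lambda>x. u x * v x) x\<bar> \<le> (\<Sum>j\<le>k. \<bar>real (k choose j) *
        (diff_op U j h u (x + real (k - j) *\<^sub>R h) * diff_op U (k - j) h v x)\<bar>)"
        unfolding eq by (rule sum_abs)
      then show ?thesis using True by (simp add: diff_op_eq abs_mult)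
    qed (simp add: diff_op_eq sum_nonneg)
  qed auto
  also have "\<dots> \<le> ennreal (quasi_const p (card {..k})) * (\<Sum>j\<in>{..k}. ennreal (real (k choose j)) *
      (\<omega> j (p * of_nat k / of_nat j) U u t *
       \<omega> (k - j) (p * of_nat k / of_nat (k - j)) U v t))"
  proof (intro mult_left_mono sum_mono)
    fix j assume j: "j \<in> {..k}"
    have "Lp_norm p U (\<lambda>x. diff_op U j h u (x + real (k - j) *\<^sub>R h) * diff_op U (k - j) h v x)
      \<le> Lp_norm (p * of_nat k / of_nat j) U (\<lambda>x. diff_op U j h u (x + real (k - j) *\<^sub>R h)) *
        Lp_norm (p * of_nat k / of_nat (k - j)) U (diff_op U (k - j) h v)"
      using j by (intro Lp_norm_Holder p k m U u v) auto
    also have "\<dots> \<le> \<omega> j (p * of_nat k / of_nat j) U u t *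
       \<omega> (k - j) (p * of_nat k / of_nat (k - j)) U v t"
      using p k by (intro mult_mono Lp_norm_diff_op_shift_le Lp_norm_diff_op_le_modulus U u h ennreal_exponent_pos) auto
    finally show "Lp_norm p U (\<lambda>x. diff_op U j h u (x + real (k - j) *\<^sub>R h) * diff_op U (k - j) h v x)
      \<le> \<omega> j (p * of_nat k / of_nat j) U u t *
       \<omega> (k - j) (p * of_nat k / of_nat (k - j)) U v t" .
  qed auto
  finally show "Lp_norm p U (diff_op U k h (\<lambda>x. u x * v x)) \<le> ennreal (quasi_const p (Suc k)) *
    (\<Sum>j\<le>k. ennreal (real (k choose j)) * (\<omega> j (p * of_nat k / of_nat j) U u t *
       \<omega> (k - j) (p * of_nat k / of_nat (k - j)) U v t))"
    by simp
qed

text \<open>Kept apart from \<open>lnorm\<close> because for q = infinity the Besov seminorm is a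
  genuine supremum over t > 0, not an essential one.\<close>

definition tnorm :: "ennreal \<Rightarrow> (real \<Rightarrow> ennreal) \<Rightarrow> ennreal" where
  "tnorm q g = (if q = \<infinity> then SUP t\<in>{0<..}. g t
     else ennreal_rpow (\<integral>\<^sup>+t\<in>{0<..}. ennreal_rpow (g t) (enn2real q) / ennreal t \<partial>lborel) (1 / enn2real q))"

lemma le_powr_of_weighted_le:
  assumes "t > 0" "A \<ge> 0" "ennreal (t powr (- a)) * x \<le> ennreal A"
  shows "x \<le> ennreal (A * t powr a)"
proof -
  have "ennreal (t powr a) * (ennreal (t powr (- a)) * x) \<le> ennreal (t powr a) * ennreal A"
    using assms by (intro mult_left_mono) auto
  moreover have "ennreal (t powr a) * ennreal (t powr (- a)) = 1"
    using assms by (simp add: ennreal_mult[symmetric] powr_minus)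
  then have "ennreal (t powr a) * (ennreal (t powr (- a)) * x) = x"
    by (simp only: mult.assoc[symmetric] mult_1)
  moreover have "ennreal (t powr a) * ennreal A = ennreal (A * t powr a)"
    using assms by (simp add: ennreal_mult mult.commute)
  ultimately show ?thesis by simp
qed

lemma besov_seminorm_pos_eq_tnorm:
  "besov_seminorm_pos s q p U u =
    tnorm q (wmodulus s (nat \<lfloor>s\<rfloor> + 1) p U u)"
  by (simp add: besov_seminorm_pos_def tnorm_def Let_def)

text \<open>The measure dt / t is the Haar measure of the multiplicative group of positive reals.
  Its invariance under t -> N t is what the recursion in Marchaud's inequality uses.\<close>

definition haar :: "real measure" where
  "haar = density lborel (\<lambda>t. inverse (ennreal t) * indicator {0<..} t)"

lemma sets_haar [measurable_cong, simp]: "sets haar = sets borel"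
  by (simp add: haar_def)

lemma nn_integral_haar:
  "f \<in> borel_measurable borel \<Longrightarrow>
    (\<integral>\<^sup>+t\<in>{0<..}. f t / ennreal t \<partial>lborel) = (\<integral>\<^sup>+t. f t \<partial>haar)"
  unfolding haar_def
  by (subst nn_integral_density) (auto simp: divide_ennreal_def ac_simps)

lemma tnorm_eq_lnorm:
  "g \<in> borel_measurable borel \<Longrightarrow> q \<noteq> \<infinity> \<Longrightarrow> tnorm q g = lnorm q haar g"
  by (simp add: tnorm_def lnorm_def nn_integral_haar)

lemma tnorm_mono: "(\<And>t. t > 0 \<Longrightarrow> f t \<le> g t) \<Longrightarrow> tnorm q f \<le> tnorm q g"
  unfolding tnorm_def
  by (auto intro!: SUP_mono ennreal_rpow_mono nn_integral_mono divide_right_mono_ennreal simp: indicator_def)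

lemma tnorm_cmult_le:
  assumes "q > 0" and [measurable]: "g \<in> borel_measurable borel"
  shows "tnorm q (\<lambda>t. c * g t) \<le> c * tnorm q g"
proof (cases "q = \<infinity>")
  case True
  then show ?thesis by (auto simp: tnorm_def intro!: SUP_least mult_left_mono SUP_upper)
next
  case False
  then show ?thesis using lnorm_cmult_le[of q g haar c] assms by (simp add: tnorm_eq_lnorm)
qed

lemma tnorm_sum_le:
  assumes q: "q > 0" and I: "finite I" and [measurable]: "\<And>i. i \<in> I \<Longrightarrow> f i \<in> borel_measurable borel"
  shows "tnorm q (\<lambda>t. \<Sum>i\<in>I. f i t) \<le> ennreal (quasi_const q (card I)) * (\<Sum>i\<in>I. tnorm q (f i))"
proof (cases "q = \<infinity>")
  case True
  have "(SUP t\<in>{0<..}. \<Sum>i\<in>I. f i t) \<le> (\<Sum>i\<in>I. SUP t\<in>{0<..}. f i t)"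
    by (intro SUP_least sum_mono SUP_upper)
  also have "\<dots> \<le> ennreal (real (card I)) * (\<Sum>i\<in>I. SUP t\<in>{0<..}. f i t)"
  proof (cases "I = {}")
    case False
    then have "1 \<le> ennreal (real (card I))" using I
      by (simp add: Suc_leI card_gt_0_iff flip: ennreal_1)
    from mult_right_mono[OF this] show ?thesis by fastforce
  qed simp
  finally show ?thesis using True by (simp add: tnorm_def quasi_const_def powr_one_gt_zero_iff)
next
  case False
  then show ?thesis using lnorm_sum_le[OF q I, of f haar] by (simp add: tnorm_eq_lnorm)
qed

lemma tnorm_Holder:
  assumes q: "q > 0" and k: "0 < j" "j < k"
    and [measurable]: "f \<in> borel_measurable borel" "g \<in> borel_measurable borel"
  shows "tnorm q (\<lambda>t. f t * g t)
    \<le> tnorm (q * of_nat k / of_nat j) f * tnorm (q * of_nat k / of_nat (k - j)) g"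
proof (cases "q = \<infinity>")
  case True
  have "(SUP t\<in>{0<..}. f t * g t) \<le> (SUP t\<in>{0<..}. f t) * (SUP t\<in>{0<..}. g t)"
    by (intro SUP_least mult_mono SUP_upper) auto
  then show ?thesis using True k by (simp add: tnorm_def exponent_top)
next
  case False
  then obtain r where r: "q = ennreal r" "r > 0"
    using q by (cases q) auto
  have "lnorm q haar (\<lambda>t. f t * g t)
    \<le> lnorm (q * of_nat k / of_nat j) haar f * lnorm (q * of_nat k / of_nat (k - j)) haar g"
    unfolding r(1) using k r
    by (intro lnorm_Holder[where p=r and a = "real j / real k" and b = "real (k - j) / real k"] exponent_ennreal)
       (auto simp: field_simps of_nat_diff)
  then show ?thesis using r k by (simp add: tnorm_eq_lnorm exponent_ennreal)
qed

text \<open>Only the interval [t, 2t] is kept: there the function is at least \<open>w t\<close>,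
  the weight at least (2t)^(-a), and the dt / t measure at least 1/2. Undoing the two factors gives
  2^a and 2^(1/q). For q = infinity the default value \<open>enn2real top = 0\<close> leaves the
  constant 2^a >= 1.\<close>

lemma weighted_le_tnorm:
  assumes q: "q > 0" and a: "a \<ge> 0" and mono: "\<And>x y. x \<le> y \<Longrightarrow> w x \<le> w y" and t: "t > 0"
  shows "ennreal (t powr (- a)) * w t
    \<le> ennreal (2 powr (a + 1 / enn2real q)) * tnorm q (\<lambda>t. ennreal (t powr (- a)) * w t)"
proof (cases "q = \<infinity>")
  case True
  have "ennreal (t powr (- a)) * w t \<le> (SUP t\<in>{0<..}. ennreal (t powr (- a)) * w t)"
    using t by (intro SUP_upper) auto
  also have "\<dots> \<le> ennreal (2 powr a) * \<dots>"
  proof -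
    have "1 \<le> ennreal (2 powr a)" using a by (simp add: ge_one_powr_ge_zero flip: ennreal_1)
    from mult_right_mono[OF this] show ?thesis by fastforce
  qed
  finally show ?thesis using True by (simp add: tnorm_def)
next
  case False
  define r where "r = enn2real q"
  have r: "r > 0" using enn2real_pos q False by (simp add: r_def)
  define A where "A = ennreal ((2 * t) powr (- a)) * w t"
  have [simp]: "w \<in> borel_measurable borel" using mono by (rule borel_measurable_mono_ennreal)
  have "ennreal_rpow A r * ennreal (1/2) = (\<integral>\<^sup>+\<tau>. ennreal_rpow A r * ennreal (1 / (2 * t)) * indicator {t..2*t} \<tau> \<partial>lborel)"
  proof -
    have "(\<integral>\<^sup>+\<tau>. ennreal_rpow A r * ennreal (1 / (2 * t)) * indicator {t..2*t} \<tau> \<partial>lborel)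
      = ennreal_rpow A r * ennreal (1 / (2 * t)) * ennreal t"
      using t by (subst nn_integral_cmult_indicator) auto
    also have "\<dots> = ennreal_rpow A r * ennreal (1/2)"
      using t unfolding mult.assoc by (subst ennreal_mult[symmetric]) auto
    finally show ?thesis by simp
  qed
  also have "\<dots> \<le> (\<integral>\<^sup>+\<tau>\<in>{0<..}. ennreal_rpow (ennreal (\<tau> powr (- a)) * w \<tau>) r / ennreal \<tau> \<partial>lborel)"
  proof (intro nn_integral_mono)
    fix \<tau>
    have "ennreal_rpow A r * ennreal (1 / (2 * t)) \<le> ennreal_rpow (ennreal (\<tau> powr (- a)) * w \<tau>) r / ennreal \<tau>"
      if \<tau>: "t \<le> \<tau>" "\<tau> \<le> 2 * t"
    proof -
      have "1 / ennreal \<tau> = ennreal (1 / \<tau>)"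
        using t \<tau> by (simp add: divide_ennreal flip: ennreal_1)
      then have e: "x / ennreal \<tau> = x * ennreal (1 / \<tau>)" for x
        by (metis ennreal_times_divide mult.right_neutral)
      show ?thesis unfolding e A_def using r t \<tau> a
        by (intro mult_mono ennreal_rpow_mono ennreal_leI mono powr_mono2' divide_left_mono) auto
    qed
    then show "ennreal_rpow A r * ennreal (1 / (2 * t)) * indicator {t..2 * t} \<tau>
      \<le> ennreal_rpow (ennreal (\<tau> powr - a) * w \<tau>) r / ennreal \<tau> * indicator {0<..} \<tau>"
      using t by (auto simp: indicator_def)
  qed
  finally have "ennreal_rpow (ennreal_rpow A r * ennreal (1/2)) (1/r) \<le> tnorm q (\<lambda>t. ennreal (t powr (- a)) * w t)"
    using False r by (simp add: tnorm_def r_def ennreal_rpow_mono)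
  then have *: "A * ennreal ((1/2) powr (1/r)) \<le> tnorm q (\<lambda>t. ennreal (t powr (- a)) * w t)"
    using r by (simp only: ennreal_rpow_mult ennreal_rpow_rpow) (simp add: ennreal_rpow_ennreal[of "1/2", simplified])
  have "ennreal (t powr (- a)) * w t = ennreal (2 powr (a + 1 / r)) * (A * ennreal ((1/2) powr (1/r)))"
  proof -
    have "2 powr (a + 1 / r) * ((2 * t) powr (- a) * (1/2) powr (1/r)) = t powr (- a)"
      using t by (simp add: powr_mult powr_add powr_divide powr_minus field_simps)
    then have "ennreal (t powr (- a)) = ennreal (2 powr (a + 1 / r)) * (ennreal ((2 * t) powr (- a)) * ennreal ((1/2) powr (1/r)))"
      by (simp add: ennreal_mult[symmetric])
    then show ?thesis unfolding A_def by (simp add: ac_simps)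
  qed
  also have "\<dots> \<le> ennreal (2 powr (a + 1 / r)) * tnorm q (\<lambda>t. ennreal (t powr (- a)) * w t)"
    by (intro mult_left_mono *) auto
  finally show ?thesis by (simp add: r_def)
qed

section \<open>The seminorm estimate\<close>

text \<open>The seminorm of order a = s j / k is built on differences of order m = floor(a) + 1. As
  s < k forces a < j, one has m <= j for j > 0, and raising the order is the easy direction. The
  second bound asks for j > 0: for j = 0 the weight is 1, and a nonzero constant has infinite norm
  for dt / t when q is finite. Both constants are chosen before the set \<open>U\<close>.\<close>

lemma weighted_modulus_le_besov_seminorm:
  fixes s :: real and p q :: ennreal
  assumes s: "s > 0" and p: "p > 0" and q: "q > 0" and k: "k = nat \<lfloor>s\<rfloor> + 1" and j: "j \<le> k"
  shows "\<exists>C\<ge>0. \<forall>(U :: 'a::euclidean_space set) u t. open U \<longrightarrow> u \<in> borel_measurable (lebesgue_on U) \<longrightarrow> t > 0 \<longrightarrow>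
    wmodulus (s * real j / real k) j (p * of_nat k / of_nat j) U u t
    \<le> ennreal C * besov_seminorm (s * real j / real k) q (p * of_nat k / of_nat j) U u"
    and "j > 0 \<Longrightarrow> \<exists>C\<ge>0. \<forall>(U :: 'a::euclidean_space set) u. open U \<longrightarrow> u \<in> borel_measurable (lebesgue_on U) \<longrightarrow>
    tnorm q (wmodulus (s * real j / real k) j (p * of_nat k / of_nat j) U u)
    \<le> ennreal C * besov_seminorm (s * real j / real k) q (p * of_nat k / of_nat j) U u"
proof -
  define P where "P = p * of_nat k / of_nat j"
  define a where "a = s * real j / real k"
  define m where "m = nat \<lfloor>a\<rfloor> + 1"
  define R where "R = ennreal (quasi_const P (Suc (j - m)) * 2 ^ (j - m))"
  have k0: "k > 0" "s < real k" using s k by linarith+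
  have P: "P > 0" unfolding P_def using p k0 by (intro ennreal_exponent_pos)
  have mj: "m \<le> j" "a > 0" if "j > 0"
  proof -
    have "a < real j" using k0 that by (simp add: a_def field_simps)
    then show "m \<le> j" unfolding m_def using that by linarith
    show "a > 0" using s k0 that by (simp add: a_def)
  qed
  have raise: "\<omega> j P U u t \<le> R * \<omega> m P U u t"
    if "j > 0" "open U" "u \<in> borel_measurable (lebesgue_on U)" for U :: "'a set" and u t
    using modulus_smoothness_raise[OF that(2,3) P, of m "j - m" t] mj that by (simp add: R_def)
  have sem: "besov_seminorm a q P U u = tnorm q (wmodulus a m P U u)"
    if "j > 0" for U :: "'a set" and u
    using mj that by (simp add: besov_seminorm_def besov_seminorm_pos_eq_tnorm m_def)
  show "\<exists>C\<ge>0. \<forall>(U :: 'a set) u t. open U \<longrightarrow> u \<in> borel_measurable (lebesgue_on U) \<longrightarrow> t > 0 \<longrightarrow>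
    wmodulus a j P U u t \<le> ennreal C * besov_seminorm a q P U u"
  proof (cases "j = 0")
    case True
    then have "P = \<infinity>" "a = 0" using exponent_0[OF p k0(1)] by (simp_all add: P_def a_def)
    have "wmodulus a j P U u t \<le> ennreal 1 * besov_seminorm a q P U u"
      if "open U" "u \<in> borel_measurable (lebesgue_on U)" "t > 0" for U :: "'a set" and u t
      using modulus_smoothness_0_le[OF that(1,2) P, of t] that True \<open>P = \<infinity>\<close> \<open>a = 0\<close>
      by (simp add: besov_seminorm_def)
    then show ?thesis by (intro exI[of _ 1]) auto
  next
    case False
    define c where "c = 2 powr (a + 1 / enn2real q)"
    have "wmodulus a j P U u t \<le> (R * ennreal c) * besov_seminorm a q P U u"
      if U: "open U" "u \<in> borel_measurable (lebesgue_on U)" "t > 0" for U :: "'a set" and u t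
    proof -
      have "wmodulus a j P U u t
        \<le> ennreal (t powr (- a)) * (R * \<omega> m P U u t)"
        using False U by (intro mult_left_mono raise) auto
      also have "\<dots> = R * (wmodulus a m P U u t)" by (simp only: ac_simps)
      also have "\<dots> \<le> R * (ennreal c * besov_seminorm a q P U u)"
        using mj False U unfolding sem[OF False[unfolded neq0_conv]] c_def
        by (intro mult_left_mono weighted_le_tnorm q modulus_smoothness_mono) auto
      finally show ?thesis by (simp only: ac_simps)
    qed
    then show ?thesis unfolding R_def
      by (intro exI[of _ "quasi_const P (Suc (j - m)) * 2 ^ (j - m) * c"])
         (auto simp: ennreal_mult quasi_const_nonneg c_def)
  qed
  show "\<exists>C\<ge>0. \<forall>(U :: 'a set) u. open U \<longrightarrow> u \<in> borel_measurable (lebesgue_on U) \<longrightarrow>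
    tnorm q (wmodulus a j P U u) \<le> ennreal C * besov_seminorm a q P U u"
    if j0: "j > 0"
  proof -
    have "tnorm q (wmodulus a j P U u) \<le> R * besov_seminorm a q P U u"
      if U: "open U" "u \<in> borel_measurable (lebesgue_on U)" for U :: "'a set" and u
    proof -
      have "tnorm q (wmodulus a j P U u)
        \<le> tnorm q (\<lambda>t. ennreal (t powr (- a)) * (R * \<omega> m P U u t))"
        using U j0 by (intro tnorm_mono mult_left_mono raise) auto
      also have "\<dots> = tnorm q (\<lambda>t. R * (wmodulus a m P U u t))"
        by (simp only: ac_simps)
      also have "\<dots> \<le> R * besov_seminorm a q P U u"
        unfolding sem[OF j0] by (intro tnorm_cmult_le q) measurable
      finally show ?thesis .
    qed
    then show ?thesis unfolding R_def
      by (intro exI[of _ "quasi_const P (Suc (j - m)) * 2 ^ (j - m)"]) (auto simp: quasi_const_nonneg)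
  qed
qed

text \<open>The common starting point of the seminorm estimate and of the membership proof, which
  treat the products on the right differently: by a supremum times a norm, or by Hoelder's
  inequality in t.\<close>

lemma tnorm_modulus_mult_le:
  fixes U :: "'a::euclidean_space set" and s :: real
  assumes U: "open U" and u: "u \<in> borel_measurable (lebesgue_on U)"
    and v: "v \<in> borel_measurable (lebesgue_on U)" and p: "p > 0" and q: "q > 0" and k: "k > 0"
  defines "w \<equiv> (\<lambda>j f t. wmodulus (s * real j / real k) j (p * of_nat k / of_nat j) U f t)"
  shows "tnorm q (wmodulus s k p U (\<lambda>x. u x * v x))
    \<le> ennreal (quasi_const p (Suc k) * quasi_const q (Suc k) * 2 ^ k) *
       (\<Sum>j\<le>k. tnorm q (\<lambda>t. w j u t * w (k - j) v t))"
proof -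
  have w[measurable]: "w j f \<in> borel_measurable borel" for j f
    unfolding w_def by measurable
  define c where "c = quasi_const p (Suc k) * 2 ^ k"
  have c0: "c \<ge> 0" by (simp add: c_def quasi_const_nonneg)
  have "tnorm q (wmodulus s k p U (\<lambda>x. u x * v x))
    \<le> tnorm q (\<lambda>t. ennreal c * (\<Sum>j\<le>k. w j u t * w (k - j) v t))"
  proof (rule tnorm_mono)
    fix t :: real assume t: "t > 0"
    let ?w = "\<lambda>j f. \<omega> j (p * of_nat k / of_nat j) U f t"
    have "wmodulus s k p U (\<lambda>x. u x * v x) t
      \<le> ennreal (t powr (- s)) * (ennreal (quasi_const p (Suc k)) *
         (\<Sum>j\<le>k. ennreal (real (k choose j)) * (?w j u * ?w (k - j) v)))"
      by (intro mult_left_mono modulus_smoothness_mult_le U u v p k) auto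
    also have "\<dots> \<le> ennreal (t powr (- s)) * (ennreal (quasi_const p (Suc k)) *
         (\<Sum>j\<le>k. ennreal (2 ^ k) * (?w j u * ?w (k - j) v)))"
    proof (intro mult_left_mono sum_mono mult_right_mono ennreal_leI)
      fix j
      have "k choose j \<le> 2 ^ k" by (rule binomial_le_pow2)
      then show "real (k choose j) \<le> 2 ^ k" by (metis of_nat_le_iff of_nat_numeral of_nat_power)
    qed auto
    also have "\<dots> = ennreal c * (\<Sum>j\<le>k. ennreal (t powr (- s)) * (?w j u * ?w (k - j) v))"
      by (simp add: c_def quasi_const_nonneg ennreal_mult sum_distrib_left ac_simps)
    also have "(\<Sum>j\<le>k. ennreal (t powr (- s)) * (?w j u * ?w (k - j) v)) = (\<Sum>j\<le>k. w j u t * w (k - j) v t)"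
    proof (rule sum.cong[OF refl])
      fix j assume "j \<in> {..k}"
      \<comment> \<open>The weight t^(-s) is shared between the two factors in the ratio j : k -
        j.\<close>
      then have "- s = - (s * real j / real k) + - (s * real (k - j) / real k)"
        using k by (simp add: field_simps of_nat_diff)
      then have "ennreal (t powr (- s)) = ennreal (t powr (- (s * real j / real k))) * ennreal (t powr (- (s * real (k - j) / real k)))"
        by (metis ennreal_mult powr_add powr_ge_zero)
      then show "ennreal (t powr (- s)) * (?w j u * ?w (k - j) v) = w j u t * w (k - j) v t"
        by (simp only: w_def ac_simps)
    qed
    finally show "wmodulus s k p U (\<lambda>x. u x * v x) t
      \<le> ennreal c * (\<Sum>j\<le>k. w j u t * w (k - j) v t)" .
  qed
  also have "\<dots> \<le> ennreal c * tnorm q (\<lambda>t. \<Sum>j\<le>k. w j u t * w (k - j) v t)"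
    by (intro tnorm_cmult_le q) measurable
  also have "\<dots> \<le> ennreal c * (ennreal (quasi_const q (card {..k})) * (\<Sum>j\<le>k. tnorm q (\<lambda>t. w j u t * w (k - j) v t)))"
    by (intro mult_left_mono tnorm_sum_le q) (auto intro!: borel_measurable_times_ennreal)
  finally show ?thesis
    by (simp add: c_def quasi_const_nonneg ennreal_mult ac_simps)
qed

lemma besov_seminorm_mult_le:
  fixes s :: real and p q :: ennreal
  assumes s: "s > 0" and p: "p > 0" and q: "q > 0" and k: "k = nat \<lfloor>s\<rfloor> + 1"
  shows "\<exists>C\<ge>0. \<forall>(U :: 'a::euclidean_space set) u v. open U \<longrightarrow>
    u \<in> borel_measurable (lebesgue_on U) \<longrightarrow> v \<in> borel_measurable (lebesgue_on U) \<longrightarrow>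
    besov_seminorm s q p U (\<lambda>x. u x * v x) \<le> ennreal C *
      (\<Sum>j\<le>k. besov_seminorm (s * real j / real k) q (p * of_nat k / of_nat j) U u *
              besov_seminorm (s * real (k - j) / real k) q (p * of_nat k / of_nat (k - j)) U v)"
proof -
  define P where "P = (\<lambda>j. p * of_nat k / (of_nat j :: ennreal))"
  define B where "B = (\<lambda>j U (u :: 'a \<Rightarrow> real). besov_seminorm (s * real j / real k) q (P j) U u)"
  define w where "w = (\<lambda>U j (f :: 'a \<Rightarrow> real) t. wmodulus (s * real j / real k) j (P j) U f t)"
  have [measurable]: "w U j f \<in> borel_measurable borel" for j f U
    unfolding w_def by measurable
  have k0: "k > 0" using k by simp
  have "\<forall>j\<in>{..k}. \<exists>C\<ge>0. \<forall>U u t. open U \<longrightarrow> u \<in> borel_measurable (lebesgue_on U) \<longrightarrow> t > 0 \<longrightarrow>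
     w U j u t \<le> ennreal C * B j U u"
    unfolding w_def B_def P_def
    by (intro ballI weighted_modulus_le_besov_seminorm(1)[OF s p q k]) simp
  then obtain C1 where C1: "\<And>j. j \<le> k \<Longrightarrow> C1 j \<ge> 0" "\<And>j U u t. j \<le> k \<Longrightarrow> open U \<Longrightarrow>
      u \<in> borel_measurable (lebesgue_on U) \<Longrightarrow> t > 0 \<Longrightarrow> w U j u t \<le> ennreal (C1 j) * B j U u"
    unfolding Ball_def atMost_iff by metis
  have "\<forall>j\<in>{0<..k}. \<exists>C\<ge>0. \<forall>U u. open U \<longrightarrow> u \<in> borel_measurable (lebesgue_on U) \<longrightarrow>
     tnorm q (w U j u) \<le> ennreal C * B j U u"
    unfolding w_def B_def P_def
    by (intro ballI weighted_modulus_le_besov_seminorm(2)[OF s p q k]) simp_all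
  then obtain C2 where C2: "\<And>j. 0 < j \<Longrightarrow> j \<le> k \<Longrightarrow> C2 j \<ge> 0" "\<And>j U u. 0 < j \<Longrightarrow> j \<le> k \<Longrightarrow> open U \<Longrightarrow>
      u \<in> borel_measurable (lebesgue_on U) \<Longrightarrow> tnorm q (w U j u) \<le> ennreal (C2 j) * B j U u"
    unfolding Ball_def greaterThanAtMost_iff by metis
  define D where "D = (\<Sum>j\<le>k. C1 j) + (\<Sum>j\<in>{0<..k}. C2 j)"
  have CD: "0 \<le> D" "\<And>j. j \<le> k \<Longrightarrow> C1 j \<le> D" "\<And>j. 0 < j \<Longrightarrow> j \<le> k \<Longrightarrow> C2 j \<le> D"
  proof -
    have n: "(\<Sum>j\<le>k. C1 j) \<ge> 0" "(\<Sum>j\<in>{0<..k}. C2 j) \<ge> 0"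
      using C1(1) C2(1) by (auto intro!: sum_nonneg)
    then show "0 \<le> D" by (simp add: D_def)
    show "C1 j \<le> D" if "j \<le> k" for j
      using member_le_sum[of j "{..k}" C1] that n C1(1) unfolding D_def by force
    show "C2 j \<le> D" if "0 < j" "j \<le> k" for j
      using member_le_sum[of j "{0<..k}" C2] that n C2(1) unfolding D_def by force
  qed
  \<comment> \<open>The factor of order i is estimated by its supremum in t, which allows i = 0; the
    norm in t falls on the other factor, hence 0 < j.\<close>
  have main: "tnorm q (\<lambda>t. w U i f t * w U j g t) \<le> ennreal (D * D) * (B i U f * B j U g)"
    if U: "open U" and f: "f \<in> borel_measurable (lebesgue_on U)" and g: "g \<in> borel_measurable (lebesgue_on U)"
    and ij: "i \<le> k" "0 < j" "j \<le> k" for U f g i j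
  proof -
    have "tnorm q (\<lambda>t. w U i f t * w U j g t) \<le> tnorm q (\<lambda>t. (ennreal (C1 i) * B i U f) * w U j g t)"
      by (intro tnorm_mono mult_right_mono C1 U f ij) auto
    also have "\<dots> \<le> (ennreal (C1 i) * B i U f) * tnorm q (w U j g)"
      by (intro tnorm_cmult_le q) measurable
    also have "\<dots> \<le> (ennreal D * B i U f) * (ennreal D * B j U g)"
    proof (intro mult_mono)
      show "tnorm q (w U j g) \<le> ennreal D * B j U g"
        using C2(2)[OF ij(2,3) U g] mult_right_mono[OF ennreal_leI[OF CD(3)[OF ij(2,3)]], of "B j U g"]
        by (auto intro: order.trans)
    qed (use CD ij in \<open>auto intro!: ennreal_leI\<close>)
    also have "\<dots> = ennreal (D * D) * (B i U f * B j U g)"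
      using CD by (simp add: ennreal_mult ac_simps)
    finally show ?thesis .
  qed
  define C where "C = quasi_const p (Suc k) * quasi_const q (Suc k) * 2 ^ k"
  have C: "C \<ge> 0" by (simp add: C_def quasi_const_nonneg)
  have "besov_seminorm s q p U (\<lambda>x. u x * v x) \<le> ennreal (C * (D * D)) * (\<Sum>j\<le>k. B j U u * B (k - j) U v)"
    if U: "open U" and u: "u \<in> borel_measurable (lebesgue_on U)" and v: "v \<in> borel_measurable (lebesgue_on U)"
    for U u v
  proof -
    have "besov_seminorm s q p U (\<lambda>x. u x * v x) =
        tnorm q (wmodulus s k p U (\<lambda>x. u x * v x))"
      using s k by (simp add: besov_seminorm_def besov_seminorm_pos_eq_tnorm)
    also have "\<dots> \<le> ennreal C * (\<Sum>j\<le>k. tnorm q (\<lambda>t. w U j u t * w U (k - j) v t))"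
      unfolding C_def w_def P_def by (rule tnorm_modulus_mult_le[OF U u v p q k0])
    also have "\<dots> \<le> ennreal C * (\<Sum>j\<le>k. ennreal (D * D) * (B j U u * B (k - j) U v))"
    proof (intro mult_left_mono sum_mono)
      fix j assume j: "j \<in> {..k}"
      show "tnorm q (\<lambda>t. w U j u t * w U (k - j) v t) \<le> ennreal (D * D) * (B j U u * B (k - j) U v)"
      proof (cases "j < k")
        case True
        then show ?thesis using j by (intro main U u v) auto
      next
        case False
        then have "j = k" using j by simp
        \<comment> \<open>For j = k the difference of order 0 falls on \<open>v\<close>, so the
          roles of \<open>u\<close> and \<open>v\<close> are exchanged.\<close>
        then show ?thesis using main[OF U v u, of 0 k] k0 by (simp add: mult.commute)
      qed
    qed simp
    also have "\<dots> = ennreal (C * (D * D)) * (\<Sum>j\<le>k. B j U u * B (k - j) U v)"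
      using C CD by (simp add: ennreal_mult sum_distrib_left mult.assoc)
    finally show ?thesis .
  qed
  then show ?thesis
    unfolding B_def P_def using C CD by (intro exI[of _ "C * (D * D)"]) auto
qed

section \<open>Marchaud's inequality on domains with interior cones\<close>

lemma nn_integral_haar_scale:
  assumes N: "N > 0" and [measurable]: "f \<in> borel_measurable borel"
  shows "(\<integral>\<^sup>+t. f (N * t) \<partial>haar) = (\<integral>\<^sup>+t. f t \<partial>haar)"
proof -
  have "(\<integral>\<^sup>+t. f t \<partial>haar) = (\<integral>\<^sup>+t. inverse (ennreal t) * indicator {0<..} t * f t \<partial>lborel)"
    unfolding haar_def by (subst nn_integral_density) auto
  also have "\<dots> = ennreal \<bar>N\<bar> * (\<integral>\<^sup>+t. inverse (ennreal (0 + N * t)) * indicator {0<..} (0 + N * t) * f (0 + N * t) \<partial>lborel)"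
    using N by (intro nn_integral_real_affine) auto
  also have "\<dots> = (\<integral>\<^sup>+t. ennreal N * (inverse (ennreal (N * t)) * indicator {0<..} (N * t) * f (N * t)) \<partial>lborel)"
    using N by (subst nn_integral_cmult) auto
  also have "\<dots> = (\<integral>\<^sup>+t. inverse (ennreal t) * indicator {0<..} t * f (N * t) \<partial>lborel)"
  proof (intro nn_integral_cong)
    fix t
    have "ennreal N * inverse (ennreal (N * t)) = inverse (ennreal t)" if "t > 0"
      using that N by (simp add: inverse_ennreal ennreal_mult[symmetric] field_simps)
    then show "ennreal N * (inverse (ennreal (N * t)) * indicator {0<..} (N * t) * f (N * t))
      = inverse (ennreal t) * indicator {0<..} t * f (N * t)"
      using N by (auto simp: indicator_def zero_less_mult_iff mult.assoc[symmetric])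
  qed
  also have "\<dots> = (\<integral>\<^sup>+t. f (N * t) \<partial>haar)"
    unfolding haar_def by (subst nn_integral_density) auto
  finally show ?thesis ..
qed

lemma tnorm_scale_le:
  assumes N: "N > 0" and [measurable]: "g \<in> borel_measurable borel"
  shows "tnorm q (\<lambda>t. g (N * t)) \<le> tnorm q g"
proof (cases "q = \<infinity>")
  case True
  then show ?thesis using N by (auto simp: tnorm_def intro!: SUP_least SUP_upper)
next
  case False
  then show ?thesis
    using nn_integral_haar_scale[OF N, of "\<lambda>t. ennreal_rpow (g t) (enn2real q)"]
    by (simp add: tnorm_eq_lnorm lnorm_def)
qed

text \<open>Needed twice: for t beyond the range of the recursion, where the modulus is merely
  bounded, and for the finiteness of truncated norms that makes absorption legitimate.\<close>

lemma tnorm_tail_finite: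
  assumes q: "q > 0" and s: "s > 0" and e: "e > 0"
  shows "tnorm q (\<lambda>t. ennreal (t powr (- s)) * indicator {e..} t) < \<infinity>"
proof (cases "q = \<infinity>")
  case True
  have "(SUP t\<in>{0<..}. ennreal (t powr (- s)) * indicator {e..} t) \<le> ennreal (e powr (- s))"
    using e s by (intro SUP_least) (auto simp: indicator_def intro!: ennreal_leI powr_mono2')
  then show ?thesis using True by (simp add: tnorm_def le_less_trans)
next
  case False
  define r where "r = enn2real q"
  have r: "r > 0" using enn2real_pos q False by (simp add: r_def)
  define b where "b = s * r"
  have b: "b > 0" using r s by (simp add: b_def)
  have "(\<integral>\<^sup>+t\<in>{0<..}. ennreal_rpow (ennreal (t powr (- s)) * indicator {e..} t) r / ennreal t \<partial>lborel)
    = (\<integral>\<^sup>+t. ennreal (t powr (- b - 1)) * indicator {e..} t \<partial>lborel)"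
  proof (intro nn_integral_cong)
    fix t :: real
    have "ennreal_rpow (ennreal (t powr (- s))) r / ennreal t = ennreal (t powr (- b - 1))" if "t > 0"
      using that by (simp add: ennreal_rpow_ennreal powr_powr divide_ennreal b_def powr_diff)
    then show "ennreal_rpow (ennreal (t powr (- s)) * indicator {e..} t) r / ennreal t * indicator {0<..} t
      = ennreal (t powr (- b - 1)) * indicator {e..} t"
      using e by (auto simp: indicator_def)
  qed
  also have "\<dots> = ennreal (0 - - (e powr (- b) / b))"
  proof (rule nn_integral_FTC_atLeast)
    show "DERIV (\<lambda>t. - (t powr (- b) / b)) x :> x powr (- b - 1)" if "e \<le> x" for x
      using that e b by (auto intro!: derivative_eq_intros simp: field_simps powr_diff)
    have "((\<lambda>t. t powr (- b)) \<longlongrightarrow> 0) at_top"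
      using b by (intro tendsto_neg_powr filterlim_ident) auto
    then have "((\<lambda>t. - (t powr (- b) / b)) \<longlongrightarrow> - (0 / b)) at_top"
      using b by (intro tendsto_minus tendsto_divide tendsto_const) auto
    then show "((\<lambda>t. - (t powr (- b) / b)) \<longlongrightarrow> 0) at_top" by simp
  qed auto
  finally show ?thesis using False by (simp add: tnorm_def r_def)
qed

lemma tnorm_le_of_truncations:
  assumes q: "q > 0" and [measurable]: "f \<in> borel_measurable borel"
    and B: "\<And>e. e > 0 \<Longrightarrow> tnorm q (\<lambda>t. f t * indicator {e..} t) \<le> B"
  shows "tnorm q f \<le> B"
proof (cases "q = \<infinity>")
  case True
  have "f t \<le> B" if "t > 0" for t
  proof -
    have "f t * indicator {t..} t \<le> tnorm q (\<lambda>s. f s * indicator {t..} s)"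
      using True that by (auto simp: tnorm_def intro!: SUP_upper2[of t])
    then show ?thesis using B[OF that] by simp
  qed
  then show ?thesis using True by (auto simp: tnorm_def intro!: SUP_least)
next
  case False
  define r where "r = enn2real q"
  have r: "r > 0" using enn2real_pos q False by (simp add: r_def)
  define F where "F = (\<lambda>n t. ennreal_rpow (f t * indicator {1 / real (Suc n)..} t) r / ennreal t * indicator {0<..} t)"
  have le: "(\<integral>\<^sup>+t. F n t \<partial>lborel) \<le> ennreal_rpow B r" for n
  proof -
    have "ennreal_rpow (\<integral>\<^sup>+t. F n t \<partial>lborel) (1 / r) \<le> B"
      using B[of "1 / real (Suc n)"] False by (simp add: tnorm_def F_def r_def)
    then show ?thesis using r by (simp add: ennreal_rpow_le_iff)
  qed
  have "(\<integral>\<^sup>+t\<in>{0<..}. ennreal_rpow (f t) r / ennreal t \<partial>lborel) = (\<integral>\<^sup>+t. (SUP n. F n t) \<partial>lborel)"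
  proof (intro nn_integral_cong antisym)
    fix t :: real
    show "ennreal_rpow (f t) r / ennreal t * indicator {0<..} t \<le> (SUP n. F n t)"
    proof (cases "t > 0")
      case True
      then obtain n where "1 / real (Suc n) < t" using nat_approx_posE by blast
      then show ?thesis using True by (intro SUP_upper2[of n]) (auto simp: F_def)
    qed simp
    show "(SUP n. F n t) \<le> ennreal_rpow (f t) r / ennreal t * indicator {0<..} t"
      using r by (intro SUP_least) (auto simp: F_def indicator_def)
  qed
  also have "\<dots> = (SUP n. \<integral>\<^sup>+t. F n t \<partial>lborel)"
  proof (rule nn_integral_monotone_convergence_SUP)
    show "incseq F"
    proof (intro incseq_SucI le_funI)
      fix n t
      have "1 / real (Suc (Suc n)) \<le> 1 / real (Suc n)" by (simp add: field_simps)
      then have "indicator {1 / real (Suc n)..} t \<le> (indicator {1 / real (Suc (Suc n))..} t :: ennreal)"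
        by (auto simp: indicator_def)
      then show "F n t \<le> F (Suc n) t"
        unfolding F_def using r
        by (intro mult_right_mono divide_right_mono_ennreal ennreal_rpow_mono mult_left_mono) auto
    qed
  qed (auto simp: F_def)
  also have "\<dots> \<le> ennreal_rpow B r" by (intro SUP_least le)
  finally show ?thesis using False r by (simp add: tnorm_def r_def[symmetric] ennreal_rpow_le_iff)
qed

text \<open>
  The cone with axis \<open>e\<close> is required at every point near \<open>B\<close>, so that one axis serves all the nodes
  of a difference with small step.
\<close>

definition interior_cone_atlas :: "('a::euclidean_space set \<times> 'a) set \<Rightarrow> real \<Rightarrow> real \<Rightarrow> 'a set \<Rightarrow> bool" where
  "interior_cone_atlas F c \<rho> U \<longleftrightarrow> finite F \<and> c > 0 \<and> \<rho> > 0 \<and> U \<subseteq> \<Union> (fst ` F) \<and>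
    (\<forall>(B, e)\<in>F. open B \<and> norm e = 1 \<and>
      (\<forall>x\<in>B \<inter> U. \<forall>y\<in>U \<inter> ball x \<rho>. \<forall>\<tau>\<in>{0<..\<rho>}. ball (y + \<tau> *\<^sub>R e) (c * \<tau>) \<subseteq> U))"

lemma interior_cone_atlasD:
  assumes "interior_cone_atlas F c \<rho> U"
  shows "finite F" "c > 0" "\<rho> > 0" "U \<subseteq> \<Union> (fst ` F)"
    and "\<And>B e. (B, e) \<in> F \<Longrightarrow> open B \<and> norm e = 1"
    and "\<And>B e x y \<tau>. (B, e) \<in> F \<Longrightarrow> x \<in> B \<Longrightarrow> x \<in> U \<Longrightarrow> y \<in> U \<Longrightarrow> dist x y < \<rho> \<Longrightarrow>
      0 < \<tau> \<Longrightarrow> \<tau> \<le> \<rho> \<Longrightarrow> ball (y + \<tau> *\<^sub>R e) (c * \<tau>) \<subseteq> U"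
proof -
  show "finite F" "c > 0" "\<rho> > 0" "U \<subseteq> \<Union> (fst ` F)"
    using assms by (simp_all add: interior_cone_atlas_def)
  have *: "open B \<and> norm e = 1 \<and>
      (\<forall>x\<in>B \<inter> U. \<forall>y\<in>U \<inter> ball x \<rho>. \<forall>\<tau>\<in>{0<..\<rho>}. ball (y + \<tau> *\<^sub>R e) (c * \<tau>) \<subseteq> U)"
    if "(B, e) \<in> F" for B e
    using assms unfolding interior_cone_atlas_def by (elim conjE) (drule bspec[OF _ that], unfold prod.case, assumption)
  show "open B \<and> norm e = 1" if "(B, e) \<in> F" for B e
    using *[OF that] by blast
  show "ball (y + \<tau> *\<^sub>R e) (c * \<tau>) \<subseteq> U"
    if "(B, e) \<in> F" "x \<in> B" "x \<in> U" "y \<in> U" "dist x y < \<rho>" "0 < \<tau>" "\<tau> \<le> \<rho>" for B e x y \<tau>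
  proof -
    have "x \<in> B \<inter> U" "y \<in> U \<inter> ball x \<rho>" "\<tau> \<in> {0<..\<rho>}" using that by auto
    then show ?thesis using *[OF that(1)] by blast
  qed
qed

lemma Lp_norm_shift_sum_le:
  fixes U :: "'a::euclidean_space set"
  assumes U: "open U" and u: "u \<in> borel_measurable (lebesgue_on U)" and P: "P > 0"
    and I: "finite I" and c: "\<And>i. i \<in> I \<Longrightarrow> c i \<ge> 0" and h: "\<And>i. i \<in> I \<Longrightarrow> norm (h i) \<le> t"
    and f: "f \<in> borel_measurable (lebesgue_on U)"
    and le: "\<And>x. x \<in> U \<Longrightarrow> \<bar>f x\<bar> \<le> (\<Sum>i\<in>I. c i * \<bar>diff_op U m (h i) u (x + y i)\<bar>)"
  shows "Lp_norm P U f \<le> ennreal (quasi_const P (card I) * (\<Sum>i\<in>I. c i)) * \<omega> m P U u t"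
proof -
  have "Lp_norm P U f \<le> ennreal (quasi_const P (card I)) *
    (\<Sum>i\<in>I. ennreal (c i) * Lp_norm P U (\<lambda>x. diff_op U m (h i) u (x + y i)))"
    by (intro Lp_norm_sum_le P I f c le measurable_diff_op_shift U u)
  also have "\<dots> \<le> ennreal (quasi_const P (card I)) * (\<Sum>i\<in>I. ennreal (c i) * \<omega> m P U u t)"
    by (intro mult_left_mono sum_mono Lp_norm_diff_op_shift_le U u P h) auto
  also have "\<dots> = ennreal (quasi_const P (card I) * (\<Sum>i\<in>I. c i)) * \<omega> m P U u t"
    using c by (simp add: sum_distrib_right[symmetric] sum_ennreal ennreal_mult quasi_const_nonneg sum_nonneg mult.assoc)
  finally show ?thesis .
qed

text \<open>For i >= 1 the point x + i g is the centre of a ball in \<open>U\<close> of radius c i M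
  |h| > N j |h|. Differences with the large step N h are therefore available there, and the scaling
  identity bounds the j-th difference with step h by N^(-j) times the one with step N h, plus
  differences of order j + 1. \<open>abs_fdiff_le_interior\<close> carries the bound back to
  x.\<close>

lemma abs_diff_op_le_in_chart:
  fixes u :: "'a::euclidean_space \<Rightarrow> real"
  assumes atlas: "interior_cone_atlas F c \<rho> U" and Be: "(B, e) \<in> F" and N: "N \<ge> 2"
    and L: "L + Suc j \<le> N * j" and step: "\<And>h (u :: 'a \<Rightarrow> real) x.
      fdiff j (real N *\<^sub>R h) u x = real N ^ j * fdiff j h u x + (\<Sum>l\<le>L. q l * fdiff (Suc j) h u (x + real l *\<^sub>R h))"
    and M: "M \<ge> 1" "M * c > real (N * j)" and h0: "norm h > 0" and small: "real (Suc j) * (M * norm h) \<le> \<rho>"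
    and xB: "x \<in> B" and xS: "x \<in> seg_dom U j h"
  defines "g \<equiv> (M * norm h) *\<^sub>R e" and "m \<equiv> Suc j"
  shows "\<bar>diff_op U j h u x\<bar> \<le> (\<Sum>l\<le>j. real (j choose l) * \<bar>diff_op U m g u (x + real l *\<^sub>R h)\<bar>)
    + (\<Sum>i=1..m. real (m choose i) * (\<bar>diff_op U j (real N *\<^sub>R h) u (x + real i *\<^sub>R g)\<bar> / real N ^ j
      + (\<Sum>l\<le>L. \<bar>q l\<bar> / real N ^ j * \<bar>diff_op U m h u (x + (real i *\<^sub>R g + real l *\<^sub>R h))\<bar>)))"
proof -
  note L = L[folded m_def] and step = step[folded m_def]
  note c = interior_cone_atlasD(2)[OF atlas] and \<rho> = interior_cone_atlasD(3)[OF atlas]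
    and cone = interior_cone_atlasD(6)[OF atlas]
  have xU: "x \<in> U" using xS seg_dom_subset by blast
  have Mm: "real i * (M * norm h) \<le> \<rho>" if "i \<le> m" for i
  proof -
    have "real i * (M * norm h) \<le> real m * (M * norm h)"
      using that M by (intro mult_right_mono) auto
    then show ?thesis using small by (simp add: m_def)
  qed
  have S1: "x + real l *\<^sub>R h \<in> seg_dom U m g" if l: "l \<le> j" for l
  proof -
    have y: "x + real l *\<^sub>R h \<in> U" using seg_dom_point[OF xS l] .
    have "real l * norm h < \<rho>"
    proof -
      have "real l * norm h < real m * norm h" using l h0 by (simp add: m_def)
      also have "\<dots> \<le> real m * (M * norm h)"
        using mult_right_mono[OF M(1), of "norm h"] by (intro mult_left_mono) auto
      also have "\<dots> \<le> \<rho>" by (rule Mm) simp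
      finally show ?thesis .
    qed
    then have d: "dist x (x + real l *\<^sub>R h) < \<rho>" by (simp add: dist_norm)
    have "x + real l *\<^sub>R h + \<tau> *\<^sub>R g \<in> U" if \<tau>: "\<tau> \<in> {0..real m}" for \<tau>
    proof (cases "\<tau> = 0")
      case True then show ?thesis using y by simp
    next
      case False
      have pos: "0 < \<tau> * (M * norm h)" using False \<tau> M h0 by auto
      have "\<tau> * (M * norm h) \<le> real m * (M * norm h)" using \<tau> M by (intro mult_right_mono) auto
      then have "\<tau> * (M * norm h) \<le> \<rho>" using Mm[of m] by simp
      from cone[OF Be xB xU y d pos this]
      have "ball (x + real l *\<^sub>R h + (\<tau> * (M * norm h)) *\<^sub>R e) (c * (\<tau> * (M * norm h))) \<subseteq> U" .
      moreover have "x + real l *\<^sub>R h + (\<tau> * (M * norm h)) *\<^sub>R e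
          \<in> ball (x + real l *\<^sub>R h + (\<tau> * (M * norm h)) *\<^sub>R e) (c * (\<tau> * (M * norm h)))"
        using pos c by simp
      ultimately show ?thesis by (auto simp: g_def)
    qed
    then show ?thesis by (simp add: seg_dom_def)
  qed
  \<comment> \<open>Here i >= 1 is essential: the ball around x + i g contains the whole segment of
    length N j |h|, whatever the direction of \<open>h\<close>.\<close>
  have S2: "x + real i *\<^sub>R g \<in> seg_dom U (N * j) h" if i: "1 \<le> i" "i \<le> m" for i
  proof -
    have pos: "0 < real i * (M * norm h)" using i M h0 by auto
    have "x + real i *\<^sub>R g + \<tau> *\<^sub>R h \<in> U" if \<tau>: "\<tau> \<in> {0..real (N * j)}" for \<tau>
    proof -
      have d: "dist x x < \<rho>" using \<rho> by simp
      have "\<tau> * norm h \<le> real (N * j) * norm h" using \<tau> by (intro mult_right_mono) auto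
      also have "\<dots> < M * c * norm h" using M h0 by (intro mult_strict_right_mono) auto
      also have "\<dots> \<le> real i * (M * c * norm h)" using i M c h0 by simp
      finally have "norm (\<tau> *\<^sub>R h) < c * (real i * (M * norm h))"
        using \<tau> by (simp add: ac_simps)
      then have "x + real i *\<^sub>R g + \<tau> *\<^sub>R h \<in> ball (x + (real i * (M * norm h)) *\<^sub>R e) (c * (real i * (M * norm h)))"
        by (simp add: g_def dist_norm)
      then show ?thesis using cone[OF Be xB xU xU d pos Mm[OF i(2)]] by blast
    qed
    then show ?thesis by (simp add: seg_dom_def)
  qed
  have inner: "\<bar>fdiff j h u (x + real i *\<^sub>R g)\<bar> \<le> \<bar>diff_op U j (real N *\<^sub>R h) u (x + real i *\<^sub>R g)\<bar> / real N ^ j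
     + (\<Sum>l\<le>L. \<bar>q l\<bar> / real N ^ j * \<bar>diff_op U m h u (x + (real i *\<^sub>R g + real l *\<^sub>R h))\<bar>)"
    if i: "1 \<le> i" "i \<le> m" for i
  proof -
    let ?y = "x + real i *\<^sub>R g"
    have Nj: "real N ^ j > 0" using N by simp
    have "?y \<in> seg_dom U j (real N *\<^sub>R h)"
    proof -
      have "?y + \<tau> *\<^sub>R real N *\<^sub>R h \<in> U" if "\<tau> \<in> {0..real j}" for \<tau>
      proof -
        have "\<tau> * real N \<in> {0..real (N * j)}" using that by (auto intro: mult_mono simp: mult.commute[of \<tau>] mult_left_mono)
        then show ?thesis using S2[OF i] by (simp add: seg_dom_def)
      qed
      then show ?thesis by (simp add: seg_dom_def)
    qed
    then have d1: "fdiff j (real N *\<^sub>R h) u ?y = diff_op U j (real N *\<^sub>R h) u ?y"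
      by (simp add: diff_op_eq)
    have d2: "fdiff m h u (?y + real l *\<^sub>R h) = diff_op U m h u (x + (real i *\<^sub>R g + real l *\<^sub>R h))" if "l \<le> L" for l
      using seg_dom_shift[OF S2[OF i], of l m] that L by (simp add: diff_op_eq add.assoc)
    \<comment> \<open>The scaling identity, solved for the difference with the small step.\<close>
    have "real N ^ j * fdiff j h u ?y = diff_op U j (real N *\<^sub>R h) u ?y
       - (\<Sum>l\<le>L. q l * diff_op U m h u (x + (real i *\<^sub>R g + real l *\<^sub>R h)))"
      using step[of h u ?y] d2 by (simp add: d1)
    moreover have "real N ^ j * \<bar>fdiff j h u ?y\<bar> = \<bar>real N ^ j * fdiff j h u ?y\<bar>"
      using Nj by (simp add: abs_mult)
    ultimately have "real N ^ j * \<bar>fdiff j h u ?y\<bar> \<le> \<bar>diff_op U j (real N *\<^sub>R h) u ?y\<bar>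
       + \<bar>\<Sum>l\<le>L. q l * diff_op U m h u (x + (real i *\<^sub>R g + real l *\<^sub>R h))\<bar>"
      by (simp only: abs_triangle_ineq4)
    also have "\<bar>\<Sum>l\<le>L. q l * diff_op U m h u (x + (real i *\<^sub>R g + real l *\<^sub>R h))\<bar>
      \<le> (\<Sum>l\<le>L. \<bar>q l\<bar> * \<bar>diff_op U m h u (x + (real i *\<^sub>R g + real l *\<^sub>R h))\<bar>)"
      by (rule order.trans[OF sum_abs]) (simp add: abs_mult)
    finally have "\<bar>fdiff j h u ?y\<bar> \<le> (\<bar>diff_op U j (real N *\<^sub>R h) u ?y\<bar>
       + (\<Sum>l\<le>L. \<bar>q l\<bar> * \<bar>diff_op U m h u (x + (real i *\<^sub>R g + real l *\<^sub>R h))\<bar>)) / real N ^ j"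
      using Nj by (simp add: pos_le_divide_eq mult.commute)
    then show ?thesis by (simp add: add_divide_distrib sum_divide_distrib)
  qed
  have "\<bar>diff_op U j h u x\<bar> = \<bar>fdiff j h u x\<bar>" using xS by (simp add: diff_op_eq)
  also have "\<dots> \<le> (\<Sum>l\<le>j. real (j choose l) * \<bar>fdiff m g u (x + real l *\<^sub>R h)\<bar>)
     + (\<Sum>i=1..m. real (m choose i) * \<bar>fdiff j h u (x + real i *\<^sub>R g)\<bar>)"
    by (rule abs_fdiff_le_interior)
  also have "(\<Sum>l\<le>j. real (j choose l) * \<bar>fdiff m g u (x + real l *\<^sub>R h)\<bar>)
     = (\<Sum>l\<le>j. real (j choose l) * \<bar>diff_op U m g u (x + real l *\<^sub>R h)\<bar>)"
    using S1 by (auto simp: diff_op_eq intro!: sum.cong)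
  also have "(\<Sum>i=1..m. real (m choose i) * \<bar>fdiff j h u (x + real i *\<^sub>R g)\<bar>)
    \<le> (\<Sum>i=1..m. real (m choose i) * (\<bar>diff_op U j (real N *\<^sub>R h) u (x + real i *\<^sub>R g)\<bar> / real N ^ j
     + (\<Sum>l\<le>L. \<bar>q l\<bar> / real N ^ j * \<bar>diff_op U m h u (x + (real i *\<^sub>R g + real l *\<^sub>R h))\<bar>)))"
    by (intro sum_mono mult_left_mono inner) auto
  finally show ?thesis by simp
qed

text \<open>The pointwise bound has three groups: order j + 1 in direction g, order j + 1 in
  direction h, and order j with step N h. Since g has length M |h| and M >= 1, both groups of order
  j + 1 are measured at M t. Only the last group will have to be absorbed, and apart from N^(-j) its
  constant does not involve N.\<close>

lemma Lp_norm_diff_op_in_chart_le: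
  fixes u :: "'a::euclidean_space \<Rightarrow> real"
  assumes U: "open U" and atlas: "interior_cone_atlas F c \<rho> U" and Be: "(B, e) \<in> F" and P: "P > 0"
    and u: "u \<in> borel_measurable (lebesgue_on U)" and N: "N \<ge> 2"
    and L: "L + Suc j \<le> N * j" and step: "\<And>h (u :: 'a \<Rightarrow> real) x.
      fdiff j (real N *\<^sub>R h) u x = real N ^ j * fdiff j h u x + (\<Sum>l\<le>L. q l * fdiff (Suc j) h u (x + real l *\<^sub>R h))"
    and M: "M \<ge> 1" "M * c > real (N * j)" and h0: "norm h > 0" and small: "real (Suc j) * (M * norm h) \<le> \<rho>"
    and h: "norm h \<le> t"
  defines "m \<equiv> Suc j" and "X \<equiv> \<omega> (Suc j) P U u (M * t)" and "Y \<equiv> \<omega> j P U u (real N * t)"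
    and "I2 \<equiv> {1..Suc j} \<times> {..L}" and "c2 \<equiv> (\<lambda>(i, l). real (Suc j choose i) * (\<bar>q l\<bar> / real N ^ j))"
  shows "Lp_norm P U (\<lambda>x. indicator B x * diff_op U j h u x) \<le> ennreal (quasi_const P 3) *
    (ennreal (quasi_const P (Suc j) * 2 ^ j + quasi_const P (card I2) * (\<Sum>i\<in>I2. c2 i)) * X
      + ennreal (quasi_const P m * 2 ^ m / real N ^ j) * Y)"
proof -
  have e1: "norm e = 1" and oB: "open B" using interior_cone_atlasD(5)[OF atlas Be] by auto
  have [measurable]: "B \<in> sets lebesgue" using oB by (simp add: borel_open)
  note ms = measurable_diff_op_shift[OF U u]
  have c2: "\<And>i. c2 i \<ge> 0" by (auto simp: c2_def)
  have t: "0 < t" using h h0 by linarith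
  define A where "A = quasi_const P (Suc j) * 2 ^ j + quasi_const P (card I2) * (\<Sum>i\<in>I2. c2 i)"
  define R where "R = ennreal (quasi_const P 3) * (ennreal A * X + ennreal (quasi_const P m * 2 ^ m / real N ^ j) * Y)"
  define g where "g = (M * norm h) *\<^sub>R e"
  have ng: "norm g = M * norm h" using M e1 by (simp add: g_def)
  define G where "G = (\<lambda>i x. if i = (0::nat) then (\<Sum>l\<in>{..j}. real (j choose l) * \<bar>diff_op U m g u (x + real l *\<^sub>R h)\<bar>)
    else if i = 1 then (\<Sum>p\<in>I2. c2 p * \<bar>diff_op U m h u (x + (real (fst p) *\<^sub>R g + real (snd p) *\<^sub>R h))\<bar>)
    else (\<Sum>i\<in>{1..m}. (real (m choose i) / real N ^ j) * \<bar>diff_op U j (real N *\<^sub>R h) u (x + real i *\<^sub>R g)\<bar>))"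
  have mG[measurable]: "G i \<in> borel_measurable (lebesgue_on U)" for i
    unfolding G_def using ms by (cases "i = 0"; cases "i = 1") (auto intro!: borel_measurable_sum borel_measurable_times borel_measurable_abs)
  have G0: "G i x \<ge> 0" for i x
    using c2 by (auto simp: G_def intro!: sum_nonneg)
  have pw: "\<bar>indicator B x * diff_op U j h u x\<bar> \<le> (\<Sum>i\<in>{..<3}. 1 * \<bar>G i x\<bar>)" for x
  proof (cases "x \<in> B \<and> x \<in> seg_dom U j h")
    case True
    then have "\<bar>diff_op U j h u x\<bar> \<le> G 0 x + (G 2 x + G 1 x)"
      using abs_diff_op_le_in_chart[OF atlas Be N L[unfolded m_def] step[unfolded m_def] M h0 _ , of x u] small
      by (simp add: G_def I2_def c2_def g_def m_def sum.cartesian_product' sum.distrib distrib_left sum_distrib_left mult.assoc)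
    moreover have xB: "x \<in> B" using True by simp
    ultimately have "\<bar>diff_op U j h u x\<bar> \<le> G 0 x + G 1 x + G 2 x" by simp
    then show ?thesis using xB G0 by (simp add: numeral_3_eq_3 numeral_2_eq_2)
  next
    case False
    then have "indicator B x * diff_op U j h u x = 0" by (auto simp: diff_op_eq indicator_def)
    moreover have "0 \<le> (\<Sum>i\<in>{..<3}. 1 * \<bar>G i x\<bar>)" by (intro sum_nonneg) auto
    ultimately show ?thesis by (simp only: abs_zero)
  qed
  have mf: "(\<lambda>x. indicator B x * diff_op U j h u x) \<in> borel_measurable (lebesgue_on U)"
    using measurable_diff_op[OF U u, of j h] by (intro measurable_restrict_space1) measurable
  have "Lp_norm P U (\<lambda>x. indicator B x * diff_op U j h u x)
     \<le> ennreal (quasi_const P (card {..<3::nat})) * (\<Sum>i\<in>{..<3}. ennreal 1 * Lp_norm P U (G i))"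
    by (intro Lp_norm_sum_le P mf mG pw) auto
  also have "\<dots> = ennreal (quasi_const P 3) * (Lp_norm P U (G 0) + Lp_norm P U (G 1) + Lp_norm P U (G 2))"
    by (simp add: numeral_3_eq_3 numeral_2_eq_2 add.assoc)
  also have "\<dots> \<le> ennreal (quasi_const P 3) * (ennreal (quasi_const P (Suc j) * 2 ^ j) * X
    + ennreal (quasi_const P (card I2) * (\<Sum>i\<in>I2. c2 i)) * X + ennreal (quasi_const P m * 2 ^ m / real N ^ j) * Y)"
  proof (intro mult_left_mono add_mono)
    have "Lp_norm P U (G 0) \<le> ennreal (quasi_const P (card {..j}) * (\<Sum>l\<in>{..j}. real (j choose l))) * X"
      unfolding X_def m_def[symmetric]
      by (rule Lp_norm_shift_sum_le[OF U u P _ _ _ mG, where h="\<lambda>_. g" and y="\<lambda>l. real l *\<^sub>R h"])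
         (use ng h M in \<open>auto simp: G_def sum_nonneg intro!: mult_left_mono\<close>)
    then show "Lp_norm P U (G 0) \<le> ennreal (quasi_const P (Suc j) * 2 ^ j) * X" by (simp add: sum_choose)
    have hM: "norm h \<le> M * t"
      using h M t mult_mono[of 1 M "norm h" t] by simp
    show "Lp_norm P U (G 1) \<le> ennreal (quasi_const P (card I2) * (\<Sum>i\<in>I2. c2 i)) * X"
      unfolding X_def m_def[symmetric]
      by (rule Lp_norm_shift_sum_le[OF U u P _ _ _ mG, where h="\<lambda>_. h" and y="\<lambda>p. real (fst p) *\<^sub>R g + real (snd p) *\<^sub>R h"])
         (use hM c2 in \<open>auto simp: G_def I2_def sum_nonneg\<close>)
    have "Lp_norm P U (G 2) \<le> ennreal (quasi_const P (card {1..m}) * (\<Sum>i\<in>{1..m}. real (m choose i) / real N ^ j)) * Y"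
      unfolding Y_def
      by (rule Lp_norm_shift_sum_le[OF U u P _ _ _ mG, where h="\<lambda>_. real N *\<^sub>R h" and y="\<lambda>i. real i *\<^sub>R g"])
         (use h in \<open>auto simp: G_def sum_nonneg mult_left_mono\<close>)
    also have "\<dots> \<le> ennreal (quasi_const P m * 2 ^ m / real N ^ j) * Y"
    proof (intro mult_right_mono ennreal_leI)
      show "quasi_const P (card {1..m}) * (\<Sum>i\<in>{1..m}. real (m choose i) / real N ^ j) \<le> quasi_const P m * 2 ^ m / real N ^ j"
        by (simp add: sum_divide_distrib[symmetric] sum_choose_pos[simplified]
            divide_right_mono mult_left_mono quasi_const_nonneg)
    qed simp
    finally show "Lp_norm P U (G 2) \<le> ennreal (quasi_const P m * 2 ^ m / real N ^ j) * Y" .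
  qed simp
  also have "\<dots> = R"
  proof -
    have "ennreal A = ennreal (quasi_const P (Suc j) * 2 ^ j) + ennreal (quasi_const P (card I2) * (\<Sum>i\<in>I2. c2 i))"
      unfolding A_def using c2 by (intro ennreal_plus mult_nonneg_nonneg quasi_const_nonneg sum_nonneg) auto
    then show ?thesis by (simp add: R_def distrib_right)
  qed
  finally show ?thesis by (simp add: R_def A_def)
qed

text \<open>
  The constant \<open>C0\<close> is independent of \<open>N\<close>, so the factor \<open>C0 / N\<^sup>j\<close> beats any power \<open>N\<^bsup>-\<sigma>\<^esup>\<close> with \<open>\<sigma> < j\<close>.
  Replacing \<open>x\<close> by points \<open>x + i g\<close> further inside the domain makes room for steps of size
  \<open>N h\<close> in every direction; the factor this costs does not depend on \<open>N\<close>.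
\<close>

lemma Marchaud_recursion:
  fixes U :: "'a::euclidean_space set"
  assumes U: "open U" and atlas: "interior_cone_atlas F c \<rho> U" and P: "P > 0" and j: "j \<ge> 1"
  shows "\<exists>C0\<ge>0. \<forall>N\<ge>2. \<exists>C1\<ge>0. \<exists>M>0. \<exists>t0>0. \<forall>u t. u \<in> borel_measurable (lebesgue_on U) \<longrightarrow> 0 < t \<longrightarrow> t \<le> t0 \<longrightarrow>
    \<omega> j P U u t \<le> ennreal C1 * \<omega> (Suc j) P U u (M * t)
      + ennreal (C0 / real N ^ j) * \<omega> j P U u (real N * t)"
proof -
  define m where "m = Suc j"
  define Q where "Q = quasi_const P (card F) * real (card F) * quasi_const P 3"
  define C0 where "C0 = Q * (quasi_const P m * 2 ^ m)"
  note F = interior_cone_atlasD(1)[OF atlas] and c = interior_cone_atlasD(2)[OF atlas]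
    and \<rho> = interior_cone_atlasD(3)[OF atlas] and cover = interior_cone_atlasD(4)[OF atlas]
    and ball_chart = interior_cone_atlasD(5)[OF atlas] and cone = interior_cone_atlasD(6)[OF atlas]
  have Q: "Q \<ge> 0" by (simp add: Q_def quasi_const_nonneg)
  have C0: "C0 \<ge> 0" using Q by (simp add: C0_def quasi_const_nonneg)
  have "\<exists>C1\<ge>0. \<exists>M>0. \<exists>t0>0. \<forall>u t. u \<in> borel_measurable (lebesgue_on U) \<longrightarrow> 0 < t \<longrightarrow> t \<le> t0 \<longrightarrow>
    \<omega> j P U u t \<le> ennreal C1 * \<omega> m P U u (M * t)
      + ennreal (C0 / real N ^ j) * \<omega> j P U u (real N * t)" if N: "N \<ge> 2" for N
  proof -
    obtain L q where L: "L + m \<le> N * j" and step: "\<And>h (u :: 'a \<Rightarrow> real) x.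
      fdiff j (real N *\<^sub>R h) u x = real N ^ j * fdiff j h u x + (\<Sum>l\<le>L. q l * fdiff m h u (x + real l *\<^sub>R h))"
      using fdiff_scale_step[OF j N, where 'a='a] unfolding m_def by blast
    \<comment> \<open>M c must exceed N j, the length in units of |h| of the segment that has to fit
      into a ball of the cone.\<close>
    define M where "M = (real (N * j) + 1) / c + 1"
    have M: "M \<ge> 1" "M * c > real (N * j)" 
    proof -
      show "M \<ge> 1" using c by (simp add: M_def)
      have "M * c = real (N * j) + 1 + c" using c by (simp add: M_def field_simps)
      then show "M * c > real (N * j)" using c by linarith
    qed
    \<comment> \<open>The farthest displaced point x + m g is reached by going m M |h| along the
      axis, which must not exceed the height \<rho> of the cones.\<close>
    define t0 where "t0 = \<rho> / (M * real m)"
    have t0: "t0 > 0" using M \<rho> by (simp add: t0_def m_def)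
    define I2 where "I2 = {1..m} \<times> {..L}"
    define c2 where "c2 = (\<lambda>(i, l). real (m choose i) * (\<bar>q l\<bar> / real N ^ j))"
    define A where "A = quasi_const P (Suc j) * 2 ^ j + quasi_const P (card I2) * (\<Sum>i\<in>I2. c2 i)"
    have c2: "\<And>i. c2 i \<ge> 0" by (auto simp: c2_def)
    have A: "A \<ge> 0" unfolding A_def using c2 by (intro add_nonneg_nonneg mult_nonneg_nonneg quasi_const_nonneg sum_nonneg) auto
    have main: "\<omega> j P U u t \<le> ennreal (Q * A) * \<omega> m P U u (M * t)
      + ennreal (C0 / real N ^ j) * \<omega> j P U u (real N * t)"
      if u: "u \<in> borel_measurable (lebesgue_on U)" and t: "0 < t" "t \<le> t0" for u t
      unfolding modulus_smoothness_def[of j P U u t]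
    proof (rule SUP_least, clarify)
      fix h :: 'a assume h: "norm h \<le> t"
      note ms = measurable_diff_op_shift[OF U u]
      define X where "X = \<omega> m P U u (M * t)"
      define Y where "Y = \<omega> j P U u (real N * t)"
      define R where "R = ennreal (quasi_const P 3) * (ennreal A * X + ennreal (quasi_const P m * 2 ^ m / real N ^ j) * Y)"
      show "Lp_norm P U (diff_op U j h u) \<le> ennreal (Q * A) * \<omega> m P U u (M * t)
          + ennreal (C0 / real N ^ j) * \<omega> j P U u (real N * t)"
      \<comment> \<open>For h = 0 the displacement g vanishes too and gains no room, but a
        difference of order j >= 1 with step 0 is zero anyway.\<close>
      proof (cases "h = 0")
        case True
        have "fdiff j 0 u x = 0" for x
          using j by (cases j) (simp_all add: fdiff_Suc)
        then have "diff_op U j h u = (\<lambda>x. 0)" using True by (auto simp: diff_op_eq)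
        then have "Lp_norm P U (diff_op U j h u) \<le> 0"
          using Lp_norm_sum_le[OF P finite.emptyI, of "diff_op U j h u"] by simp
        then show ?thesis by simp
      next
        case False
        then have h0: "norm h > 0" by simp
        have small: "real m * (M * norm h) \<le> \<rho>"
        proof -
          have "real m * (M * norm h) \<le> real m * (M * t0)" using h t M by (intro mult_left_mono) auto
          also have "\<dots> = \<rho>" using M by (simp add: t0_def m_def)
          finally show ?thesis .
        qed
        have chart: "Lp_norm P U (\<lambda>x. indicator (fst b) x * diff_op U j h u x) \<le> R" if "b \<in> F" for b
        proof -
          have "(fst b, snd b) \<in> F" using that by simp
          from Lp_norm_diff_op_in_chart_le[OF U atlas this P u N L[unfolded m_def] step[unfolded m_def] M h0 small[unfolded m_def] h]
          show ?thesis unfolding R_def X_def Y_def A_def I2_def c2_def m_def .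
        qed
        have mb: "(\<lambda>x. indicator (fst b) x * diff_op U j h u x) \<in> borel_measurable (lebesgue_on U)" if "b \<in> F" for b
        proof -
          have "open (fst b)" using ball_chart that by (cases b) auto
          then have [measurable]: "fst b \<in> sets lebesgue" by (simp add: borel_open)
          show ?thesis
            using measurable_diff_op[OF U u, of j h] by (intro measurable_restrict_space1) measurable
        qed
        have "Lp_norm P U (diff_op U j h u) \<le> ennreal (quasi_const P (card F)) *
           (\<Sum>b\<in>F. ennreal 1 * Lp_norm P U (\<lambda>x. indicator (fst b) x * diff_op U j h u x))"
        proof (intro Lp_norm_sum_le P F mb measurable_diff_op_lebesgue_on U u)
          fix x assume "x \<in> U"
          then obtain b where b: "b \<in> F" "x \<in> fst b" using cover by auto
          have "\<bar>diff_op U j h u x\<bar> = 1 * \<bar>indicator (fst b) x * diff_op U j h u x\<bar>" using b by simp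
          also have "\<dots> \<le> (\<Sum>b\<in>F. 1 * \<bar>indicator (fst b) x * diff_op U j h u x\<bar>)"
            using b F by (intro member_le_sum) auto
          finally show "\<bar>diff_op U j h u x\<bar> \<le> (\<Sum>b\<in>F. 1 * \<bar>indicator (fst b) x * diff_op U j h u x\<bar>)" .
        qed auto
        also have "\<dots> \<le> ennreal (quasi_const P (card F)) * (\<Sum>b\<in>F. R)"
          by (intro mult_left_mono sum_mono) (auto simp: chart)
        also have "\<dots> = ennreal (Q * A) * X + ennreal (C0 / real N ^ j) * Y"
        proof -
          have "ennreal (quasi_const P (card F)) * (\<Sum>b\<in>F. R) = ennreal Q * (ennreal A * X + ennreal (quasi_const P m * 2 ^ m / real N ^ j) * Y)"
            by (simp add: R_def Q_def ennreal_mult quasi_const_nonneg ennreal_of_nat_eq_real_of_nat mult.assoc)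
          also have "\<dots> = ennreal (Q * A) * X + ennreal (Q * (quasi_const P m * 2 ^ m / real N ^ j)) * Y"
          proof -
            have "ennreal (Q * A) = ennreal Q * ennreal A" using Q A by (rule ennreal_mult)
            moreover have "ennreal (Q * (quasi_const P m * 2 ^ m / real N ^ j)) = ennreal Q * ennreal (quasi_const P m * 2 ^ m / real N ^ j)"
              using Q by (intro ennreal_mult) (simp_all add: quasi_const_nonneg)
            ultimately show ?thesis by (simp only: distrib_left mult.assoc)
          qed
          finally show ?thesis by (simp add: C0_def)
        qed
        finally show ?thesis by (simp add: X_def Y_def)
      qed
    qed
    then show ?thesis using Q A t0 M by (intro exI[of _ "Q * A"] conjI exI[of _ M] exI[of _ t0]) auto
  qed
  then show ?thesis using C0 unfolding m_def by blast
qed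

text \<open>
  Cutting off at \<open>t \<ge> e\<close> makes the left-hand side finite, so that the last term of the recursion can
  be absorbed, uniformly in \<open>e\<close>.
\<close>

lemma Marchaud_step:
  fixes U :: "'a::euclidean_space set"
  assumes U: "open U" and atlas: "interior_cone_atlas F c \<rho> U" and P: "P > 0" and q: "q > 0"
    and \<sigma>: "0 < \<sigma>" "\<sigma> < real j"
    and u: "u \<in> borel_measurable (lebesgue_on U)" and fin: "Lp_norm P U u < \<infinity>"
    and hyp: "tnorm q (wmodulus \<sigma> (Suc j) P U u) < \<infinity>"
  shows "tnorm q (wmodulus \<sigma> j P U u) < \<infinity>"
proof -
  have j: "j \<ge> 1" using \<sigma> by (cases j) auto
  obtain C0 where C0: "C0 \<ge> 0" and rec: "\<And>N. N \<ge> 2 \<Longrightarrow> \<exists>C1\<ge>0. \<exists>M>0. \<exists>t0>0. \<forall>u t. u \<in> borel_measurable (lebesgue_on U) \<longrightarrow> 0 < t \<longrightarrow> t \<le> t0 \<longrightarrow>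
    \<omega> j P U u t \<le> ennreal C1 * \<omega> (Suc j) P U u (M * t)
      + ennreal (C0 / real N ^ j) * \<omega> j P U u (real N * t)"
    using Marchaud_recursion[OF U atlas P j] by blast
  define K where "K = quasi_const q 3"
  have K: "K \<ge> 0" by (simp add: K_def quasi_const_nonneg)
  \<comment> \<open>After multiplication by the weight, the factor C0 / N^j of the dilated term
    becomes C0 N^(\<sigma> - j), which tends to 0 because \<sigma> < j. \<open>K\<close> is the
    quasi-norm constant for three terms, and 1/2 leaves room for absorption.\<close>
  obtain N :: nat where N: "N \<ge> 2" and small: "K * (C0 * real N powr (\<sigma> - real j)) \<le> 1/2"
  proof -
    have "((\<lambda>n. K * (C0 * real n powr (\<sigma> - real j))) \<longlongrightarrow> K * (C0 * 0)) sequentially"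
      using \<sigma> by (intro tendsto_intros tendsto_neg_powr filterlim_real_sequentially) auto
    then have "eventually (\<lambda>n. K * (C0 * real n powr (\<sigma> - real j)) < 1/2) sequentially"
      by (rule order_tendstoD) simp
    then have "eventually (\<lambda>n. n \<ge> 2 \<and> K * (C0 * real n powr (\<sigma> - real j)) < 1/2) sequentially"
      using eventually_ge_at_top[of 2] by eventually_elim auto
    then show thesis using that by (auto simp: eventually_sequentially intro: less_imp_le)
  qed
  obtain C1 M t0 where C1: "C1 \<ge> 0" "M > 0" "t0 > 0" and r: "\<And>t. 0 < t \<Longrightarrow> t \<le> t0 \<Longrightarrow>
    \<omega> j P U u t \<le> ennreal C1 * \<omega> (Suc j) P U u (M * t)
      + ennreal (C0 / real N ^ j) * \<omega> j P U u (real N * t)"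
    using rec[OF N] u by blast
  have N0: "real N > 0" using N by simp
  define \<phi> where "\<phi> = (wmodulus \<sigma> j P U u)"
  define \<psi> where "\<psi> = (wmodulus \<sigma> (Suc j) P U u)"
  define \<phi>e where "\<phi>e = (\<lambda>e t. \<phi> t * indicator {e..} t)"
  define B where "B = ennreal (quasi_const P (Suc j) * 2 ^ j) * Lp_norm P U u"
  have B: "B < \<infinity>" using fin by (simp add: B_def ennreal_mult_less_top)
  define tail where "tail = (\<lambda>e t. ennreal (t powr (- \<sigma>)) * indicator {e..} (t::real))"
  have [measurable]: "\<phi> \<in> borel_measurable borel" "\<psi> \<in> borel_measurable borel"
    "\<phi>e e \<in> borel_measurable borel" "tail e \<in> borel_measurable borel" for e
    unfolding \<phi>_def \<psi>_def \<phi>e_def tail_def by measurable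
  have \<phi>B: "\<phi> t \<le> ennreal (t powr (- \<sigma>)) * B" for t
    unfolding \<phi>_def B_def by (intro mult_left_mono modulus_smoothness_le_Lp_norm U u P) auto
  define \<theta> where "\<theta> = C0 * real N powr (\<sigma> - real j)"
  have \<theta>: "\<theta> \<ge> 0" using C0 by (simp add: \<theta>_def)
  have small\<phi>: "\<phi> t \<le> ennreal (C1 * M powr \<sigma>) * \<psi> (M * t) + ennreal \<theta> * \<phi> (real N * t)" if t: "0 < t" "t \<le> t0" for t
  proof -
    have "\<phi> t \<le> ennreal (t powr (- \<sigma>)) * (ennreal C1 * \<omega> (Suc j) P U u (M * t)
      + ennreal (C0 / real N ^ j) * \<omega> j P U u (real N * t))"
      unfolding \<phi>_def using r[OF t] by (intro mult_left_mono) auto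
    also have "\<dots> = (ennreal (t powr (- \<sigma>)) * ennreal C1) * \<omega> (Suc j) P U u (M * t)
      + (ennreal (t powr (- \<sigma>)) * ennreal (C0 / real N ^ j)) * \<omega> j P U u (real N * t)"
      by (simp only: distrib_left mult.assoc)
    also have "ennreal (t powr (- \<sigma>)) * ennreal C1 = ennreal (C1 * M powr \<sigma>) * ennreal ((M * t) powr (- \<sigma>))"
      using C1 t by (simp add: ennreal_mult[symmetric] powr_mult powr_minus field_simps)
    also have "ennreal (t powr (- \<sigma>)) * ennreal (C0 / real N ^ j) = ennreal \<theta> * ennreal ((real N * t) powr (- \<sigma>))"
    proof -
      have "\<theta> * (real N * t) powr (- \<sigma>) = t powr (- \<sigma>) * (C0 / real N ^ j)"
        using t N0 by (simp add: \<theta>_def powr_mult powr_minus powr_diff powr_realpow field_simps)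
      then show ?thesis using \<theta> C0 by (simp add: ennreal_mult[symmetric])
    qed
    finally show ?thesis by (simp only: \<phi>_def \<psi>_def mult.assoc)
  qed
  \<comment> \<open>The first two terms come from the recursion and serve t <= t0; the third covers
    t > t0, where the modulus is only bounded through the L_p norm.\<close>
  define G where "G = (\<lambda>e i t. if i = (0::nat) then ennreal (C1 * M powr \<sigma>) * \<psi> (M * t)
    else if i = 1 then ennreal \<theta> * \<phi>e e (real N * t) else B * tail t0 t)"
  have [measurable]: "G e i \<in> borel_measurable borel" for e i
    unfolding G_def by (cases "i = 0"; cases "i = 1") simp_all
  define T where "T = ennreal (C1 * M powr \<sigma>) * tnorm q \<psi> + B * tnorm q (tail t0)"
  have "tnorm q \<phi> \<le> 2 * (ennreal K * T)"
  proof (rule tnorm_le_of_truncations[OF q])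
    fix e :: real assume e: "e > 0"
    have pw: "\<phi>e e t \<le> (\<Sum>i\<in>{..<3}. G e i t)" if t: "t > 0" for t
    proof (cases "e \<le> t")
      case True
      \<comment> \<open>The cut-off is compatible with the dilation: t >= e and N >= 1 put N t in
        the truncated range as well.\<close>
      then have Nt: "e \<le> real N * t" 
      proof -
        have "1 * t \<le> real N * t" using N t by (intro mult_right_mono) auto
        then show ?thesis using True by linarith
      qed
      have "\<phi> t \<le> G e 0 t + G e 1 t + G e 2 t"
      proof (cases "t \<le> t0")
        case True
        then show ?thesis using small\<phi>[OF t True] Nt by (auto simp: G_def \<phi>e_def intro: add_increasing2)
      next
        case False
        then have "\<phi> t \<le> G e 2 t" using \<phi>B[of t] by (simp add: G_def tail_def mult.commute)
        then show ?thesis by (simp add: add_increasing)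
      qed
      then show ?thesis using True by (simp add: \<phi>e_def numeral_3_eq_3 numeral_2_eq_2 add.assoc)
    qed (simp add: \<phi>e_def)
    have "tnorm q (\<phi>e e) \<le> tnorm q (\<lambda>t. \<Sum>i\<in>{..<3}. G e i t)" by (intro tnorm_mono pw)
    also have "\<dots> \<le> ennreal (quasi_const q (card {..<3::nat})) * (\<Sum>i\<in>{..<3}. tnorm q (G e i))"
      by (intro tnorm_sum_le q) auto
    also have "\<dots> = ennreal K * (tnorm q (G e 0) + tnorm q (G e 1) + tnorm q (G e 2))"
      by (simp add: K_def numeral_3_eq_3 numeral_2_eq_2 add.assoc)
    also have "\<dots> \<le> ennreal K * (ennreal (C1 * M powr \<sigma>) * tnorm q \<psi> + ennreal \<theta> * tnorm q (\<phi>e e) + B * tnorm q (tail t0))"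
    proof (intro mult_left_mono add_mono)
      have "tnorm q (G e 0) \<le> ennreal (C1 * M powr \<sigma>) * tnorm q (\<lambda>t. \<psi> (M * t))"
        unfolding G_def by (simp, intro tnorm_cmult_le q) measurable
      also have "\<dots> \<le> ennreal (C1 * M powr \<sigma>) * tnorm q \<psi>"
        by (intro mult_left_mono tnorm_scale_le C1) auto
      finally show "tnorm q (G e 0) \<le> ennreal (C1 * M powr \<sigma>) * tnorm q \<psi>" .
      have "tnorm q (G e 1) \<le> ennreal \<theta> * tnorm q (\<lambda>t. \<phi>e e (real N * t))"
        unfolding G_def by (simp, intro tnorm_cmult_le q) measurable
      also have "\<dots> \<le> ennreal \<theta> * tnorm q (\<phi>e e)"
        by (intro mult_left_mono tnorm_scale_le N0) auto
      finally show "tnorm q (G e 1) \<le> ennreal \<theta> * tnorm q (\<phi>e e)" .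
      show "tnorm q (G e 2) \<le> B * tnorm q (tail t0)"
        unfolding G_def by (simp, intro tnorm_cmult_le q) measurable
    qed simp
    also have "\<dots> = ennreal K * T + ennreal (K * \<theta>) * tnorm q (\<phi>e e)"
      using K \<theta> by (simp add: T_def distrib_left ennreal_mult mult.assoc add_ac)
    also have "\<dots> \<le> ennreal K * T + ennreal (1/2) * tnorm q (\<phi>e e)"
      using small by (intro add_left_mono mult_right_mono ennreal_leI) (auto simp: \<theta>_def)
    finally have le: "tnorm q (\<phi>e e) \<le> ennreal K * T + ennreal (1/2) * tnorm q (\<phi>e e)" .
    \<comment> \<open>For t >= e the function is at most B t^(-\<sigma>), whose norm over [e,
      infinity) is finite. Without this, x <= y + x / 2 would say nothing.\<close>
    have fine: "tnorm q (\<phi>e e) < top"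
    proof -
      have "tnorm q (\<phi>e e) \<le> tnorm q (\<lambda>t. B * tail e t)"
        using \<phi>B by (intro tnorm_mono) (auto simp: \<phi>e_def tail_def indicator_def mult.commute)
      also have "\<dots> \<le> B * tnorm q (tail e)" by (intro tnorm_cmult_le q) measurable
      also have "\<dots> < top" using B tnorm_tail_finite[OF q \<sigma>(1) e] by (simp add: tail_def ennreal_mult_less_top)
      finally show ?thesis .
    qed
    have "tnorm q (\<phi>e e) \<le> 2 * (ennreal K * T)"
    proof (cases "ennreal K * T = top")
      case True
      then show ?thesis by (simp add: ennreal_mult_top)
    next
      case False
      then obtain x y where xy: "tnorm q (\<phi>e e) = ennreal x" "ennreal K * T = ennreal y" "x \<ge> 0" "y \<ge> 0"
        using fine by (metis ennreal_cases less_irrefl)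
      have "ennreal x \<le> ennreal (y + 1/2 * x)"
      proof -
        have "ennreal (1/2) * ennreal x = ennreal (1/2 * x)" using xy by (intro ennreal_mult[symmetric]) auto
        then show ?thesis using le xy by (simp only: ennreal_plus)
      qed
      then have "x \<le> y + 1/2 * x" using xy by (subst (asm) ennreal_le_iff) auto
      then have "x \<le> 2 * y" by simp
      then have "ennreal x \<le> ennreal (2 * y)" by (rule ennreal_leI)
      then show ?thesis using xy by (simp add: ennreal_mult)
    qed
    then show "tnorm q (\<lambda>t. \<phi> t * indicator {e..} t) \<le> 2 * (ennreal K * T)"
      by (simp add: \<phi>e_def)
  qed measurable
  also have "\<dots> < top"
  proof -
    have "tnorm q \<psi> < top" using hyp by (simp add: \<psi>_def)
    moreover have "tnorm q (tail t0) < top" using tnorm_tail_finite[OF q \<sigma>(1) C1(3)] by (simp add: tail_def)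
    ultimately show ?thesis using B by (simp add: T_def ennreal_mult_less_top)
  qed
  finally show ?thesis by (simp add: \<phi>_def)
qed

text \<open>The step from order n + 1 to n needs \<sigma> < n, which \<sigma> < j guarantees for
  every n >= j.\<close>

lemma Marchaud:
  fixes U :: "'a::euclidean_space set"
  assumes U: "open U" and atlas: "interior_cone_atlas F c \<rho> U" and P: "P > 0" and q: "q > 0"
    and \<sigma>: "0 < \<sigma>" "\<sigma> < real j" and jm: "j \<le> m"
    and u: "u \<in> borel_measurable (lebesgue_on U)" and fin: "Lp_norm P U u < \<infinity>"
    and hyp: "tnorm q (wmodulus \<sigma> m P U u) < \<infinity>"
  shows "tnorm q (wmodulus \<sigma> j P U u) < \<infinity>"
  using jm hyp
proof (induction m rule: dec_induct)
  case (step n)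
  have "\<sigma> < real n" using \<sigma>(2) step.hyps(1) by linarith
  then have "tnorm q (wmodulus \<sigma> n P U u) < \<infinity>"
    by (rule Marchaud_step[OF U atlas P q \<sigma>(1) _ u fin step.prems])
  then show ?case by (rule step.IH)
qed

section \<open>Interior cones: behaviour under dilations and existence in Lipschitz domains\<close>

lemma interior_cone_atlas_scale:
  fixes U :: "'a::euclidean_space set"
  assumes "interior_cone_atlas F c \<rho> U" and r: "r > 0"
  shows "interior_cone_atlas ((\<lambda>(B, e). ((*\<^sub>R) r ` B, e)) ` F) c (r * \<rho>) ((*\<^sub>R) r ` U)"
proof -
  note F = interior_cone_atlasD(1-4)[OF assms(1)] and ch = interior_cone_atlasD(5)[OF assms(1)]
    and cone = interior_cone_atlasD(6)[OF assms(1)]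
  show ?thesis
    unfolding interior_cone_atlas_def
  proof (intro conjI ballI)
    show "(*\<^sub>R) r ` U \<subseteq> \<Union> (fst ` (\<lambda>(B, e). ((*\<^sub>R) r ` B, e)) ` F)"
    proof
      fix x assume "x \<in> (*\<^sub>R) r ` U"
      then obtain y where y: "y \<in> U" "x = r *\<^sub>R y" by blast
      then obtain b where b: "b \<in> F" "y \<in> fst b" using F(4) by blast
      have "(*\<^sub>R) r ` fst b = fst (case b of (B, e) \<Rightarrow> ((*\<^sub>R) r ` B, e))" by (simp split: prod.split)
      then have "(*\<^sub>R) r ` fst b \<in> fst ` (\<lambda>(B, e). ((*\<^sub>R) r ` B, e)) ` F" using b(1) by blast
      moreover have "x \<in> (*\<^sub>R) r ` fst b" using y b by blast
      ultimately show "x \<in> \<Union> (fst ` (\<lambda>(B, e). ((*\<^sub>R) r ` B, e)) ` F)" by (rule UnionI)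
    qed
    fix b assume "b \<in> (\<lambda>(B, e). ((*\<^sub>R) r ` B, e)) ` F"
    then obtain B e where b: "b = ((*\<^sub>R) r ` B, e)" and Be: "(B, e) \<in> F" by auto
    have in_image: "ball (r *\<^sub>R y + \<tau> *\<^sub>R e) (c * \<tau>) \<subseteq> (*\<^sub>R) r ` U"
      if x: "x \<in> B" "x \<in> U" and y: "y \<in> U" "dist (r *\<^sub>R x) (r *\<^sub>R y) < r * \<rho>" and t: "0 < \<tau>" "\<tau> \<le> r * \<rho>" for x y \<tau>
    proof
      fix z assume z: "z \<in> ball (r *\<^sub>R y + \<tau> *\<^sub>R e) (c * \<tau>)"
      have "dist x y < \<rho>" using y r by (simp add: dist_norm scaleR_diff_right[symmetric])
      then have sub: "ball (y + (\<tau> / r) *\<^sub>R e) (c * (\<tau> / r)) \<subseteq> U"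
        using t r by (intro cone[OF Be x y(1)]) (auto simp: field_simps)
      have "r *\<^sub>R y + \<tau> *\<^sub>R e - z = r *\<^sub>R (y + (\<tau> / r) *\<^sub>R e - (1 / r) *\<^sub>R z)"
        using r by (simp add: algebra_simps)
      then have "norm (r *\<^sub>R y + \<tau> *\<^sub>R e - z) = r * norm (y + (\<tau> / r) *\<^sub>R e - (1 / r) *\<^sub>R z)"
        using r by simp
      then have "norm (y + (\<tau> / r) *\<^sub>R e - (1 / r) *\<^sub>R z) < c * (\<tau> / r)"
        using z r by (simp add: dist_norm field_simps)
      then have "(1 / r) *\<^sub>R z \<in> U" using sub by (auto simp: dist_norm)
      then show "z \<in> (*\<^sub>R) r ` U" using r by (intro image_eqI[of _ _ "(1 / r) *\<^sub>R z"]) auto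
    qed
    show "case b of (B, e) \<Rightarrow> open B \<and> norm e = 1 \<and>
      (\<forall>x\<in>B \<inter> (*\<^sub>R) r ` U. \<forall>y\<in>(*\<^sub>R) r ` U \<inter> ball x (r * \<rho>). \<forall>\<tau>\<in>{0<..r * \<rho>}. ball (y + \<tau> *\<^sub>R e) (c * \<tau>) \<subseteq> (*\<^sub>R) r ` U)"
      unfolding b prod.case
    proof (intro conjI ballI)
      show "open ((*\<^sub>R) r ` B)" "norm e = 1" using ch[OF Be] r open_scaling[of r B] by auto
      fix x y \<tau> assume *: "x \<in> (*\<^sub>R) r ` B \<inter> (*\<^sub>R) r ` U" "y \<in> (*\<^sub>R) r ` U \<inter> ball x (r * \<rho>)" "\<tau> \<in> {0<..r * \<rho>}"
      then obtain x' y' where xy: "x = r *\<^sub>R x'" "y = r *\<^sub>R y'" "x' \<in> B" "x' \<in> U" "y' \<in> U"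
        using r by auto
      then show "ball (y + \<tau> *\<^sub>R e) (c * \<tau>) \<subseteq> (*\<^sub>R) r ` U"
        using in_image[of x' y' \<tau>] * by simp
    qed
  qed (use F r in auto)
qed

lemma bounded_lipschitz_domain_imp_atlas:
  fixes U :: "'a::euclidean_space set"
  assumes "bounded_lipschitz_domain U"
  shows "\<exists>F c \<rho>. interior_cone_atlas F c \<rho> U"
proof -
  have o: "open U" and bd: "bounded U"
    and lip: "\<And>z. z \<in> frontier U \<Longrightarrow> \<exists>e \<rho> L. \<exists>\<phi> :: 'a \<Rightarrow> real.
        norm e = 1 \<and> \<rho> > 0 \<and> L-lipschitz_on {y. y \<bullet> e = 0} \<phi> \<and>
        U \<inter> ball z \<rho> = {x \<in> ball z \<rho>. \<phi> (x - (x \<bullet> e) *\<^sub>R e) < x \<bullet> e}"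
    using assms unfolding bounded_lipschitz_domain_def by blast+
  \<comment> \<open>Cones are provided in the ball of radius 2 r, while the covering will use balls
    of radius r. A point y within \<rho> <= r of some x in the smaller ball then still lies in the
    larger one.\<close>
  have loc: "\<exists>e r c. norm e = 1 \<and> r > 0 \<and> c > 0 \<and> (\<forall>y\<in>U \<inter> ball z (2 * r). \<forall>\<tau>\<in>{0<..r}. ball (y + \<tau> *\<^sub>R e) (c * \<tau>) \<subseteq> U)"
    if z: "z \<in> closure U" for z
  proof (cases "z \<in> U")
    case True
    then obtain \<rho> where \<rho>: "\<rho> > 0" "ball z \<rho> \<subseteq> U" using o open_contains_ball by blast
    obtain e :: 'a where "e \<in> Basis" using nonempty_Basis by blast
    then have e: "norm e = 1" by simp
    have "ball (y + \<tau> *\<^sub>R e) (1 * \<tau>) \<subseteq> U" if y: "y \<in> ball z (2 * (\<rho> / 4))" and t: "\<tau> \<in> {0<..\<rho> / 4}" for y \<tau>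
    proof
      fix w assume w: "w \<in> ball (y + \<tau> *\<^sub>R e) (1 * \<tau>)"
      have "dist z w \<le> dist z y + dist y (y + \<tau> *\<^sub>R e) + dist (y + \<tau> *\<^sub>R e) w"
        using dist_triangle[of z w y] dist_triangle[of y w "y + \<tau> *\<^sub>R e"] by linarith
      also have "\<dots> < \<rho>" using y t w e by (simp add: dist_norm)
      finally show "w \<in> U" using \<rho> by auto
    qed
    then show ?thesis using e \<rho> by (intro exI[of _ e] exI[of _ "\<rho> / 4"] exI[of _ 1]) auto
  next
    case False
    then have "z \<in> frontier U" using z o by (simp add: frontier_def interior_open)
    from lip[OF this] obtain e \<rho> L and \<phi> :: "'a \<Rightarrow> real" where e: "norm e = 1" and \<rho>: "\<rho> > 0"
      and L: "L-lipschitz_on {y. y \<bullet> e = 0} \<phi>"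
      and eq: "U \<inter> ball z \<rho> = {x \<in> ball z \<rho>. \<phi> (x - (x \<bullet> e) *\<^sub>R e) < x \<bullet> e}" by blast
    have L0: "L \<ge> 0" using L by (rule lipschitz_on_nonneg)
    \<comment> \<open>Moving by \<tau> along e raises the height by \<tau>, while a perturbation w
      changes the height by at most |w| and the graph by at most L |w|. The point stays above the
      graph as long as (1 + L) |w| <= \<tau>.\<close>
    define c where "c = 1 / (1 + L)"
    have c: "c > 0" "c \<le> 1" "c * (1 + L) = 1" using L0 by (auto simp: c_def)
    have "ball (y + \<tau> *\<^sub>R e) (c * \<tau>) \<subseteq> U" if y: "y \<in> U" "y \<in> ball z (2 * (\<rho> / 4))" and t: "\<tau> \<in> {0<..\<rho> / 4}" for y \<tau>
    proof
      fix v assume v: "v \<in> ball (y + \<tau> *\<^sub>R e) (c * \<tau>)"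
      define w where "w = v - (y + \<tau> *\<^sub>R e)"
      have nw: "norm w < c * \<tau>" using v by (simp add: w_def dist_norm norm_minus_commute)
      have v_eq: "v = y + \<tau> *\<^sub>R e + w" by (simp add: w_def)
      have ee: "e \<bullet> e = 1" using e by (simp add: norm_eq_1)
      have "c * \<tau> \<le> \<tau>" using c t by simp
      have vz: "v \<in> ball z \<rho>"
      proof -
        have "dist z v \<le> dist z y + dist y v" by (rule dist_triangle)
        also have "dist y v \<le> norm (\<tau> *\<^sub>R e) + norm w"
          unfolding v_eq dist_commute[of y] using norm_triangle_ineq[of "\<tau> *\<^sub>R e" w] by (simp add: dist_norm add.assoc)
        finally have "dist z v \<le> dist z y + (norm (\<tau> *\<^sub>R e) + norm w)" by simp
        moreover have "norm (\<tau> *\<^sub>R e) = \<tau>" using e t by simp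
        moreover have "norm w < \<tau>" using nw \<open>c * \<tau> \<le> \<tau>\<close> by (rule less_le_trans)
        ultimately show ?thesis using y t by (simp add: dist_norm)
      qed
      define pr where "pr = (\<lambda>x::'a. x - (x \<bullet> e) *\<^sub>R e)"
      have pr_mem: "pr x \<in> {y. y \<bullet> e = 0}" for x by (simp add: pr_def inner_diff_left ee)
      have pr_diff: "pr v - pr y = pr w"
        unfolding v_eq by (simp add: pr_def inner_add_left ee algebra_simps)
      have "norm (pr w) \<le> norm w"
      proof -
        have "(norm (pr w))\<^sup>2 = (norm w)\<^sup>2 - (w \<bullet> e)\<^sup>2"
          unfolding pr_def power2_norm_eq_inner
          by (simp add: inner_diff_left inner_diff_right ee inner_commute[of e w] power2_eq_square)
        then have "(norm (pr w))\<^sup>2 \<le> (norm w)\<^sup>2" by simp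
        then show ?thesis by (rule power2_le_imp_le) simp
      qed
      then have "\<bar>\<phi> (pr v) - \<phi> (pr y)\<bar> \<le> L * norm w"
        using lipschitz_onD[OF L pr_mem pr_mem, of v y] L0 pr_diff
          mult_left_mono[of "norm (pr w)" "norm w" L] by (simp add: dist_norm)
      moreover have "\<phi> (pr y) < y \<bullet> e"
      proof -
        have "y \<in> U \<inter> ball z \<rho>" using y \<rho> by auto
        then show ?thesis unfolding eq pr_def by simp
      qed
      moreover have "v \<bullet> e = y \<bullet> e + \<tau> + w \<bullet> e" by (simp add: v_eq inner_add_left ee)
      moreover have "\<bar>w \<bullet> e\<bar> \<le> norm w" using Cauchy_Schwarz_ineq2[of w e] e by simp
      moreover have "(1 + L) * norm w \<le> \<tau>"
      proof -
        have "(1 + L) * norm w \<le> (1 + L) * (c * \<tau>)" using nw L0 by (intro mult_left_mono) auto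
        also have "\<dots> = c * (1 + L) * \<tau>" by (simp only: ac_simps)
        also have "\<dots> = \<tau>" using c(3) by simp
        finally show ?thesis .
      qed
      ultimately have "\<phi> (pr v) < v \<bullet> e" by (simp add: distrib_right abs_le_iff)
      then have "v \<in> U \<inter> ball z \<rho>" unfolding eq using vz by (simp add: pr_def)
      then show "v \<in> U" by simp
    qed
    then show ?thesis using e \<rho> c by (intro exI[of _ e] exI[of _ "\<rho> / 4"] exI[of _ c]) auto
  qed
  then obtain e r c where E: "\<And>z. z \<in> closure U \<Longrightarrow> norm (e z) = 1 \<and> r z > 0 \<and> c z > 0 \<and>
     (\<forall>y\<in>U \<inter> ball z (2 * r z). \<forall>\<tau>\<in>{0<..r z}. ball (y + \<tau> *\<^sub>R e z) (c z * \<tau>) \<subseteq> U)"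
    by metis
  have "compact (closure U)" using bd by simp
  moreover have "\<And>z. z \<in> closure U \<Longrightarrow> open (ball z (r z))" by simp
  moreover have "closure U \<subseteq> (\<Union>z\<in>closure U. ball z (r z))" using E by force
  ultimately obtain Z where Z: "Z \<subseteq> closure U" "finite Z" "closure U \<subseteq> (\<Union>z\<in>Z. ball z (r z))"
    by (rule compactE_image) (assumption | blast)+
  define \<rho> where "\<rho> = Min (insert 1 (r ` Z))"
  define c' where "c' = Min (insert 1 (c ` Z))"
  have \<rho>: "\<rho> > 0" "\<And>z. z \<in> Z \<Longrightarrow> \<rho> \<le> r z"
    unfolding \<rho>_def using Z E by (auto simp: subset_iff)
  have c': "c' > 0" "\<And>z. z \<in> Z \<Longrightarrow> c' \<le> c z"
    unfolding c'_def using Z E by (auto simp: subset_iff)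
  have "interior_cone_atlas ((\<lambda>z. (ball z (r z), e z)) ` Z) c' \<rho> U"
    unfolding interior_cone_atlas_def
  proof (intro conjI ballI)
    show "U \<subseteq> \<Union> (fst ` (\<lambda>z. (ball z (r z), e z)) ` Z)"
      using Z(3) closure_subset[of U] by (simp add: image_image)
    fix b assume "b \<in> (\<lambda>z. (ball z (r z), e z)) ` Z"
    then obtain z where b: "b = (ball z (r z), e z)" and z: "z \<in> Z" by auto
    have zc: "z \<in> closure U" using z Z by auto
    have in_dom: "ball (y + \<tau> *\<^sub>R e z) (c' * \<tau>) \<subseteq> U" if "dist z x < r z" "y \<in> U" "dist x y < \<rho>" "0 < \<tau>" "\<tau> \<le> \<rho>" for x y \<tau>
    proof -
      have "y \<in> ball z (2 * r z)" using that dist_triangle[of z y x] \<rho>(2)[OF z] by simp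
      then have "ball (y + \<tau> *\<^sub>R e z) (c z * \<tau>) \<subseteq> U" using E[OF zc] that \<rho>(2)[OF z] by auto
      moreover have "c' * \<tau> \<le> c z * \<tau>" using c'(2)[OF z] that by simp
      ultimately show ?thesis using subset_ball by blast
    qed
    show "case b of (B, e) \<Rightarrow> open B \<and> norm e = 1 \<and>
      (\<forall>x\<in>B \<inter> U. \<forall>y\<in>U \<inter> ball x \<rho>. \<forall>\<tau>\<in>{0<..\<rho>}. ball (y + \<tau> *\<^sub>R e) (c' * \<tau>) \<subseteq> U)"
      unfolding b prod.case
    proof (intro conjI ballI)
      fix x y \<tau> assume "x \<in> ball z (r z) \<inter> U" "y \<in> U \<inter> ball x \<rho>" "\<tau> \<in> {0<..\<rho>}"
      then show "ball (y + \<tau> *\<^sub>R e z) (c' * \<tau>) \<subseteq> U" by (intro in_dom[of x]) auto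
    qed (use E[OF zc] in auto)
  qed (use Z \<rho> c' in auto)
  then show ?thesis by blast
qed

section \<open>Boundedness\<close>

text \<open>Fubini's theorem will be applied to the pairs (h, x) with x + i h in a set D, which form
  a measurable subset of the product when D is Borel. So Lebesgue sets are first enlarged without
  gaining measure.\<close>

lemma lebesgue_set_borel_superset:
  fixes E :: "'a::euclidean_space set"
  assumes "E \<in> sets lebesgue"
  obtains E' where "E' \<in> sets borel" "E \<subseteq> E'" "emeasure lborel E' = emeasure lebesgue E"
proof -
  from assms obtain S N N' where *: "E = S \<union> N" "N \<subseteq> N'" "N' \<in> null_sets lborel" "S \<in> sets lborel"
    by (rule sets_completionE)
  have "emeasure lborel (S \<union> N') = emeasure lborel S"
    using * by (intro emeasure_Un_null_set) auto
  moreover have "emeasure lborel S \<le> emeasure lebesgue E"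
  proof -
    have "emeasure lborel S = emeasure lebesgue S" using * by simp
    also have "\<dots> \<le> emeasure lebesgue E" using * assms by (intro emeasure_mono) auto
    finally show ?thesis .
  qed
  moreover have "emeasure lebesgue E \<le> emeasure lborel (S \<union> N')"
  proof -
    have "emeasure lebesgue E \<le> emeasure lebesgue (S \<union> N')"
      using * by (intro emeasure_mono) auto
    also have "\<dots> = emeasure lborel (S \<union> N')"
      using sets.Un[OF *(4) null_setsD2[OF *(3)]]
      by (simp only: emeasure_completion[OF sets_completionI_sets] main_part)
    finally show ?thesis .
  qed
  ultimately show ?thesis using * by (intro that[of "S \<union> N'"]) auto
qed

text \<open>After interchanging the integrals, for fixed x the vectors h with x + i h in D form a
  copy of D shrunk by the factor i, of measure at most that of D.\<close>

lemma nn_integral_measure_translates_le: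
  fixes E D :: "'a::euclidean_space set"
  assumes [measurable]: "E \<in> sets borel" "D \<in> sets borel" and i: "i \<ge> 1"
  shows "(\<integral>\<^sup>+h. emeasure lborel {x \<in> E. x + real i *\<^sub>R h \<in> D} \<partial>lborel) \<le> emeasure lborel E * emeasure lborel D"
proof -
  define f where "f = (\<lambda>(h, x). indicator E x * (indicator D (x + real i *\<^sub>R h) :: ennreal))"
  have f[measurable]: "f \<in> borel_measurable (lborel \<Otimes>\<^sub>M lborel)"
    unfolding f_def by measurable
  have "(\<integral>\<^sup>+h. emeasure lborel {x \<in> E. x + real i *\<^sub>R h \<in> D} \<partial>lborel) = (\<integral>\<^sup>+h. \<integral>\<^sup>+x. f (h, x) \<partial>lborel \<partial>lborel)"
  proof (intro nn_integral_cong)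
    fix h :: 'a
    have "{x \<in> E. x + real i *\<^sub>R h \<in> D} = E \<inter> (\<lambda>x. x + real i *\<^sub>R h) -` D" by auto
    moreover have "\<dots> \<in> sets borel" by measurable
    ultimately have m: "{x \<in> E. x + real i *\<^sub>R h \<in> D} \<in> sets lborel" by simp
    have "(\<integral>\<^sup>+x. f (h, x) \<partial>lborel) = (\<integral>\<^sup>+x. indicator {x \<in> E. x + real i *\<^sub>R h \<in> D} x \<partial>lborel)"
      by (intro nn_integral_cong) (auto simp: f_def indicator_def)
    then show "emeasure lborel {x \<in> E. x + real i *\<^sub>R h \<in> D} = (\<integral>\<^sup>+x. f (h, x) \<partial>lborel)"
      using m by simp
  qed
  also have "\<dots> = (\<integral>\<^sup>+x. \<integral>\<^sup>+h. f (h, x) \<partial>lborel \<partial>lborel)"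
    by (rule lborel_pair.Fubini'[symmetric]) (use f in \<open>simp add: f_def\<close>)
  also have "\<dots> \<le> (\<integral>\<^sup>+x. indicator E x * emeasure lborel D \<partial>lborel)"
  proof (intro nn_integral_mono)
    fix x :: 'a
    have "emeasure lborel D = (\<integral>\<^sup>+h. indicator D h \<partial>lborel)" by simp
    also have "\<dots> = (\<integral>\<^sup>+h. indicator D h \<partial>density (distr lborel borel (\<lambda>h. x + real i *\<^sub>R h)) (\<lambda>_. \<bar>real i\<bar> ^ DIM('a)))"
      using i by (subst lborel_affine[of "real i" x]) auto
    also have "\<dots> = (\<integral>\<^sup>+h. ennreal (real i ^ DIM('a)) * indicator D (x + real i *\<^sub>R h) \<partial>lborel)"
      by (subst nn_integral_density; (subst nn_integral_distr)?) auto
    also have "\<dots> \<ge> (\<integral>\<^sup>+h. indicator D (x + real i *\<^sub>R h) \<partial>lborel)"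
    proof (intro nn_integral_mono)
      fix h
      have "1 \<le> ennreal (real i ^ DIM('a))" using i by (simp flip: ennreal_1)
      from mult_right_mono[OF this] show "indicator D (x + real i *\<^sub>R h) \<le> ennreal (real i ^ DIM('a)) * indicator D (x + real i *\<^sub>R h)"
        by fastforce
    qed
    finally have "(\<integral>\<^sup>+h. indicator D (x + real i *\<^sub>R h) \<partial>lborel) \<le> emeasure lborel D" .
    then show "(\<integral>\<^sup>+h. f (h, x) \<partial>lborel) \<le> indicator E x * emeasure lborel D"
      by (auto simp: f_def indicator_def)
  qed
  also have "\<dots> = emeasure lborel E * emeasure lborel D"
    by (simp add: nn_integral_multc)
  finally show ?thesis .
qed

text \<open>An averaging argument: over h in H, the measure of the points of E that some step i h
  carries into D has mean at most k |E| |D| / |H| <= |E| / 4. So some h moves at most half of E into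
  D.\<close>

lemma exists_good_translation:
  fixes E D :: "'a::euclidean_space set"
  assumes E: "E \<in> lmeasurable" "measure lebesgue E > 0" and D: "D \<in> lmeasurable"
    and H: "H \<in> lmeasurable" "H \<in> sets borel" "measure lebesgue H > 0" "4 * real k * measure lebesgue D \<le> measure lebesgue H"
  obtains h B where "h \<in> H" "B \<in> lmeasurable" "measure lebesgue B \<le> measure lebesgue E / 2"
    "\<And>x i. x \<in> E \<Longrightarrow> 1 \<le> i \<Longrightarrow> i \<le> k \<Longrightarrow> x + real i *\<^sub>R h \<in> D \<Longrightarrow> x \<in> B"
proof -
  obtain E' where E': "E' \<in> sets borel" "E \<subseteq> E'" "emeasure lborel E' = emeasure lebesgue E"
    using lebesgue_set_borel_superset E(1) by blast
  obtain D' where D': "D' \<in> sets borel" "D \<subseteq> D'" "emeasure lborel D' = emeasure lebesgue D"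
    using lebesgue_set_borel_superset D by blast
  have eE: "emeasure lborel E' = ennreal (measure lebesgue E)" and eD: "emeasure lborel D' = ennreal (measure lebesgue D)"
    using E D E' D' by (simp_all add: emeasure_eq_measure2)
  have eH: "emeasure lborel H = ennreal (measure lebesgue H)"
  proof -
    have "emeasure lborel H = emeasure lebesgue H" using H(2) by simp
    then show ?thesis using H(1) by (simp only: emeasure_eq_measure2)
  qed
  define F where "F = (\<lambda>i h. emeasure lborel {x \<in> E'. x + real i *\<^sub>R h \<in> D'})"
  define b where "b = measure lebesgue E"
  have "\<exists>h\<in>H. (\<Sum>i=1..k. F i h) \<le> ennreal (b / 2)"
  proof (rule ccontr)
    assume "\<not> ?thesis"
    then have *: "ennreal (b / 2) \<le> (\<Sum>i=1..k. F i h)" if "h \<in> H" for h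
      using that by (auto simp: not_le intro: less_imp_le)
    have Fm[measurable]: "F i \<in> borel_measurable lborel" for i
      using E' D' unfolding F_def by measurable
    have "ennreal (b / 2) * emeasure lborel H = (\<integral>\<^sup>+h. ennreal (b / 2) * indicator H h \<partial>lborel)"
      using H by (simp add: nn_integral_cmult_indicator)
    also have "\<dots> \<le> (\<integral>\<^sup>+h. (\<Sum>i=1..k. F i h) \<partial>lborel)"
      using * by (intro nn_integral_mono) (auto simp: indicator_def)
    also have "\<dots> = (\<Sum>i=1..k. \<integral>\<^sup>+h. F i h \<partial>lborel)"
      by (rule nn_integral_sum) auto
    also have "\<dots> \<le> (\<Sum>i=1..k. emeasure lborel E' * emeasure lborel D')"
      unfolding F_def by (intro sum_mono nn_integral_measure_translates_le E' D') auto
    also have "\<dots> = ennreal (real k * (b * measure lebesgue D))"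
      by (simp add: eE eD ennreal_mult[symmetric] ennreal_of_nat_eq_real_of_nat b_def)
    finally have "b / 2 * measure lebesgue H \<le> real k * (b * measure lebesgue D)"
      unfolding eH by (subst (asm) ennreal_mult[symmetric]; (subst (asm) ennreal_le_iff)?) (auto simp: b_def)
    then have "b * (2 * measure lebesgue H) \<le> b * (4 * real k * measure lebesgue D)" by (simp add: algebra_simps)
    then have "2 * measure lebesgue H \<le> 4 * real k * measure lebesgue D"
      using E(2) by (simp add: b_def)
    then show False using H by linarith
  qed
  then obtain h where h: "h \<in> H" "(\<Sum>i=1..k. F i h) \<le> ennreal (b / 2)" by blast
  define B where "B = (\<Union>i\<in>{1..k}. {x \<in> E'. x + real i *\<^sub>R h \<in> D'})"
  have m: "{x \<in> E'. x + real i *\<^sub>R h \<in> D'} \<in> sets borel" for i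
  proof -
    have "{x \<in> E'. x + real i *\<^sub>R h \<in> D'} = E' \<inter> (\<lambda>x. x + real i *\<^sub>R h) -` D'" by auto
    moreover have "\<dots> \<in> sets borel" using E' D' by measurable
    ultimately show ?thesis by simp
  qed
  have Bs: "B \<in> sets borel" unfolding B_def using m by (intro sets.finite_UN) auto
  have "emeasure lborel B \<le> (\<Sum>i=1..k. F i h)"
    unfolding B_def F_def using m by (intro emeasure_subadditive_finite) auto
  also note h(2)
  finally have eB: "emeasure lebesgue B \<le> ennreal (b / 2)" using Bs by simp
  have Bm: "B \<in> lmeasurable"
    using Bs eB by (intro fmeasurableI) (auto intro: le_less_trans)
  have "measure lebesgue B \<le> measure lebesgue E / 2"
    using eB Bm by (simp add: emeasure_eq_measure2 b_def)
  moreover have "x \<in> B" if "x \<in> E" "1 \<le> i" "i \<le> k" "x + real i *\<^sub>R h \<in> D" for x i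
    using that E' D' by (auto simp: B_def)
  ultimately show ?thesis using that h Bm by blast
qed

section \<open>Decay of the measures of superlevel sets\<close>

definition superlevel :: "'a::euclidean_space set \<Rightarrow> ('a \<Rightarrow> real) \<Rightarrow> real \<Rightarrow> real" where
  "superlevel U u l = measure lebesgue {x \<in> U. \<bar>u x\<bar> > l}"

lemma superlevel_lmeasurable:
  fixes u :: "'a::euclidean_space \<Rightarrow> real"
  assumes "U \<in> lmeasurable" "u \<in> borel_measurable (lebesgue_on U)"
  shows "{x \<in> U. \<bar>u x\<bar> > l} \<in> lmeasurable"
proof -
  have Us: "U \<in> sets lebesgue" using assms by auto
  note assms(2)[measurable]
  have "{x \<in> space (lebesgue_on U). l < \<bar>u x\<bar>} \<in> sets (lebesgue_on U)" by measurable
  then have "{x \<in> U. \<bar>u x\<bar> > l} \<in> sets lebesgue" using Us by (simp add: sets_restrict_space_iff)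
  then show ?thesis using assms by (intro fmeasurableI2[OF assms(1)]) auto
qed

lemma superlevel_antimono:
  assumes "U \<in> lmeasurable" "u \<in> borel_measurable (lebesgue_on U)" "l \<le> l'"
  shows "superlevel U u l' \<le> superlevel U u l"
  unfolding superlevel_def using assms superlevel_lmeasurable[OF assms(1,2)]
  by (intro measure_mono_fmeasurable) auto

lemma superlevel_nonneg: "superlevel U u l \<ge> 0"
  by (simp add: superlevel_def)

text \<open>Chebyshev's inequality; it will be applied to differences of u as well as to u
  itself.\<close>

lemma superlevel_le_Lp_norm:
  assumes U: "U \<in> lmeasurable" and f: "f \<in> borel_measurable (lebesgue_on U)" and p: "p > 0" and \<kappa>: "\<kappa> > 0" and X: "X \<ge> 0"
    and le: "Lp_norm (ennreal p) U f \<le> ennreal X"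
  shows "superlevel U f \<kappa> \<le> (X / \<kappa>) powr p"
proof -
  let ?S = "{x \<in> U. \<bar>f x\<bar> > \<kappa>}"
  have Us: "U \<in> sets lebesgue" using U by auto
  note Sm = superlevel_lmeasurable[OF U f, of \<kappa>]
  then have Ss: "?S \<in> sets lebesgue" by auto
  then have S: "?S \<in> sets (lebesgue_on U)" using Us by (simp add: sets_restrict_space_iff)
  have "ennreal (\<kappa> powr p) * emeasure lebesgue ?S = ennreal (\<kappa> powr p) * emeasure (lebesgue_on U) ?S"
    using Us Ss by (subst emeasure_restrict_space) auto
  also have "\<dots> = (\<integral>\<^sup>+x. ennreal (\<kappa> powr p) * indicator ?S x \<partial>lebesgue_on U)"
    using S by (simp add: nn_integral_cmult_indicator)
  also have "\<dots> \<le> (\<integral>\<^sup>+x. ennreal (\<bar>f x\<bar> powr p) \<partial>lebesgue_on U)"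
    using \<kappa> p by (intro nn_integral_mono) (auto simp: indicator_def intro!: ennreal_leI powr_mono2)
  also have "\<dots> \<le> ennreal_rpow (ennreal X) p"
    using le p by (simp add: Lp_norm_def ennreal_rpow_le_iff[of "1 / p"])
  also have "\<dots> = ennreal (X powr p)" using X by (simp add: ennreal_rpow_ennreal)
  finally have "\<kappa> powr p * measure lebesgue ?S \<le> X powr p"
    using Sm by (simp add: emeasure_eq_measure2 ennreal_mult[symmetric])
  then show ?thesis
    using \<kappa> X by (simp add: superlevel_def powr_divide field_simps)
qed

text \<open>Let E be the part in one chart of the set where |u| > \<kappa> + (2^k - 1) l, let D be
  the set where |u| > l, and H the ball of radius c t around t e. If D is small compared with H,
  some h in H keeps x + h, ..., x + k h outside D for at least half of E. There the k-th difference
  must exceed \<kappa> in absolute value, so Chebyshev's inequality bounds that half, hence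
  E.\<close>

lemma superlevel_recursion:
  fixes U :: "'a::euclidean_space set"
  assumes U: "open U" "U \<in> lmeasurable" and atlas: "interior_cone_atlas F c \<rho> U"
    and u: "u \<in> borel_measurable (lebesgue_on U)"
    and p: "p > 0" and k: "k \<ge> 1" and s: "s > 0" and A: "A \<ge> 0"
    and hyp: "\<And>t. t > 0 \<Longrightarrow> \<omega> k (ennreal p) U u t \<le> ennreal (A * t powr s)"
  shows "\<exists>t0>0. \<exists>a>0. \<exists>C\<ge>0. \<forall>\<kappa>>0. \<forall>l\<ge>0. \<forall>t>0. t \<le> t0 \<longrightarrow> superlevel U u l \<le> a * t ^ DIM('a) \<longrightarrow>
    superlevel U u (\<kappa> + (2 ^ k - 1) * l) \<le> C * (t powr s / \<kappa>) powr p"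
proof -
  note F = interior_cone_atlasD(1-4)[OF atlas] and ch = interior_cone_atlasD(5)[OF atlas]
    and cone = interior_cone_atlasD(6)[OF atlas]
  define V where "V = measure lebesgue (ball (0::'a) 1)"
  have V: "V > 0" unfolding V_def by (simp add: content_ball_pos)
  define t0 where "t0 = \<rho> / real k"
  \<comment> \<open>H has volume (c t)^d V, so this value turns |D| <= a t^d into the condition 4 k
    |D| <= |H| of the averaging argument.\<close>
  define a where "a = c ^ DIM('a) * V / (4 * real k)"
  \<comment> \<open>The factor 2 compensates the discarded half of E, and 1 + c appears because |h|
    <= (1 + c) t for h in H.\<close>
  define C1 where "C1 = 2 * (A * (1 + c) powr s) powr p"
  define C where "C = real (card F) * C1"
  have pos: "t0 > 0" "a > 0" "C1 \<ge> 0" "C \<ge> 0"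
    using F k V by (auto simp: t0_def a_def C_def C1_def)
  have main: "superlevel U u (\<kappa> + (2 ^ k - 1) * l) \<le> C * (t powr s / \<kappa>) powr p"
    if \<kappa>: "\<kappa> > 0" and l: "l \<ge> 0" and t: "t > 0" "t \<le> t0" and small: "superlevel U u l \<le> a * t ^ DIM('a)" for \<kappa> l t
  proof -
    define D where "D = {x \<in> U. \<bar>u x\<bar> > l}"
    define S where "S = {x \<in> U. \<bar>u x\<bar> > \<kappa> + (2 ^ k - 1) * l}"
    have Dm: "D \<in> lmeasurable" and Sm: "S \<in> lmeasurable"
      unfolding D_def S_def by (rule superlevel_lmeasurable[OF U(2) u])+
    have chart: "measure lebesgue (S \<inter> fst b) \<le> C1 * (t powr s / \<kappa>) powr p" if "b \<in> F" for b
    proof -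
      obtain B e where b: "b = (B, e)" by (cases b)
      then have Be: "(B, e) \<in> F" using \<open>b \<in> F\<close> by simp
      have e1: "norm e = 1" and oB: "open B" using ch[OF Be] by auto
      define E where "E = S \<inter> B"
      have Em: "E \<in> lmeasurable" unfolding E_def using Sm oB
        by (intro fmeasurable_Int_fmeasurable) (auto simp: borel_open)
      have "measure lebesgue E \<le> C1 * (t powr s / \<kappa>) powr p"
      proof (cases "measure lebesgue E > 0")
        case True
        define H where "H = ball (t *\<^sub>R e) (c * t)"
        have ct: "c * t > 0" using F t by simp
        have mH: "measure lebesgue H = (c * t) ^ DIM('a) * V"
          unfolding H_def V_def using ct content_ball_conv_unit_ball[of "c * t" "t *\<^sub>R e"] by simp
        have Hm: "H \<in> lmeasurable" "H \<in> sets borel" by (simp_all add: H_def)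
        have Hpos: "measure lebesgue H > 0" unfolding mH using ct V by simp
        have "4 * real k * measure lebesgue D \<le> 4 * real k * (a * t ^ DIM('a))"
          using small by (intro mult_left_mono) (auto simp: superlevel_def D_def)
        also have "\<dots> = measure lebesgue H" using k by (simp add: mH a_def power_mult_distrib)
        finally have Hbig: "4 * real k * measure lebesgue D \<le> measure lebesgue H" .
        obtain h Bad where h: "h \<in> H" and Bad: "Bad \<in> lmeasurable" "measure lebesgue Bad \<le> measure lebesgue E / 2"
          "\<And>x i. x \<in> E \<Longrightarrow> 1 \<le> i \<Longrightarrow> i \<le> k \<Longrightarrow> x + real i *\<^sub>R h \<in> D \<Longrightarrow> x \<in> Bad"
          using exists_good_translation[OF Em True Dm Hm Hpos Hbig] by blast
        have hn: "norm (h - t *\<^sub>R e) < c * t" using h by (simp add: H_def dist_norm norm_minus_commute)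
        have "norm h \<le> norm (t *\<^sub>R e) + norm (h - t *\<^sub>R e)" using norm_triangle_ineq[of "t *\<^sub>R e" "h - t *\<^sub>R e"] by simp
        then have nh: "norm h \<le> (1 + c) * t" using hn e1 t by (simp add: distrib_right)
        have seg: "x \<in> seg_dom U k h" if x: "x \<in> E" for x
        proof -
          have xU: "x \<in> U" "x \<in> B" using x by (auto simp: E_def S_def)
          have "x + \<tau> *\<^sub>R h \<in> U" if \<tau>: "\<tau> \<in> {0..real k}" for \<tau>
          proof (cases "\<tau> = 0")
            case False
            have "\<tau> * t \<le> real k * t0" using \<tau> t by (intro mult_mono) auto
            then have le: "0 < \<tau> * t" "\<tau> * t \<le> \<rho>" using False \<tau> t k by (auto simp: t0_def)
            have "norm (x + (\<tau> * t) *\<^sub>R e - (x + \<tau> *\<^sub>R h)) = norm (\<tau> *\<^sub>R (t *\<^sub>R e - h))"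
              by (simp add: algebra_simps)
            also have "\<dots> = \<tau> * norm (h - t *\<^sub>R e)" using \<tau> by (simp add: norm_minus_commute)
            also have "\<dots> < \<tau> * (c * t)" using hn \<tau> False by (intro mult_strict_left_mono) auto
            finally have "x + \<tau> *\<^sub>R h \<in> ball (x + (\<tau> * t) *\<^sub>R e) (c * (\<tau> * t))"
              by (simp add: dist_norm mult.left_commute)
            moreover have "dist x x < \<rho>" using F(3) by simp
            ultimately show ?thesis using cone[OF Be xU(2,1) xU(1) _ le] by blast
          qed (use xU in auto)
          then show ?thesis by (simp add: seg_dom_def)
        qed
        define T where "T = {x \<in> U. \<bar>diff_op U k h u x\<bar> > \<kappa>}"
        have sub: "E - Bad \<subseteq> T"
        proof
          fix x assume x: "x \<in> E - Bad"
          have "\<bar>u (x + real i *\<^sub>R h)\<bar> \<le> l" if i: "i \<in> {1..k}" for i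
          proof -
            have "x + real i *\<^sub>R h \<in> U" using seg_dom_point seg x i by fastforce
            moreover have "x + real i *\<^sub>R h \<notin> D" using Bad(3)[of x i] x i by auto
            ultimately show ?thesis by (simp add: D_def)
          qed
          then have "(\<Sum>i=1..k. real (k choose i) * \<bar>u (x + real i *\<^sub>R h)\<bar>) \<le> (\<Sum>i=1..k. real (k choose i) * l)"
            by (intro sum_mono mult_left_mono) auto
          also have "\<dots> = (2 ^ k - 1) * l"
            by (simp only: sum_distrib_right[symmetric] sum_choose_pos)
          finally have "\<bar>u x\<bar> \<le> \<bar>fdiff k h u x\<bar> + (2 ^ k - 1) * l"
            using abs_le_fdiff_plus_shifts[of u x k h] by linarith
          moreover have "\<bar>u x\<bar> > \<kappa> + (2 ^ k - 1) * l" "x \<in> U" using x by (auto simp: E_def S_def)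
          ultimately show "x \<in> T" using seg[of x] x by (simp add: T_def diff_op_eq)
        qed
        have "Lp_norm (ennreal p) U (diff_op U k h u) \<le> ennreal (A * ((1 + c) * t) powr s)"
          using Lp_norm_diff_op_le_modulus[OF nh] hyp[of "(1 + c) * t"] F(2) t by (meson add_pos_pos mult_pos_pos order.trans zero_less_one)
        then have T: "measure lebesgue T \<le> (A * ((1 + c) * t) powr s / \<kappa>) powr p"
          using A superlevel_le_Lp_norm[OF U(2) measurable_diff_op_lebesgue_on[OF U(1) u] p \<kappa>]
          by (simp add: superlevel_def T_def)
        have Tm: "T \<in> lmeasurable"
          unfolding T_def by (intro superlevel_lmeasurable measurable_diff_op_lebesgue_on U u)
        have "measure lebesgue E \<le> measure lebesgue (T \<union> Bad)"
          using sub Em Tm Bad(1) by (intro measure_mono_fmeasurable fmeasurable.Un) auto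
        also have "\<dots> \<le> measure lebesgue T + measure lebesgue Bad"
          using Tm Bad(1) by (intro measure_Un_le) auto
        finally have "measure lebesgue E \<le> 2 * measure lebesgue T" using Bad(2) by linarith
        also have "\<dots> \<le> 2 * (A * ((1 + c) * t) powr s / \<kappa>) powr p"
          using T by simp
        also have "A * ((1 + c) * t) powr s / \<kappa> = (A * (1 + c) powr s) * (t powr s / \<kappa>)"
          using F(2) t by (simp add: powr_mult)
        also have "2 * \<dots> powr p = C1 * (t powr s / \<kappa>) powr p"
          using A \<kappa> powr_mult[of "A * (1 + c) powr s" "t powr s / \<kappa>" p] by (simp add: C1_def)
        finally show ?thesis .
      next
        case False
        then have "measure lebesgue E \<le> 0" by simp
        also have "0 \<le> C1 * (t powr s / \<kappa>) powr p" using pos by simp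
        finally show ?thesis .
      qed
      then show ?thesis by (simp add: E_def b)
    qed
    have "S = (\<Union>b\<in>F. S \<inter> fst b)" using F(4) by (auto simp: S_def)
    moreover have "S \<inter> fst b \<in> sets lebesgue" if "b \<in> F" for b
      using that ch Sm by (cases b) (auto simp: borel_open)
    ultimately have "measure lebesgue S \<le> (\<Sum>b\<in>F. measure lebesgue (S \<inter> fst b))"
      using measure_UNION_le[OF F(1), of "\<lambda>b. S \<inter> fst b" lebesgue] by metis
    also have "\<dots> \<le> (\<Sum>b\<in>F. C1 * (t powr s / \<kappa>) powr p)" by (intro sum_mono chart)
    also have "\<dots> = C * (t powr s / \<kappa>) powr p" by (simp add: C_def)
    finally show ?thesis by (simp add: superlevel_def S_def)
  qed
  then show ?thesis using pos by blast
qed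

lemma superlevel_tendsto_0:
  assumes "U \<in> lmeasurable" "u \<in> borel_measurable (lebesgue_on U)"
  shows "(\<lambda>n. superlevel U u (real n)) \<longlonglongrightarrow> 0"
proof -
  define S where "S = (\<lambda>n::nat. {x \<in> U. \<bar>u x\<bar> > real n})"
  have S: "S n \<in> lmeasurable" for n unfolding S_def by (rule superlevel_lmeasurable[OF assms])
  have "(\<lambda>n. measure lebesgue (S n)) \<longlonglongrightarrow> measure lebesgue (\<Inter>n. S n)"
  proof (rule Lim_measure_decseq)
    show "range S \<subseteq> sets lebesgue" using S by blast
    show "decseq S" by (rule antimonoI) (auto simp: S_def)
    show "emeasure lebesgue (S n) \<noteq> \<infinity>" for n using fmeasurableD2[OF S[of n]] by simp
  qed
  moreover have "(\<Inter>n. S n) = {}"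
  proof -
    have "\<exists>n. x \<notin> S n" for x
    proof -
      obtain n :: nat where "\<bar>u x\<bar> < real n" using reals_Archimedean2 by blast
      then have "x \<notin> S n" by (simp add: S_def)
      then show ?thesis ..
    qed
    then show ?thesis by blast
  qed
  ultimately show ?thesis by (simp add: S_def superlevel_def)
qed

text \<open>The levels \<Lambda> (2 - 2^(-n)) stay below 2 \<Lambda>, while the scale t = t0 r^n
  shrinks. The inductive bound T r^(d n) equals a t^d, precisely the smallness that licenses the
  next step. As it tends to 0, \<open>\<mu>\<close> vanishes at 2 \<Lambda>.\<close>

lemma De_Giorgi_iteration:
  fixes \<mu> :: "real \<Rightarrow> real" and d :: nat
  assumes nonneg: "\<And>l. \<mu> l \<ge> 0" and anti: "\<And>l l'. l \<le> l' \<Longrightarrow> \<mu> l' \<le> \<mu> l"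
    and lim: "(\<lambda>n. \<mu> (real n)) \<longlonglongrightarrow> 0"
    and pos: "a > 0" "t0 > 0" "C \<ge> 0" "d \<ge> 1" "P > 0" "s * P > real d"
    and rec: "\<And>\<kappa> l t. \<kappa> > 0 \<Longrightarrow> l \<ge> 0 \<Longrightarrow> 0 < t \<Longrightarrow> t \<le> t0 \<Longrightarrow> \<mu> l \<le> a * t ^ d \<Longrightarrow> \<mu> (\<kappa> + l) \<le> C * (t powr s / \<kappa>) powr P"
  shows "\<exists>l. \<mu> l = 0"
proof -
  \<comment> \<open>Solves r^(s P) 2^P = r^d: the loss 2^P from halving \<open>\<kappa>\<close> is
    balanced so that each step reproduces the decay which the next one requires. The condition s P >
    d gives r < 1.\<close>
  define r where "r = 2 powr (- P / (s * P - real d))"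
  have r: "0 < r" "r < 1"
    using pos by (auto simp: r_def powr_less_one divide_neg_pos)
  have r_pow: "r powr (s * P) * 2 powr P = r ^ d"
  proof -
    have "r powr (s * P - real d) = 2 powr (- P)" using pos by (simp add: r_def powr_powr)
    then have "r powr (s * P) = 2 powr (- P) * r powr real d"
      using r by (simp add: powr_diff field_simps)
    then show ?thesis using r by (simp add: powr_minus powr_realpow)
  qed
  define T where "T = a * t0 ^ d"
  have T: "T > 0" using pos by (simp add: T_def)
  have "((\<lambda>n. C * (t0 powr (s * P) * 2 powr P) * real n powr (- P)) \<longlonglongrightarrow> C * (t0 powr (s * P) * 2 powr P) * 0)"
    using pos by (intro tendsto_intros tendsto_neg_powr filterlim_real_sequentially) auto
  then have "eventually (\<lambda>n. C * (t0 powr (s * P) * 2 powr P) * real n powr (- P) < T * r ^ d) sequentially"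
    using T r by (intro order_tendstoD) auto
  moreover have "eventually (\<lambda>n. \<mu> (real n) < T) sequentially"
    using lim T by (intro order_tendstoD) auto
  ultimately have "eventually (\<lambda>n. n \<ge> 1 \<and> \<mu> (real n) < T \<and>
      C * (t0 powr (s * P) * 2 powr P) * real n powr (- P) < T * r ^ d) sequentially"
    using eventually_ge_at_top[of 1] by eventually_elim auto
  \<comment> \<open>The starting level has to do two things: bring \<open>\<mu>\<close> below T, and
    make the recursion constant times m^(-P) small enough for the induction step to close.\<close>
  then obtain m where m: "m \<ge> 1" "\<mu> (real m) < T"
    "C * (t0 powr (s * P) * 2 powr P) * real m powr (- P) < T * r ^ d"
    by (auto simp: eventually_sequentially)
  define \<Lambda> where "\<Lambda> = real m"
  have \<Lambda>: "\<Lambda> \<ge> 1" using m by (simp add: \<Lambda>_def)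
  have step: "\<mu> (\<Lambda> * (2 - (1/2) ^ n)) \<le> T * (r ^ d) ^ n" for n
  proof (induction n)
    case 0
    then show ?case using m by (simp add: \<Lambda>_def)
  next
    case (Suc n)
    define t where "t = t0 * r ^ n"
    define \<kappa> where "\<kappa> = \<Lambda> * (1/2) ^ Suc n"
    have t: "t > 0" "t \<le> t0" using pos r by (auto simp: t_def power_le_one mult_left_le)
    have \<kappa>: "\<kappa> > 0" using \<Lambda> by (simp add: \<kappa>_def)
    have l: "\<Lambda> * (2 - (1/2) ^ n) \<ge> 0"
      using \<Lambda> power_le_one[of "1/2::real" n] by (intro mult_nonneg_nonneg) auto
    have "T * (r ^ d) ^ n = a * t ^ d"
      by (simp add: T_def t_def power_mult_distrib power_mult[symmetric] mult.commute)
    then have "\<mu> (\<Lambda> * (2 - (1/2) ^ n)) \<le> a * t ^ d" using Suc.IH by simp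
    from rec[OF \<kappa> l t this]
    have "\<mu> (\<kappa> + \<Lambda> * (2 - (1/2) ^ n)) \<le> C * (t powr s / \<kappa>) powr P" .
    also have "\<kappa> + \<Lambda> * (2 - (1/2) ^ n) = \<Lambda> * (2 - (1/2) ^ Suc n)" by (simp add: \<kappa>_def algebra_simps)
    also have "C * (t powr s / \<kappa>) powr P = C * (t0 powr (s * P) * 2 powr P) * \<Lambda> powr (- P) * (r ^ d) ^ n"
    proof -
      have "t powr s = t0 powr s * (r ^ n) powr s" using pos r by (simp add: t_def powr_mult)
      moreover have "1 / \<kappa> = 2 * 2 ^ n / \<Lambda>" by (simp add: \<kappa>_def power_divide field_simps)
      moreover have "t powr s / \<kappa> = t powr s * (1 / \<kappa>)" by simp
      ultimately have "t powr s / \<kappa> = (t0 powr s * 2) * ((r ^ n) powr s * 2 ^ n) / \<Lambda>"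
        by (simp only: times_divide_eq_right ac_simps)
      then have "(t powr s / \<kappa>) powr P = ((t0 powr s * 2) powr P * ((r ^ n) powr s * 2 ^ n) powr P) / \<Lambda> powr P"
        using pos r \<Lambda> by (simp add: powr_divide powr_mult)
      also have "(t0 powr s * 2) powr P = t0 powr (s * P) * 2 powr P"
        using pos by (simp add: powr_mult powr_powr)
      also have "((r ^ n) powr s * 2 ^ n) powr P = (r powr (s * P) * 2 powr P) ^ n"
      proof -
        have "((r ^ n) powr s * 2 ^ n) powr P = (r powr (real n)) powr (s * P) * (2 powr (real n)) powr P"
          using r by (simp add: powr_mult powr_powr powr_realpow)
        also have "\<dots> = (r powr (s * P) * 2 powr P) powr real n"
          using r by (simp add: powr_mult powr_powr mult.commute)
        also have "\<dots> = (r powr (s * P) * 2 powr P) ^ n" using r by (simp add: powr_realpow)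
        finally show ?thesis .
      qed
      finally have "(t powr s / \<kappa>) powr P = t0 powr (s * P) * 2 powr P * (r ^ d) ^ n / \<Lambda> powr P"
        unfolding r_pow .
      then show ?thesis by (simp only: powr_minus divide_inverse ac_simps)
    qed
    also have "\<dots> \<le> T * r ^ d * (r ^ d) ^ n"
      using m(3) r by (intro mult_right_mono) (auto simp: \<Lambda>_def)
    finally show ?case by (simp add: mult.assoc)
  qed
  have "\<mu> (2 * \<Lambda>) \<le> 0"
  proof (rule LIMSEQ_le_const)
    have "r ^ d < 1" using r pos power_strict_decreasing[of 0 d r] by simp
    then have "(\<lambda>n. T * (r ^ d) ^ n) \<longlonglongrightarrow> T * 0"
      using r by (intro tendsto_intros LIMSEQ_realpow_zero) auto
    then show "(\<lambda>n. T * (r ^ d) ^ n) \<longlonglongrightarrow> 0" by simp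
    have "\<mu> (2 * \<Lambda>) \<le> T * (r ^ d) ^ n" for n
    proof -
      have "\<Lambda> * (2 - (1/2) ^ n) \<le> \<Lambda> * 2" using \<Lambda> by (intro mult_left_mono) auto
      then show ?thesis using anti[of "\<Lambda> * (2 - (1/2) ^ n)" "2 * \<Lambda>"] step[of n] by simp
    qed
    then show "\<exists>N. \<forall>n\<ge>N. \<mu> (2 * \<Lambda>) \<le> T * (r ^ d) ^ n" by blast
  qed
  then show ?thesis using nonneg[of "2 * \<Lambda>"] by (intro exI[of _ "2 * \<Lambda>"]) simp
qed

text \<open>Decay of order e permits the choice t = \<open>\<tau> l\<close> with a t^d = K l^(-e).
  The recursion then yields the exponent e s p / d + p, which is at least e + p because s p >= d.
  The level grows by the factor b in each step, so the outcome is polynomial decay, but of any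
  order.\<close>

lemma superlevel_decay_iteration:
  fixes \<mu> :: "real \<Rightarrow> real" and d :: nat
  assumes nonneg: "\<And>l. \<mu> l \<ge> 0" and anti: "\<And>l l'. l \<le> l' \<Longrightarrow> \<mu> l' \<le> \<mu> l"
    and pos: "a > 0" "t0 > 0" "C \<ge> 0" "d \<ge> 1" "p > 0" "s * p \<ge> real d" "b \<ge> 1"
    and rec: "\<And>l t. l \<ge> 1 \<Longrightarrow> 0 < t \<Longrightarrow> t \<le> t0 \<Longrightarrow> \<mu> l \<le> a * t ^ d \<Longrightarrow> \<mu> (b * l) \<le> C * (t powr s / l) powr p"
    and init: "\<exists>K\<ge>0. \<forall>l\<ge>1. \<mu> l \<le> K * l powr (- p)"
  shows "\<exists>K\<ge>0. \<forall>l\<ge>1. \<mu> l \<le> K * l powr (- (real (Suc n) * p))"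
proof (induction n)
  case 0
  then show ?case using init by simp
next
  case (Suc n)
  define e where "e = real (Suc n) * p"
  have e: "e > 0" using pos by (simp add: e_def)
  obtain K0 where K0: "K0 \<ge> 0" "\<And>l. l \<ge> 1 \<Longrightarrow> \<mu> l \<le> K0 * l powr (- e)" using Suc.IH by (auto simp: e_def)
  \<comment> \<open>Positivity of \<open>K\<close> keeps \<open>\<tau> l\<close> positive.\<close>
  define K where "K = K0 + 1"
  have K: "K > 0" "\<And>l. l \<ge> 1 \<Longrightarrow> \<mu> l \<le> K * l powr (- e)"
  proof -
    show "K > 0" using K0 by (simp add: K_def)
    show "\<mu> l \<le> K * l powr (- e)" if "l \<ge> 1" for l
      using K0(2)[OF that] by (simp add: K_def distrib_right add_increasing2)
  qed
  define \<tau> where "\<tau> = (\<lambda>l. (K / a) powr (1 / real d) * l powr (- (e / real d)))"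
  have "(\<tau> \<longlongrightarrow> (K / a) powr (1 / real d) * 0) at_top"
    unfolding \<tau>_def using e pos by (intro tendsto_intros tendsto_neg_powr filterlim_ident) auto
  then have "eventually (\<lambda>l. \<tau> l < t0) at_top" using pos by (intro order_tendstoD) auto
  then have "eventually (\<lambda>l. 1 \<le> l \<and> \<tau> l < t0) at_top"
    using eventually_ge_at_top[of 1] by eventually_elim auto
  then obtain l0 where l0: "\<And>l. l \<ge> l0 \<Longrightarrow> 1 \<le> l \<and> \<tau> l < t0" by (auto simp: eventually_at_top_linorder)
  have l01: "l0 \<ge> 1" using l0 by blast
  define e' where "e' = real (Suc (Suc n)) * p"
  have e': "e' > 0" "e' = e + p" 
  proof -
    show "e' > 0" using pos by (simp add: e'_def)
    show "e' = e + p" by (simp add: e'_def e_def algebra_simps)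
  qed
  define C' where "C' = C * (K / a) powr (s * p / real d)"
  have C': "C' \<ge> 0" using pos by (simp add: C'_def)
  have large: "\<mu> (b * l) \<le> C' * l powr (- e')" if l: "l \<ge> l0" for l
  proof -
    have l1: "l \<ge> 1" "\<tau> l \<le> t0" using l0[OF l] by auto
    have \<tau>0: "\<tau> l > 0" using K pos l1 by (simp add: \<tau>_def)
    have "a * \<tau> l ^ d = K * l powr (- e)"
    proof -
      have "\<tau> l ^ d = \<tau> l powr real d" using \<tau>0 by (simp add: powr_realpow)
      also have "\<dots> = (K / a) * l powr (- e)"
        using K pos l1 by (simp add: \<tau>_def powr_mult powr_powr)
      finally show ?thesis using pos by simp
    qed
    then have "\<mu> (b * l) \<le> C * (\<tau> l powr s / l) powr p"
      using K(2)[OF l1(1)] by (intro rec l1 \<tau>0) simp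
    also have "(\<tau> l powr s / l) powr p = (K / a) powr (s * p / real d) * l powr (- (e * (s * p) / real d) - p)"
    proof -
      have "\<tau> l powr s / l = (K / a) powr (s / real d) * l powr (- (e / real d) * s - 1)"
        using K pos l1 by (simp add: \<tau>_def powr_mult powr_powr powr_diff)
      then show ?thesis using K pos l1 by (simp add: powr_mult powr_powr algebra_simps)
    qed
    also have "C * \<dots> \<le> C * ((K / a) powr (s * p / real d) * l powr (- e'))"
    proof (intro mult_left_mono powr_mono)
      have "e * 1 \<le> e * (s * p / real d)" using e pos by (intro mult_left_mono) auto
      then show "- (e * (s * p) / real d) - p \<le> - e'" using e' by simp
    qed (use pos l1 in auto)
    finally show ?thesis by (simp add: C'_def)
  qed
  \<comment> \<open>The first summand serves y >= b l0. For smaller y, \<open>\<mu> y\<close> is at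
    most \<open>\<mu> 1\<close> while y^(-e') is bounded from below.\<close>
  define M where "M = C' * b powr e' + \<mu> 1 * (b * l0) powr e'"
  have "\<mu> y \<le> M * y powr (- e')" if y: "y \<ge> 1" for y
  proof (cases "y \<ge> b * l0")
    case True
    have "l0 \<le> y / b" using True pos by (simp add: field_simps)
    from large[OF this] have "\<mu> y \<le> C' * (y / b) powr (- e')" using pos by simp
    also have "\<dots> = C' * b powr e' * y powr (- e')"
      using pos y by (simp add: powr_divide powr_minus field_simps)
    also have "\<dots> \<le> M * y powr (- e')"
      using nonneg by (intro mult_right_mono) (auto simp: M_def)
    finally show ?thesis .
  next
    case False
    have "\<mu> y \<le> \<mu> 1 * 1" using anti[OF y] by simp
    also have "1 \<le> (b * l0) powr e' * y powr (- e')"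
    proof -
      have "y powr e' \<le> (b * l0) powr e'" using False y e' by (intro powr_mono2) auto
      then show ?thesis using y by (simp add: powr_minus field_simps)
    qed
    then have "\<mu> 1 * 1 \<le> \<mu> 1 * ((b * l0) powr e' * y powr (- e'))" using nonneg by (intro mult_left_mono) auto
    also have "\<dots> \<le> M * y powr (- e')"
      unfolding M_def mult.assoc[symmetric] using C' by (intro mult_right_mono) auto
    finally show ?thesis .
  qed
  moreover have "M \<ge> 0" using C' nonneg by (simp add: M_def)
  ultimately show ?case unfolding e'_def by blast
qed

text \<open>Dyadic layers: where 2^n < |u| <= 2^(n+1), the integrand is at most 2^((n+1) R), on a
  set of measure at most K 2^(-n (R+1)). The resulting series is K 2^R times the geometric series
  with ratio 1/2. Where |u| <= 1, the finite measure of \<open>U\<close> suffices.\<close>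

lemma Lp_norm_finite_of_superlevel_decay:
  assumes U: "U \<in> lmeasurable" and u: "u \<in> borel_measurable (lebesgue_on U)" and R: "R > 0" and K: "K \<ge> 0"
    and decay: "\<And>l. l \<ge> 1 \<Longrightarrow> superlevel U u l \<le> K * l powr (- (R + 1))"
  shows "Lp_norm (ennreal R) U u < \<infinity>"
proof -
  have Us: "U \<in> sets lebesgue" using U by auto
  define S where "S = (\<lambda>n::nat. {x \<in> U. \<bar>u x\<bar> > 2 ^ n})"
  have Sm: "S n \<in> lmeasurable" for n unfolding S_def by (rule superlevel_lmeasurable[OF U u])
  then have Ss: "S n \<in> sets (lebesgue_on U)" for n
    using Us by (auto simp: sets_restrict_space_iff S_def)
  define f where "f = (\<lambda>n x. ennreal ((2 ^ Suc n) powr R) * indicator (S n) x)"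
  have pw: "ennreal (\<bar>u x\<bar> powr R) \<le> 1 + (\<Sum>n. f n x)" if x: "x \<in> U" for x
  proof (cases "\<bar>u x\<bar> \<le> 1")
    case True
    then have "ennreal (\<bar>u x\<bar> powr R) \<le> 1" using R powr_le1[of R "\<bar>u x\<bar>"] by simp
    then show ?thesis by (simp add: add_increasing2)
  next
    case False
    define n where "n = (LEAST n. \<bar>u x\<bar> \<le> 2 ^ Suc n)"
    obtain n0 where "\<bar>u x\<bar> < 2 ^ n0" using real_arch_pow[of 2 "\<bar>u x\<bar>"] by auto
    then have "\<bar>u x\<bar> \<le> 2 ^ Suc n0" by simp
    then have n: "\<bar>u x\<bar> \<le> 2 ^ Suc n" unfolding n_def by (rule LeastI)
    have "2 ^ n < \<bar>u x\<bar>"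
    proof (cases n)
      case 0 then show ?thesis using False by simp
    next
      case (Suc m)
      then have "m < (LEAST n. \<bar>u x\<bar> \<le> 2 ^ Suc n)" unfolding n_def by simp
      from not_less_Least[OF this] have "\<not> \<bar>u x\<bar> \<le> 2 ^ Suc m" .
      then show ?thesis using Suc by simp
    qed
    then have "x \<in> S n" using x by (simp add: S_def)
    then have "ennreal (\<bar>u x\<bar> powr R) \<le> f n x"
      using n R by (simp add: f_def del: power_Suc) (intro ennreal_leI powr_mono2, auto)
    also have "\<dots> \<le> (\<Sum>n. f n x)"
      using sum_le_suminf[of "\<lambda>n. f n x" "{n}"] by simp
    finally show ?thesis by (simp add: add_increasing)
  qed
  have fm[measurable]: "f n \<in> borel_measurable (lebesgue_on U)" for n
    unfolding f_def using Ss by measurable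
  have "(\<integral>\<^sup>+x. ennreal (\<bar>u x\<bar> powr R) \<partial>lebesgue_on U) \<le> (\<integral>\<^sup>+x. 1 + (\<Sum>n. f n x) \<partial>lebesgue_on U)"
    using pw by (intro nn_integral_mono) auto
  also have "\<dots> = emeasure (lebesgue_on U) U + (\<Sum>n. \<integral>\<^sup>+x. f n x \<partial>lebesgue_on U)"
    by (subst nn_integral_add) (auto simp: nn_integral_suminf)
  also have "(\<Sum>n. \<integral>\<^sup>+x. f n x \<partial>lebesgue_on U) \<le> (\<Sum>n. ennreal (K * 2 powr R * (1/2) ^ n))"
  proof (intro suminf_le)
    fix n
    have "(\<integral>\<^sup>+x. f n x \<partial>lebesgue_on U) = ennreal ((2 ^ Suc n) powr R) * emeasure (lebesgue_on U) (S n)"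
      unfolding f_def using Ss by (simp add: nn_integral_cmult_indicator)
    also have "emeasure (lebesgue_on U) (S n) = ennreal (superlevel U u (2 ^ n))"
      using Sm[of n] Us by (subst emeasure_restrict_space) (auto simp: superlevel_def S_def emeasure_eq_measure2)
    also have "ennreal ((2 ^ Suc n) powr R) * \<dots> \<le> ennreal ((2 ^ Suc n) powr R) * ennreal (K * (2 ^ n) powr (- (R + 1)))"
      by (intro mult_left_mono ennreal_leI decay) auto
    also have "\<dots> = ennreal (K * 2 powr R * (1/2) ^ n)"
    proof -
      have "(2 ^ Suc n) powr R * (K * (2 ^ n) powr (- (R + 1))) = K * 2 powr R * ((2 ^ n) powr R * (2 ^ n) powr (- (R + 1)))"
        by (simp add: powr_mult)
      also have "(2 ^ n) powr R * (2 ^ n) powr (- (R + 1)) = (2 ^ n) powr (R + - (R + 1) :: real)"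
        by (rule powr_add[symmetric])
      also have "\<dots> = (1/2 :: real) ^ n" by (simp add: powr_minus power_one_over inverse_eq_divide)
      finally show ?thesis using K by (simp add: ennreal_mult[symmetric])
    qed
    finally show "(\<integral>\<^sup>+x. f n x \<partial>lebesgue_on U) \<le> ennreal (K * 2 powr R * (1/2) ^ n)" .
  qed auto
  also have "\<dots> = ennreal (\<Sum>n. K * 2 powr R * (1/2) ^ n)"
    using K by (intro suminf_ennreal2 summable_mult summable_geometric) auto
  finally have "(\<integral>\<^sup>+x. ennreal (\<bar>u x\<bar> powr R) \<partial>lebesgue_on U) \<le> emeasure (lebesgue_on U) U + ennreal (\<Sum>n. K * 2 powr R * (1/2) ^ n)"
    by (simp add: add_left_mono)
  also have "\<dots> < \<infinity>"
    using U Us by (simp add: emeasure_restrict_space emeasure_eq_measure2)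
  finally show ?thesis using R by (simp add: Lp_norm_def)
qed

text \<open>Hoelder's inequality for |f|^P = |f|^(\<alpha> p) |f|^((1 - \<alpha>) R). The weights
  combine the exponents themselves instead of their reciprocals, which makes it easy to solve for R
  later.\<close>

lemma Lp_norm_interpolate:
  assumes [measurable]: "f \<in> borel_measurable (lebesgue_on U)" and pos: "p > 0" "R > 0" "0 < \<alpha>" "\<alpha> < 1"
    and P: "P = \<alpha> * p + (1 - \<alpha>) * R"
  shows "Lp_norm (ennreal P) U f
    \<le> ennreal_rpow (Lp_norm (ennreal p) U f) (\<alpha> * p / P) * ennreal_rpow (Lp_norm (ennreal R) U f) ((1 - \<alpha>) * R / P)"
proof -
  have P0: "P > 0" unfolding P using pos by (intro add_pos_pos mult_pos_pos) auto
  define F where "F = (\<lambda>r. \<integral>\<^sup>+x. ennreal (\<bar>f x\<bar> powr r) \<partial>lebesgue_on U)"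
  have L: "Lp_norm (ennreal r) U f = ennreal_rpow (F r) (1 / r)" if "r > 0" for r
    using that by (simp add: Lp_norm_def F_def)
  have "F P = (\<integral>\<^sup>+x. ennreal_rpow (ennreal (\<bar>f x\<bar> powr p)) \<alpha> * ennreal_rpow (ennreal (\<bar>f x\<bar> powr R)) (1 - \<alpha>) \<partial>lebesgue_on U)"
    unfolding F_def P
    by (intro nn_integral_cong) (simp add: ennreal_rpow_ennreal powr_powr ennreal_mult[symmetric] powr_add mult.commute)
  also have "\<dots> \<le> ennreal_rpow (F p) \<alpha> * ennreal_rpow (F R) (1 - \<alpha>)"
    unfolding F_def using pos by (intro nn_integral_Holder) auto
  finally have "ennreal_rpow (F P) (1 / P) \<le> ennreal_rpow (ennreal_rpow (F p) \<alpha> * ennreal_rpow (F R) (1 - \<alpha>)) (1 / P)"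
    using P0 by (intro ennreal_rpow_mono) auto
  then show ?thesis using pos P0 by (simp add: L ennreal_rpow_mult ennreal_rpow_rpow)
qed

text \<open>With \<theta> = j / k the exponent is p / \<theta>. In |f|^(p / \<theta>) = |f|^p |f|^(p
  / \<theta> - p) the second factor is pulled out at its essential supremum.\<close>

lemma Lp_norm_interpolate_Linf:
  assumes [measurable]: "f \<in> borel_measurable (lebesgue_on U)" and p: "p > 0" and jk: "0 < j" "j < k"
  shows "Lp_norm (p * of_nat k / of_nat j) U f
    \<le> ennreal_rpow (Lp_norm p U f) (real j / real k) * ennreal_rpow (Lp_norm \<infinity> U f) (1 - real j / real k)"
proof (cases "p = \<infinity>")
  case True
  then show ?thesis using jk by (simp add: exponent_top ennreal_rpow_add)
next
  case False
  then obtain r where r: "p = ennreal r" "r > 0" using p by (cases p) auto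
  define \<theta> where "\<theta> = real j / real k"
  have \<theta>: "0 < \<theta>" "\<theta> < 1" using jk by (auto simp: \<theta>_def)
  have e: "p * of_nat k / of_nat j = ennreal (r / \<theta>)"
    using r jk by (simp add: exponent_ennreal \<theta>_def)
  define M where "M = Lp_norm \<infinity> U f"
  have AE: "AE x in lebesgue_on U. ennreal \<bar>f x\<bar> \<le> M"
    unfolding M_def Lp_norm_def by (simp add: esssup_AE)
  define b where "b = r / \<theta> - r"
  have b: "b > 0" using r \<theta> by (simp add: b_def field_simps)
  have "(\<integral>\<^sup>+x. ennreal (\<bar>f x\<bar> powr (r / \<theta>)) \<partial>lebesgue_on U)
    \<le> (\<integral>\<^sup>+x. ennreal (\<bar>f x\<bar> powr r) * ennreal_rpow M b \<partial>lebesgue_on U)"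
  proof (intro nn_integral_mono_AE)
    show "AE x in lebesgue_on U. ennreal (\<bar>f x\<bar> powr (r / \<theta>)) \<le> ennreal (\<bar>f x\<bar> powr r) * ennreal_rpow M b"
      using AE
    proof eventually_elim
      case (elim x)
      have "ennreal (\<bar>f x\<bar> powr (r / \<theta>)) = ennreal (\<bar>f x\<bar> powr r) * ennreal_rpow (ennreal \<bar>f x\<bar>) b"
        by (simp add: ennreal_rpow_ennreal ennreal_mult[symmetric] powr_add[symmetric] b_def)
      also have "\<dots> \<le> ennreal (\<bar>f x\<bar> powr r) * ennreal_rpow M b"
        using elim b by (intro mult_left_mono ennreal_rpow_mono) auto
      finally show ?case .
    qed
  qed
  also have "\<dots> = (\<integral>\<^sup>+x. ennreal (\<bar>f x\<bar> powr r) \<partial>lebesgue_on U) * ennreal_rpow M b"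
    by (rule nn_integral_multc) measurable
  finally have "ennreal_rpow (\<integral>\<^sup>+x. ennreal (\<bar>f x\<bar> powr (r / \<theta>)) \<partial>lebesgue_on U) (\<theta> / r)
    \<le> ennreal_rpow ((\<integral>\<^sup>+x. ennreal (\<bar>f x\<bar> powr r) \<partial>lebesgue_on U) * ennreal_rpow M b) (\<theta> / r)"
    using r \<theta> by (intro ennreal_rpow_mono) auto
  moreover have "b * (\<theta> / r) = 1 - \<theta>" using r \<theta> by (simp add: b_def field_simps)
  ultimately have "Lp_norm (ennreal (r / \<theta>)) U f \<le> ennreal_rpow (Lp_norm p U f) \<theta> * ennreal_rpow M (1 - \<theta>)"
    using r \<theta> by (simp add: Lp_norm_def ennreal_rpow_mult ennreal_rpow_rpow)
  then show ?thesis unfolding e by (simp add: M_def \<theta>_def)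
qed

lemma Linf_of_superlevel_0:
  assumes U: "U \<in> lmeasurable" and u: "u \<in> borel_measurable (lebesgue_on U)" and "superlevel U u l = 0"
  shows "Lp_norm \<infinity> U u < \<infinity>"
proof -
  note S = superlevel_lmeasurable[OF U u, of l]
  then have "{x \<in> U. \<bar>u x\<bar> > l} \<in> null_sets lebesgue"
    using assms(3) by (intro null_setsI) (auto simp: superlevel_def emeasure_eq_measure2)
  then have "AE x in lebesgue. x \<notin> {x \<in> U. \<bar>u x\<bar> > l}" by (rule AE_not_in)
  then have "AE x in lebesgue. x \<in> U \<longrightarrow> ennreal \<bar>u x\<bar> \<le> ennreal l"
    by eventually_elim (auto intro: ennreal_leI)
  then have "AE x in lebesgue_on U. ennreal \<bar>u x\<bar> \<le> ennreal l"
    using U by (subst AE_restrict_space_iff) auto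
  then have "esssup (lebesgue_on U) (\<lambda>x. ennreal \<bar>u x\<bar>) \<le> ennreal l"
    using u by (intro esssup_I) auto
  then show ?thesis by (simp add: Lp_norm_def le_less_trans)
qed

text \<open>Order 1 is decisive: as 2^1 - 1 = 1, the recursion leads from level l to l + \<kappa>,
  and summable increments end at a finite level. For k > 1 the level is multiplied by at least 2^k -
  1 >= 3 in each step and runs off to infinity.\<close>

lemma Linf_of_first_order_smoothness:
  fixes U :: "'a::euclidean_space set" and P s A :: real
  assumes U: "open U" "U \<in> lmeasurable" and atlas: "interior_cone_atlas F c \<rho> U"
    and u: "u \<in> borel_measurable (lebesgue_on U)"
    and P: "P > 0" and s: "s > 0" "s * P > DIM('a)" and A: "A \<ge> 0"
    and hyp: "\<And>t. t > 0 \<Longrightarrow> \<omega> 1 (ennreal P) U u t \<le> ennreal (A * t powr s)"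
  shows "Lp_norm \<infinity> U u < \<infinity>"
proof -
  obtain t0 a C where pos: "t0 > 0" "a > 0" "C \<ge> 0" and rec: "\<forall>\<kappa>>0. \<forall>l\<ge>0. \<forall>t>0. t \<le> t0 \<longrightarrow>
    superlevel U u l \<le> a * t ^ DIM('a) \<longrightarrow> superlevel U u (\<kappa> + (2 ^ 1 - 1) * l) \<le> C * (t powr s / \<kappa>) powr P"
    using superlevel_recursion[OF U atlas u P order.refl s(1) A hyp] by blast
  have "\<exists>l. superlevel U u l = 0"
  proof (rule De_Giorgi_iteration[OF superlevel_nonneg superlevel_antimono[OF U(2) u] superlevel_tendsto_0[OF U(2) u]
        pos(2,1,3) _ P s(2)])
    show "superlevel U u (\<kappa> + l) \<le> C * (t powr s / \<kappa>) powr P"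
      if "\<kappa> > 0" "l \<ge> 0" "0 < t" "t \<le> t0" "superlevel U u l \<le> a * t ^ DIM('a)" for \<kappa> l t
      using rec that by simp
  qed auto
  then show ?thesis using Linf_of_superlevel_0[OF U(2) u] by blast
qed

text \<open>
  For \<open>s \<ge> 1\<close> the exponents \<open>P = s p\<close> and \<open>\<alpha> < 1\<close> satisfy \<open>\<alpha> P > d\<close>, and \<open>R\<close> is chosen so that \<open>L\<^sub>P\<close> lies
  between \<open>L\<^sub>p\<close> and \<open>L\<^sub>R\<close> with weights that turn the rate \<open>t\<^sup>s\<close> into \<open>t\<^sup>\<alpha>\<close>.
\<close>

lemma Linf_embedding:
  fixes U :: "'a::euclidean_space set" and p s A :: real
  assumes U: "open U" "U \<in> lmeasurable" and atlas: "interior_cone_atlas F c \<rho> U"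
    and u: "u \<in> borel_measurable (lebesgue_on U)" and fin: "Lp_norm (ennreal p) U u < \<infinity>"
    and p: "p > 0" and s: "s > 0" "s * p > DIM('a)" and k: "k = nat \<lfloor>s\<rfloor> + 1" and A: "A \<ge> 0"
    and hyp: "\<And>t. t > 0 \<Longrightarrow> \<omega> k (ennreal p) U u t \<le> ennreal (A * t powr s)"
  shows "Lp_norm \<infinity> U u < \<infinity>"
proof (cases "s < 1")
  case True
  then have "k = 1" using k s by simp
  then show ?thesis using Linf_of_first_order_smoothness[OF U atlas u p s A] hyp by simp
next
  case False
  define d where "d = DIM('a)"
  have k1: "k \<ge> 1" using k by simp
  have d: "d \<ge> 1" by (simp add: d_def Suc_leI)
  obtain t0 a C where pos: "t0 > 0" "a > 0" "C \<ge> 0" and rec: "\<forall>\<kappa>>0. \<forall>l\<ge>0. \<forall>t>0. t \<le> t0 \<longrightarrow>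
    superlevel U u l \<le> a * t ^ DIM('a) \<longrightarrow> superlevel U u (\<kappa> + (2 ^ k - 1) * l) \<le> C * (t powr s / \<kappa>) powr p"
    using superlevel_recursion[OF U atlas u p k1 s(1) A hyp] by blast
  have decay: "\<exists>K\<ge>0. \<forall>l\<ge>1. superlevel U u l \<le> K * l powr (- (real (Suc n) * p))" for n
  proof (rule superlevel_decay_iteration[OF superlevel_nonneg superlevel_antimono[OF U(2) u] pos(2,1,3) d p])
    show "real d \<le> s * p" using s by (simp add: d_def)
    show "(1::real) \<le> 2 ^ k" by simp
    show "superlevel U u (2 ^ k * l) \<le> C * (t powr s / l) powr p"
      if "1 \<le> l" "0 < t" "t \<le> t0" "superlevel U u l \<le> a * t ^ d" for l t
    proof -
      \<comment> \<open>The increment \<kappa> is taken equal to l, which makes the new level 2^k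
        l.\<close>
      have "superlevel U u (l + (2 ^ k - 1) * l) \<le> C * (t powr s / l) powr p"
        using rec that by (simp add: d_def)
      then show ?thesis by (simp add: algebra_simps)
    qed
    obtain X where X: "Lp_norm (ennreal p) U u = ennreal X" "X \<ge> 0"
      using fin by (cases "Lp_norm (ennreal p) U u") auto
    have "superlevel U u l \<le> X powr p * l powr (- p)" if "l \<ge> 1" for l
      using superlevel_le_Lp_norm[OF U(2) u p _ X(2), of l] that X
      by (simp add: powr_divide powr_minus field_simps)
    then show "\<exists>K\<ge>0. \<forall>l\<ge>1. superlevel U u l \<le> K * l powr (- p)"
      using X by (intro exI[of _ "X powr p"]) auto
  qed
  have allfin: "Lp_norm (ennreal R) U u < \<infinity>" if R: "R > 0" for R
  proof -
    obtain n where n: "(R + 1) / p < real n" using reals_Archimedean2 by blast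
    then have n': "R + 1 \<le> real (Suc n) * p" using p by (simp add: field_simps)
    obtain K where K: "K \<ge> 0" "\<And>l. l \<ge> 1 \<Longrightarrow> superlevel U u l \<le> K * l powr (- (real (Suc n) * p))"
      using decay[of n] by blast
    have "superlevel U u l \<le> K * l powr (- (R + 1))" if l: "l \<ge> 1" for l
      using K(2)[OF l] mult_left_mono[OF powr_mono[of "- (real (Suc n) * p)" "- (R + 1)" l] K(1)] n' l
      by linarith
    then show ?thesis by (intro Lp_norm_finite_of_superlevel_decay[OF U(2) u R K(1)])
  qed
  define y where "y = real d / (s * p)"
  \<comment> \<open>The midpoint between y = d / (s p) and 1: \<alpha> < 1 lets Marchaud's
    inequality descend to order 1, and \<alpha> > y keeps \<alpha> P above the dimension.\<close>
  define \<alpha> where "\<alpha> = (y + 1) / 2"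
  have sp: "s * p > 0" using s p by simp
  have dsp: "y < 1" using s sp by (simp add: d_def y_def)
  have \<alpha>: "y < \<alpha>" "\<alpha> < 1" using dsp by (simp_all add: \<alpha>_def)
  have "0 < y" using sp d by (simp add: y_def)
  then have \<alpha>0: "\<alpha> > 0" using \<alpha> by linarith
  define P where "P = s * p"
  \<comment> \<open>With P = s p the power \<alpha> p / P is \<alpha> / s. R is the solution of P =
    \<alpha> p + (1 - \<alpha>) R, positive because s >= 1 > \<alpha>.\<close>
  define R where "R = p * (s - \<alpha>) / (1 - \<alpha>)"
  have P: "P > 0" using sp by (simp add: P_def)
  have R: "R > 0" using False \<alpha> p by (simp add: R_def)
  have "(1 - \<alpha>) * R = p * (s - \<alpha>)" using \<alpha> by (simp add: R_def)
  then have PR: "P = \<alpha> * p + (1 - \<alpha>) * R" by (simp add: P_def algebra_simps)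
  define B where "B = ennreal (quasi_const (ennreal R) (Suc k) * 2 ^ k) * Lp_norm (ennreal R) U u"
  have B: "B < \<infinity>" using allfin[OF R] by (simp add: B_def ennreal_mult_less_top)
  define B' where "B' = ennreal_rpow B ((1 - \<alpha>) * R / P)"
  have B': "B' < \<infinity>" using B by (simp add: B'_def)
  have \<omega>P: "\<omega> k (ennreal P) U u t \<le> ennreal (A powr (\<alpha> / s) * t powr \<alpha>) * B'" if t: "t > 0" for t
    unfolding modulus_smoothness_def[of k "ennreal P"]
  proof (rule SUP_least, clarify)
    fix h :: 'a assume h: "norm h \<le> t"
    have "Lp_norm (ennreal P) U (diff_op U k h u) \<le>
      ennreal_rpow (Lp_norm (ennreal p) U (diff_op U k h u)) (\<alpha> * p / P) *
      ennreal_rpow (Lp_norm (ennreal R) U (diff_op U k h u)) ((1 - \<alpha>) * R / P)"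
      by (intro Lp_norm_interpolate measurable_diff_op_lebesgue_on U u p R \<alpha>0 \<alpha> PR)
    also have "\<dots> \<le> ennreal_rpow (ennreal (A * t powr s)) (\<alpha> * p / P) * B'"
      unfolding B'_def
    proof (intro mult_mono ennreal_rpow_mono)
      show "Lp_norm (ennreal p) U (diff_op U k h u) \<le> ennreal (A * t powr s)"
        using Lp_norm_diff_op_le_modulus[OF h] hyp[OF t] by (rule order.trans)
      show "Lp_norm (ennreal R) U (diff_op U k h u) \<le> B"
        unfolding B_def using R
        by (intro order.trans[OF Lp_norm_diff_op_le_modulus[OF h] modulus_smoothness_le_Lp_norm[OF U(1) u]]) simp
    qed (use \<alpha> \<alpha>0 p P R in auto)
    also have "ennreal_rpow (ennreal (A * t powr s)) (\<alpha> * p / P) = ennreal (A powr (\<alpha> / s) * t powr \<alpha>)"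
      using A t s p by (simp add: ennreal_rpow_ennreal P_def powr_mult powr_powr)
    finally show "Lp_norm (ennreal P) U (diff_op U k h u) \<le> ennreal (A powr (\<alpha> / s) * t powr \<alpha>) * B'" .
  qed
  have "tnorm \<infinity> (wmodulus \<alpha> k (ennreal P) U u) \<le> ennreal (A powr (\<alpha> / s)) * B'"
  proof -
    have "wmodulus \<alpha> k (ennreal P) U u t \<le> ennreal (A powr (\<alpha> / s)) * B'"
      if t: "t > 0" for t
    proof -
      have "wmodulus \<alpha> k (ennreal P) U u t
        \<le> ennreal (t powr (- \<alpha>)) * (ennreal (A powr (\<alpha> / s) * t powr \<alpha>) * B')"
        by (intro mult_left_mono \<omega>P t) simp
      also have "\<dots> = ennreal (t powr (- \<alpha>) * (A powr (\<alpha> / s) * t powr \<alpha>)) * B'"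
        by (simp add: ennreal_mult mult.assoc)
      also have "t powr (- \<alpha>) * (A powr (\<alpha> / s) * t powr \<alpha>) = A powr (\<alpha> / s)"
        using t by (simp add: powr_minus)
      finally show ?thesis .
    qed
    then show ?thesis by (auto simp: tnorm_def intro!: SUP_least)
  qed
  also have "\<dots> < \<infinity>" using B' by (simp add: ennreal_mult_less_top)
  finally have "tnorm \<infinity> (wmodulus \<alpha> k (ennreal P) U u) < \<infinity>" .
  then have fin1: "tnorm \<infinity> (wmodulus \<alpha> 1 (ennreal P) U u) < \<infinity>"
    by (rule Marchaud[OF U(1) atlas _ _ \<alpha>0 _ k1 u allfin[OF P], rotated 3]) (use P \<alpha> in auto)
  then obtain X where X: "tnorm \<infinity> (wmodulus \<alpha> 1 (ennreal P) U u) = ennreal X" "X \<ge> 0"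
    by (cases "tnorm \<infinity> (wmodulus \<alpha> 1 (ennreal P) U u)") auto
  have "\<omega> 1 (ennreal P) U u t \<le> ennreal (X * t powr \<alpha>)" if t: "t > 0" for t
  proof -
    have "wmodulus \<alpha> 1 (ennreal P) U u t \<le> ennreal X"
      unfolding X(1)[symmetric] using t by (auto simp: tnorm_def intro!: SUP_upper)
    then show ?thesis using t X(2) by (rule le_powr_of_weighted_le[rotated 2])
  qed
  moreover have "\<alpha> * P > real DIM('a)" using \<alpha>(1) sp by (simp add: P_def y_def d_def field_simps)
  ultimately show ?thesis
    using Linf_of_first_order_smoothness[OF U atlas u P \<alpha>0 _ X(2)] by blast
qed

section \<open>Products\<close>

text \<open>Monotonicity of the modulus bounds its weighted supremum in t by the seminorm for every
  q, so the fine index disappears before the embedding is applied.\<close>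

lemma besov_imp_Linf:
  fixes U :: "'a::euclidean_space set"
  assumes U: "open U" "U \<in> lmeasurable" and atlas: "interior_cone_atlas F c \<rho> U"
    and s: "s > 0" and p: "p > 0" and q: "q > 0" and sp: "ennreal s > of_nat DIM('a) / p"
    and u: "u \<in> besov_space s q p U"
  shows "Lp_norm \<infinity> U u < \<infinity>"
proof (cases "p = \<infinity>")
  case True
  then show ?thesis using u by (simp add: besov_space_def Lp_space_def)
next
  case False
  then obtain r where r: "p = ennreal r" "r > 0" using p by (cases p) auto
  have m: "u \<in> borel_measurable (lebesgue_on U)" and fin: "Lp_norm (ennreal r) U u < \<infinity>"
    and sem: "besov_seminorm s q p U u < \<infinity>"
    using u r by (auto simp: besov_space_def Lp_space_def)
  define k where "k = nat \<lfloor>s\<rfloor> + 1"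
  have sem_eq: "besov_seminorm s q p U u = tnorm q (wmodulus s k p U u)"
    using s by (simp add: besov_seminorm_def besov_seminorm_pos_eq_tnorm k_def)
  define Y where "Y = ennreal (2 powr (s + 1 / enn2real q)) * besov_seminorm s q p U u"
  have "Y < \<infinity>" using sem by (simp add: Y_def ennreal_mult_less_top)
  then obtain A where A: "Y = ennreal A" "A \<ge> 0" by (cases Y) auto
  have "\<omega> k (ennreal r) U u t \<le> ennreal (A * t powr s)" if t: "t > 0" for t
  proof -
    have "wmodulus s k p U u t \<le> ennreal A"
      unfolding A(1)[symmetric] Y_def sem_eq using s t by (intro weighted_le_tnorm q modulus_smoothness_mono) auto
    then show ?thesis unfolding r(1) using t A(2) by (rule le_powr_of_weighted_le[rotated 2])
  qed
  moreover have "s * r > DIM('a)"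
  proof -
    have "ennreal (real DIM('a) / r) < ennreal s"
      using sp r by (simp add: ennreal_of_nat_eq_real_of_nat divide_ennreal)
    then show ?thesis using r s by (simp add: ennreal_less_iff field_simps)
  qed
  ultimately show ?thesis
    using Linf_embedding[OF U atlas m fin r(2) s _ k_def A(2)] by blast
qed

text \<open>Homogeneity: the power q k / j of g^(j/k) is g^q. This is the origin of the index q k /
  j.\<close>

lemma tnorm_rpow_le:
  assumes q: "q > 0" and [measurable]: "g \<in> borel_measurable borel" and jk: "0 < j" "j < k"
  shows "tnorm (q * of_nat k / of_nat j) (\<lambda>t. ennreal_rpow (g t) (real j / real k)) \<le> ennreal_rpow (tnorm q g) (real j / real k)"
proof (cases "q = \<infinity>")
  case True
  then show ?thesis using jk
    by (auto simp: exponent_top tnorm_def intro!: SUP_least ennreal_rpow_mono SUP_upper)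
next
  case False
  then obtain r where r: "q = ennreal r" "r > 0" using q by (cases q) auto
  then show ?thesis using jk
    by (simp add: exponent_ennreal tnorm_def ennreal_rpow_rpow)
qed

text \<open>Interpolation bounds the modulus of order k in the intermediate Lebesgue space by the
  power j / k of the one in L_p, the rest going into the L_inf norm. The order is then lowered from
  k to j, which Marchaud's inequality allows because s j / k < j.\<close>

lemma tnorm_intermediate_smoothness:
  fixes U :: "'a::euclidean_space set"
  assumes U: "open U" and atlas: "interior_cone_atlas F c \<rho> U"
    and s: "s > 0" and p: "p > 0" and q: "q > 0" and k: "k = nat \<lfloor>s\<rfloor> + 1" and jk: "0 < j" "j < k"
    and u: "u \<in> besov_space s q p U" and inf: "Lp_norm \<infinity> U u < \<infinity>"
  shows "tnorm (q * of_nat k / of_nat j) (wmodulus (s * real j / real k) j (p * of_nat k / of_nat j) U u) < \<infinity>"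
proof -
  define P where "P = p * of_nat k / of_nat j"
  define Q where "Q = q * of_nat k / of_nat j"
  define \<theta> where "\<theta> = real j / real k"
  have \<theta>: "0 < \<theta>" "\<theta> < 1" using jk by (auto simp: \<theta>_def)
  have PQ: "P > 0" "Q > 0" unfolding P_def Q_def using p q jk by (auto intro!: ennreal_exponent_pos)
  have m: "u \<in> borel_measurable (lebesgue_on U)" and fin: "Lp_norm p U u < \<infinity>"
    and sem: "besov_seminorm s q p U u < \<infinity>"
    using u by (auto simp: besov_space_def Lp_space_def)
  have sem_eq: "besov_seminorm s q p U u = tnorm q (wmodulus s k p U u)"
    using s by (simp add: besov_seminorm_def besov_seminorm_pos_eq_tnorm k)
  have finP: "Lp_norm P U u < \<infinity>"
    unfolding P_def
    by (rule order.strict_trans1[OF Lp_norm_interpolate_Linf[OF m p jk]])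
       (use fin inf in \<open>simp add: ennreal_mult_less_top\<close>)
  define B where "B = ennreal (quasi_const \<infinity> (Suc k) * 2 ^ k) * Lp_norm \<infinity> U u"
  have B: "B < \<infinity>" using inf by (simp add: B_def ennreal_mult_less_top)
  have interp: "\<omega> k P U u t \<le> ennreal_rpow (\<omega> k p U u t) \<theta> * ennreal_rpow B (1 - \<theta>)" for t
    unfolding modulus_smoothness_def[of k P]
  proof (rule SUP_least, clarify)
    fix h :: 'a assume h: "norm h \<le> t"
    have "Lp_norm P U (diff_op U k h u) \<le> ennreal_rpow (Lp_norm p U (diff_op U k h u)) \<theta>
        * ennreal_rpow (Lp_norm \<infinity> U (diff_op U k h u)) (1 - \<theta>)"
      unfolding P_def \<theta>_def by (intro Lp_norm_interpolate_Linf measurable_diff_op_lebesgue_on U m p jk)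
    also have "\<dots> \<le> ennreal_rpow (\<omega> k p U u t) \<theta> * ennreal_rpow B (1 - \<theta>)"
    proof (intro mult_mono ennreal_rpow_mono Lp_norm_diff_op_le_modulus h)
      show "Lp_norm \<infinity> U (diff_op U k h u) \<le> B"
        unfolding B_def using Lp_norm_diff_op_le_modulus[OF h] modulus_smoothness_le_Lp_norm[OF U m]
        by (rule order.trans) simp
    qed (use \<theta> in auto)
    finally show "Lp_norm P U (diff_op U k h u)
      \<le> ennreal_rpow (\<omega> k p U u t) \<theta> * ennreal_rpow B (1 - \<theta>)" .
  qed
  have "tnorm Q (wmodulus (s * real j / real k) k P U u)
    \<le> tnorm Q (\<lambda>t. ennreal_rpow B (1 - \<theta>) * ennreal_rpow (wmodulus s k p U u t) \<theta>)"
  proof (rule tnorm_mono)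
    fix t :: real assume t: "t > 0"
    have "ennreal (t powr (- (s * real j / real k))) = ennreal_rpow (ennreal (t powr (- s))) \<theta>"
      by (simp add: ennreal_rpow_ennreal powr_powr \<theta>_def)
    then show "wmodulus (s * real j / real k) k P U u t
      \<le> ennreal_rpow B (1 - \<theta>) * ennreal_rpow (wmodulus s k p U u t) \<theta>"
      using mult_left_mono[OF interp[of t], of "ennreal_rpow (ennreal (t powr (- s))) \<theta>"]
      by (simp add: ennreal_rpow_mult ac_simps)
  qed
  also have "\<dots> \<le> ennreal_rpow B (1 - \<theta>) * tnorm Q (\<lambda>t. ennreal_rpow (wmodulus s k p U u t) \<theta>)"
    by (intro tnorm_cmult_le PQ) measurable
  also have "\<dots> \<le> ennreal_rpow B (1 - \<theta>) * ennreal_rpow (besov_seminorm s q p U u) \<theta>"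
    unfolding sem_eq Q_def \<theta>_def by (intro mult_left_mono tnorm_rpow_le q jk) auto
  also have "\<dots> < \<infinity>" using B sem by (simp add: ennreal_mult_less_top)
  finally have hyp: "tnorm Q (wmodulus (s * real j / real k) k P U u) < \<infinity>" .
  have sk: "s < real k" using s k by linarith
  have "0 < s * real j / real k" "s * real j / real k < real j"
    using s sk jk by (auto simp: field_simps)
  then show ?thesis unfolding P_def[symmetric] Q_def[symmetric]
    using jk by (intro Marchaud[OF U atlas PQ _ _ _ m finP hyp]) auto
qed

lemma besov_space_mult:
  fixes U :: "'a::euclidean_space set"
  assumes U: "open U" "U \<in> lmeasurable" and atlas: "interior_cone_atlas F c \<rho> U"
    and s: "s > 0" and p: "p > 0" and q: "q > 0" and sp: "ennreal s > of_nat DIM('a) / p"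
    and u: "u \<in> besov_space s q p U" and v: "v \<in> besov_space s q p U"
  shows "(\<lambda>x. u x * v x) \<in> besov_space s q p U"
proof -
  define k where "k = nat \<lfloor>s\<rfloor> + 1"
  have k0: "k > 0" by (simp add: k_def)
  have m[measurable]: "u \<in> borel_measurable (lebesgue_on U)" "v \<in> borel_measurable (lebesgue_on U)"
    and fin: "Lp_norm p U u < \<infinity>" "Lp_norm p U v < \<infinity>"
    using u v by (auto simp: besov_space_def Lp_space_def)
  have inf: "Lp_norm \<infinity> U u < \<infinity>" "Lp_norm \<infinity> U v < \<infinity>"
    using besov_imp_Linf[OF U atlas s p q sp] u v by auto
  note top = exponent_0[OF p k0] and self = exponent_self[OF k0, of p]
  have "Lp_norm p U (\<lambda>x. u x * v x) \<le> Lp_norm \<infinity> U u * Lp_norm p U v"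
    using Lp_norm_Holder[OF p k0 _ m, of 0] top self by simp
  also have "\<dots> < \<infinity>" using inf fin by (simp add: ennreal_mult_less_top)
  finally have Lp: "(\<lambda>x. u x * v x) \<in> Lp_space p U" by (simp add: Lp_space_def)
  define w where "w = (\<lambda>j f t. wmodulus (s * real j / real k) j (p * of_nat k / of_nat j) U f t)"
  have [measurable]: "w j f \<in> borel_measurable borel" for j f
    unfolding w_def by measurable
  \<comment> \<open>At the ends no Hoelder inequality in t is used: the modulus of order 0 is
    bounded by the L_inf norm uniformly in t, and the other factor carries the whole
    seminorm.\<close>
  have end_term: "tnorm q (\<lambda>t. w 0 f t * w k g t) < \<infinity>"
    if f: "f \<in> besov_space s q p U" "Lp_norm \<infinity> U f < \<infinity>" and g: "g \<in> besov_space s q p U" for f g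
  proof -
    have "f \<in> borel_measurable (lebesgue_on U)" using f by (simp add: besov_space_def Lp_space_def)
    then have "w 0 f t \<le> Lp_norm \<infinity> U f" if "t > 0" for t
      using modulus_smoothness_0_le[OF U(1), of f \<infinity> t] that top by (simp add: w_def)
    then have "tnorm q (\<lambda>t. w 0 f t * w k g t) \<le> tnorm q (\<lambda>t. Lp_norm \<infinity> U f * w k g t)"
      by (intro tnorm_mono mult_right_mono) auto
    also have "\<dots> \<le> Lp_norm \<infinity> U f * tnorm q (w k g)" by (intro tnorm_cmult_le q) measurable
    also have "tnorm q (w k g) = besov_seminorm s q p U g"
    proof -
      have "w k g = (wmodulus s k p U g)"
        using k0 self by (simp add: w_def)
      then show ?thesis
        using s by (simp add: besov_seminorm_def besov_seminorm_pos_eq_tnorm k_def)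
    qed
    also have "Lp_norm \<infinity> U f * \<dots> < \<infinity>"
      using f g by (simp add: besov_space_def ennreal_mult_less_top)
    finally show ?thesis .
  qed
  have "tnorm q (\<lambda>t. w j u t * w (k - j) v t) < \<infinity>" if j: "j \<le> k" for j
  proof -
    consider "j = 0" | "j = k" | "0 < j" "j < k" using j by linarith
    then show ?thesis
    proof cases
      case 1
      then show ?thesis using end_term[OF u inf(1) v] by simp
    next
      case 2
      then show ?thesis using end_term[OF v inf(2) u] by (simp add: mult.commute)
    next
      case 3
      have "tnorm q (\<lambda>t. w j u t * w (k - j) v t)
        \<le> tnorm (q * of_nat k / of_nat j) (w j u) * tnorm (q * of_nat k / of_nat (k - j)) (w (k - j) v)"
        by (intro tnorm_Holder q 3) measurable
      also have "\<dots> < \<infinity>"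
      proof -
        have "tnorm (q * of_nat k / of_nat j) (w j u) < \<infinity>"
          unfolding w_def by (rule tnorm_intermediate_smoothness[OF U(1) atlas s p q k_def 3 u inf(1)])
        moreover have "tnorm (q * of_nat k / of_nat (k - j)) (w (k - j) v) < \<infinity>"
          unfolding w_def using 3 by (intro tnorm_intermediate_smoothness[OF U(1) atlas s p q k_def _ _ v inf(2)]) auto
        ultimately show ?thesis by (simp add: ennreal_mult_less_top)
      qed
      finally show ?thesis .
    qed
  qed
  then have "(\<Sum>j\<le>k. tnorm q (\<lambda>t. w j u t * w (k - j) v t)) < \<infinity>"
    by (simp add: ennreal_sum_less_top)
  then have "ennreal (quasi_const p (Suc k) * quasi_const q (Suc k) * 2 ^ k) *
       (\<Sum>j\<le>k. tnorm q (\<lambda>t. w j u t * w (k - j) v t)) < \<infinity>"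
    by (simp add: ennreal_mult_less_top)
  moreover have "besov_seminorm s q p U (\<lambda>x. u x * v x) \<le> ennreal (quasi_const p (Suc k) * quasi_const q (Suc k) * 2 ^ k) *
       (\<Sum>j\<le>k. tnorm q (\<lambda>t. w j u t * w (k - j) v t))"
    using tnorm_modulus_mult_le[OF U(1) m p q k0, of s] s
    by (simp add: w_def besov_seminorm_def besov_seminorm_pos_eq_tnorm k_def)
  ultimately show ?thesis using Lp unfolding besov_space_def by (auto intro: le_less_trans)
qed

text \<open>Dilation invariance of \<open>C\<close> is expressed by the order of the quantifiers:
  one \<open>C\<close> serves all dilates with r > 0, the case r = 1 being the domain itself.
  Membership involves no constant and is proved with the cones of each dilate.\<close>

theorem lemma9p1:
  fixes \<Omega> :: "'a::euclidean_space set"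
    and s :: real and p q :: ennreal and k :: nat
  assumes "bounded_lipschitz_domain \<Omega>"
    and "s > 0" and "p > 0" and "q > 0"
    and "ennreal s > of_nat DIM('a) / p"
    and "k = nat \<lfloor>s\<rfloor> + 1"
  shows "\<exists>C::real. C \<ge> 0 \<and>
    (\<forall>r>0. \<forall>u\<in>besov_space s q p ((\<lambda>x. r *\<^sub>R x) ` \<Omega>). \<forall>v\<in>besov_space s q p ((\<lambda>x. r *\<^sub>R x) ` \<Omega>).
       (\<lambda>x. u x * v x) \<in> besov_space s q p ((\<lambda>x. r *\<^sub>R x) ` \<Omega>) \<and>
       besov_seminorm s q p ((\<lambda>x. r *\<^sub>R x) ` \<Omega>) (\<lambda>x. u x * v x)
         \<le> ennreal C *
           (\<Sum>j\<le>k. besov_seminorm (s * real j / real k) q (p * of_nat k / of_nat j)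
                      ((\<lambda>x. r *\<^sub>R x) ` \<Omega>) u *
                   besov_seminorm (s * real (k - j) / real k) q (p * of_nat k / of_nat (k - j))
                      ((\<lambda>x. r *\<^sub>R x) ` \<Omega>) v))"
proof -
  \<comment> \<open>\<open>C\<close> is fixed before the open set, hence shared by all
    dilates.\<close>
  obtain C where C: "C \<ge> 0" and ineq: "\<And>(\<Omega> :: 'a set) u v. open \<Omega> \<Longrightarrow>
    u \<in> borel_measurable (lebesgue_on \<Omega>) \<Longrightarrow> v \<in> borel_measurable (lebesgue_on \<Omega>) \<Longrightarrow>
    besov_seminorm s q p \<Omega> (\<lambda>x. u x * v x) \<le> ennreal C *
      (\<Sum>j\<le>k. besov_seminorm (s * real j / real k) q (p * of_nat k / of_nat j) \<Omega> u *
              besov_seminorm (s * real (k - j) / real k) q (p * of_nat k / of_nat (k - j)) \<Omega> v)"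
    using besov_seminorm_mult_le[OF assms(2-4,6)] by blast
  obtain F c \<rho> where atlas: "interior_cone_atlas F c \<rho> \<Omega>"
    using bounded_lipschitz_domain_imp_atlas[OF assms(1)] by blast
  have \<Omega>: "open \<Omega>" "bounded \<Omega>" using assms(1) by (auto simp: bounded_lipschitz_domain_def)
  show ?thesis
  proof (intro exI[of _ C] conjI C allI impI ballI)
    fix r :: real and u v
    assume r: "r > 0" and u: "u \<in> besov_space s q p ((\<lambda>x. r *\<^sub>R x) ` \<Omega>)" and v: "v \<in> besov_space s q p ((\<lambda>x. r *\<^sub>R x) ` \<Omega>)"
    have o: "open ((\<lambda>x. r *\<^sub>R x) ` \<Omega>)" using r \<Omega> open_scaling[of r \<Omega>] by simp
    have lm: "(\<lambda>x. r *\<^sub>R x) ` \<Omega> \<in> lmeasurable"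
      using o bounded_scaling[OF \<Omega>(2)] by (intro lmeasurable_open) auto
    show "(\<lambda>x. u x * v x) \<in> besov_space s q p ((\<lambda>x. r *\<^sub>R x) ` \<Omega>)"
      by (rule besov_space_mult[OF o lm interior_cone_atlas_scale[OF atlas r] assms(2-5) u v])
    show "besov_seminorm s q p ((\<lambda>x. r *\<^sub>R x) ` \<Omega>) (\<lambda>x. u x * v x)
         \<le> ennreal C *
           (\<Sum>j\<le>k. besov_seminorm (s * real j / real k) q (p * of_nat k / of_nat j)
                      ((\<lambda>x. r *\<^sub>R x) ` \<Omega>) u *
                   besov_seminorm (s * real (k - j) / real k) q (p * of_nat k / of_nat (k - j))
                      ((\<lambda>x. r *\<^sub>R x) ` \<Omega>) v)"
      using u v by (intro ineq o) (auto simp: besov_space_def Lp_space_def)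
  qed
qed

end
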